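(* Let $M$ be a compact bordered Riemann surface, let $n\ge3$ be an integer, and let $f\colon M\to\mathfrak{A}_*$ be a map of class $\mathscr{A}(M)$, where $\mathfrak{A}_*=\{(z_1,\dots,z_n)\in\mathbb{C}^n:\sum_{j=1}^nz_j^2=0\}\setminus\{0\}$. Then the following hold. (i) For any integer $r\ge1$ the space of conformal minimal immersions $X\colon M\to\mathbb{R}^n$ of class $\mathscr{C}^r(M)$ with generalized Gauss map $G_X=\pi\circ f\colon M\to\mathbb{CP}^{n-1}$ is a real analytic Banach manifold with the natural $\mathscr{C}^r(M)$-topology. (ii) For any integer $r\ge1$ and any group homomorphism $\mathfrak{q}\colon H_1(M;\mathbb{Z})\to\mathrm{span}(f(M))\cap\{z\in\mathbb{C}^n:\Re(z)=0\}\subset\mathbb{C}^n$, the space of conformal minimal immersions $X\colon M\to\mathbb{R}^n$ of class $\mathscr{C}^r(M)$ with generalized Gauss map $G_X=\pi\circ f\colon M\to\mathbb{CP}^{n-1}$ and flux map $\mathrm{Flux}_X=i\,\mathfrak{q}\colon H_1(M;\mathbb{Z})\to\mathbb{R}^n$ is a real analytic Banach manifold.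
   Context: A compact bordered Riemann surface is a compact Riemann surface $M$ with nonempty boundary $bM\subset M$ consisting of finitely many pairwise disjoint smooth Jordan curves; $\mathring M=M\setminus bM$. A map is of class $\mathscr{A}(M)$ if it is continuous on $M$ and holomorphic on $\mathring M$. $\mathrm{span}$ denotes the $\mathbb{C}$-linear span and $\pi\colon\mathbb{C}^n\setminus\{0\}\to\mathbb{CP}^{n-1}$ is the canonical projection $\pi(z_1,\dots,z_n)=[z_1:\cdots:z_n]$. A conformal minimal immersion $X\colon M\to\mathbb{R}^n$ of class $\mathscr{C}^r(M)$ is a conformal immersion of class $\mathscr{C}^r$ on $M$ that is harmonic on $\mathring M$. With $\partial$ the $\mathbb{C}$-linear part of the exterior differential, its generalized Gauss map is $G_X(p)=[\partial X_1(p):\cdots:\partial X_n(p)]$, and its flux is the group homomorphism $\mathrm{Flux}_X\colon H_1(M;\mathbb{Z})\to\mathbb{R}^n$, $\mathrm{Flux}_X(\gamma)=\int_\gamma\Im(\partial X)=-i\int_\gamma\partial X$ for every closed curve $\gamma\subset M$. *)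

theory Defs
  imports "HOL-Homology.Homology" "HOL-Algebra.Module" "HOL-Analysis.Analysis"
begin

section \<open>Functions of class \<open>C\<^sup>r\<close> on plane sets\<close>

text \<open>
  Iterated real partial derivatives relative to a set \<open>S\<close>: a list over \<open>{1, \<i>}\<close> records the
  directions of differentiation. \<open>S\<close> will be a relatively open subset of the closed upper
  half-plane, where derivatives within \<open>S\<close> are unique; at boundary points they are one-sided.
\<close>

definition partials :: "complex set \<Rightarrow> complex list \<Rightarrow> (complex \<Rightarrow> 'b::real_normed_vector) \<Rightarrow> complex \<Rightarrow> 'b"
  where "partials S vs g = foldr (\<lambda>v h z. frechet_derivative h (at z within S) v) vs g"

definition Ck_on :: "nat \<Rightarrow> complex set \<Rightarrow> (complex \<Rightarrow> 'b::real_normed_vector) \<Rightarrow> bool"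
  where "Ck_on r S g \<longleftrightarrow>
    (\<forall>vs \<in> lists {1, \<i>}.
      (length vs < r \<longrightarrow> partials S vs g differentiable_on S) \<and>
      (length vs \<le> r \<longrightarrow> continuous_on S (partials S vs g)))"

text \<open>Meant for open \<open>S\<close>; vector-valued functions are harmonic componentwise.\<close>

definition harmonic_on :: "complex set \<Rightarrow> (complex \<Rightarrow> 'b::real_normed_vector) \<Rightarrow> bool"
  where "harmonic_on S g \<longleftrightarrow>
    Ck_on 2 S g \<and> (\<forall>z\<in>S. partials S [1, 1] g z + partials S [\<i>, \<i>] g z = 0)"


section \<open>Compact bordered Riemann surfaces\<close>

text \<open>
  A chart is a pair of an open set and a homeomorphism of it onto a relatively open subset of the
  closed upper half-plane. The library predicate \<open>holomorphic_on\<close> asks for complex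
  differentiability within the given set, also at its points on the real axis. As transition maps
  carry real points to real points, by Schwarz reflection they extend holomorphically across the
  real axis; so the \<open>C\<^sup>r\<close> notions below do not depend on the charts chosen.
\<close>

type_synonym 'a chart = "'a set \<times> ('a \<Rightarrow> complex)"

definition upper_half_plane :: "complex set"
  where "upper_half_plane = {z. 0 \<le> Im z}"

definition chart_image :: "'a chart \<Rightarrow> complex set"
  where "chart_image c = snd c ` fst c"

definition in_chart :: "'a chart \<Rightarrow> ('a \<Rightarrow> 'b) \<Rightarrow> complex \<Rightarrow> 'b"
  where "in_chart c g = g \<circ> inv_into (fst c) (snd c)"

definition surface_boundary :: "'a chart set \<Rightarrow> 'a set"
  where "surface_boundary A = {p. \<exists>(U, \<phi>) \<in> A. p \<in> U \<and> Im (\<phi> p) = 0}"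

text \<open>
  Riemann surfaces are connected. That the boundary consists of finitely many pairwise disjoint
  smooth Jordan curves is automatic: it is a compact smooth one-dimensional manifold without
  boundary.
\<close>

definition compact_bordered_Riemann_surface :: "'a topology \<Rightarrow> 'a chart set \<Rightarrow> bool"
  where "compact_bordered_Riemann_surface M A \<longleftrightarrow>
    compact_space M \<and> Hausdorff_space M \<and> connected_space M \<and>
    (\<forall>(U, \<phi>) \<in> A. openin M U \<and>
      openin (top_of_set upper_half_plane) (\<phi> ` U) \<and>
      homeomorphic_map (subtopology M U) (top_of_set (\<phi> ` U)) \<phi>) \<and>
    (\<Union>(U, \<phi>) \<in> A. U) = topspace M \<and>
    (\<forall>(U, \<phi>) \<in> A. \<forall>(V, \<psi>) \<in> A. (\<psi> \<circ> inv_into U \<phi>) holomorphic_on \<phi> ` (U \<inter> V)) \<and>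
    surface_boundary A \<noteq> {}"

text \<open>
  As \<open>\<phi> ` U\<close> is relatively open in the half-plane, its interior in \<open>\<complex>\<close> is the image of the
  interior points of the surface lying in \<open>U\<close>.
\<close>

definition class_A :: "'a topology \<Rightarrow> 'a chart set \<Rightarrow> ('a \<Rightarrow> complex ^ 'n) \<Rightarrow> bool"
  where "class_A M A f \<longleftrightarrow>
    continuous_map M euclidean f \<and>
    (\<forall>c\<in>A. \<forall>j. (\<lambda>z. in_chart c f z $ j) holomorphic_on interior (chart_image c))"

definition null_quadric_punctured :: "(complex ^ 'n) set"
  where "null_quadric_punctured = {z. (\<Sum>j\<in>UNIV. (z $ j)\<^sup>2) = 0} - {0}"


section \<open>The space \<open>C\<^sup>r(M)\<close>\<close>

text \<open>
  Maps on \<open>M\<close> are represented by their \<^const>\<open>extensional\<close> representatives, so that maps which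
  agree on \<open>M\<close> are equal.
\<close>

definition Cr_maps :: "'a topology \<Rightarrow> 'a chart set \<Rightarrow> nat \<Rightarrow> ('a \<Rightarrow> real ^ 'n) set"
  where "Cr_maps M A r =
    {X \<in> extensional (topspace M). \<forall>c\<in>A. Ck_on r (chart_image c) (in_chart c X)}"

definition Cr_nbhd :: "'a topology \<Rightarrow> 'a chart set \<Rightarrow> nat \<Rightarrow> ('a \<Rightarrow> real ^ 'n) \<Rightarrow>
    'a chart \<Rightarrow> 'a set \<Rightarrow> real \<Rightarrow> ('a \<Rightarrow> real ^ 'n) set"
  where "Cr_nbhd M A r X c K \<epsilon> =
    {Y \<in> Cr_maps M A r. \<forall>vs \<in> lists {1, \<i>}. length vs \<le> r \<longrightarrow>
      (\<forall>p\<in>K. norm (partials (chart_image c) vs (in_chart c Y) (snd c p)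
                - partials (chart_image c) vs (in_chart c X) (snd c p)) < \<epsilon>)}"

text \<open>
  Uniform convergence of all partial derivatives up to order \<open>r\<close> on compact subsets of chart
  domains. Since \<open>M\<close> is compact this is the topology of the usual \<open>C\<^sup>r\<close>-norms, which are built
  from a finite cover of \<open>M\<close> by such compact sets.
\<close>

definition Cr_topology :: "'a topology \<Rightarrow> 'a chart set \<Rightarrow> nat \<Rightarrow> ('a \<Rightarrow> real ^ 'n) topology"
  where "Cr_topology M A r = topology_generated_by
    {Cr_nbhd M A r X c K \<epsilon> | X c K \<epsilon>.
      X \<in> Cr_maps M A r \<and> c \<in> A \<and> compactin M K \<and> K \<subseteq> fst c \<and> 0 < \<epsilon>}"


section \<open>Conformal minimal immersions\<close>

definition conformal_immersion :: "'a chart set \<Rightarrow> ('a \<Rightarrow> real ^ 'n) \<Rightarrow> bool"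
  where "conformal_immersion A X \<longleftrightarrow>
    (\<forall>c\<in>A. \<forall>z \<in> chart_image c.
      let D = frechet_derivative (in_chart c X) (at z within chart_image c)
      in inj D \<and> (\<exists>s>0. \<forall>v w. D v \<bullet> D w = s * (v \<bullet> w)))"

definition conformal_minimal_immersion ::
    "'a topology \<Rightarrow> 'a chart set \<Rightarrow> nat \<Rightarrow> ('a \<Rightarrow> real ^ 'n) \<Rightarrow> bool"
  where "conformal_minimal_immersion M A r X \<longleftrightarrow>
    X \<in> Cr_maps M A r \<and> conformal_immersion A X \<and>
    (\<forall>c\<in>A. harmonic_on (interior (chart_image c)) (in_chart c X))"

text \<open>
  In a chart with coordinate \<open>z = x + \<i>y\<close> the form \<open>\<partial>X\<close> is \<open>(\<partial>X/\<partial>z) dz\<close> with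
  \<open>\<partial>/\<partial>z = (\<partial>/\<partial>x - \<i> \<partial>/\<partial>y) / 2\<close>; \<open>del_coeff\<close> is the coefficient \<open>\<partial>X/\<partial>z\<close> at a point of the surface.
\<close>

definition del_coeff :: "'a chart \<Rightarrow> ('a \<Rightarrow> real ^ 'n) \<Rightarrow> 'a \<Rightarrow> complex ^ 'n"
  where "del_coeff c X p = (\<chi> j.
    (complex_of_real (partials (chart_image c) [1] (in_chart c X) (snd c p) $ j)
      - \<i> * complex_of_real (partials (chart_image c) [\<i>] (in_chart c X) (snd c p) $ j)) / 2)"

text \<open>
  Where \<open>chart_at\<close> is used below the result does not depend on the chart: another choice multiplies
  \<^const>\<open>del_coeff\<close> by a nonzero number, and the velocity of a curve by its inverse.
\<close>

definition chart_at :: "'a chart set \<Rightarrow> 'a \<Rightarrow> 'a chart"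
  where "chart_at A p = (SOME c. c \<in> A \<and> p \<in> fst c)"

text \<open>Points of projective space are the orbits of the nonzero scalars on the nonzero vectors.\<close>

definition proj_point :: "complex ^ 'n \<Rightarrow> (complex ^ 'n) set"
  where "proj_point z = {c *s z | c. c \<noteq> 0}"

definition Gauss_map :: "'a chart set \<Rightarrow> ('a \<Rightarrow> real ^ 'n) \<Rightarrow> 'a \<Rightarrow> (complex ^ 'n) set"
  where "Gauss_map A X p = proj_point (del_coeff (chart_at A p) X p)"


section \<open>Flux\<close>

definition C1_curve_on :: "'a chart set \<Rightarrow> real set \<Rightarrow> (real \<Rightarrow> 'a) \<Rightarrow> bool"
  where "C1_curve_on A J \<gamma> \<longleftrightarrow>
    (\<forall>(U, \<phi>) \<in> A. let I = {t \<in> J. \<gamma> t \<in> U} in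
      \<exists>D. (\<forall>t\<in>I. ((\<phi> \<circ> \<gamma>) has_vector_derivative D t) (at t within I)) \<and> continuous_on I D)"

text \<open>
  Closed curves are piecewise \<open>C\<^sup>1\<close>, so that one-forms can be integrated along them; on a connected
  surface each class in \<open>H\<^sub>1\<close> is represented by such a curve.
\<close>

definition closed_curve :: "'a topology \<Rightarrow> 'a chart set \<Rightarrow> (real \<Rightarrow> 'a) \<Rightarrow> bool"
  where "closed_curve M A \<gamma> \<longleftrightarrow>
    pathin M \<gamma> \<and> \<gamma> 0 = \<gamma> 1 \<and>
    (\<exists>P. finite P \<and> {0, 1} \<subseteq> P \<and> P \<subseteq> {0..1} \<and>
      (\<forall>a\<in>P. \<forall>b\<in>P. a < b \<and> {a<..<b} \<inter> P = {} \<longrightarrow> C1_curve_on A {a..b} \<gamma>))"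

text \<open>
  The class in \<open>H\<^sub>1(M; \<int>)\<close> of a closed curve, viewed as a singular 1-simplex: on the standard
  1-simplex \<open>{(x\<^sub>0, x\<^sub>1). x\<^sub>0 + x\<^sub>1 = 1}\<close> the coordinate \<open>x\<^sub>1\<close> is the parameter of the curve.
\<close>

definition curve_class :: "'a topology \<Rightarrow> (real \<Rightarrow> 'a) \<Rightarrow> 'a chain set"
  where "curve_class M \<gamma> =
    homologous_rel_set 1 M {} (frag_of (restrict (\<lambda>x. \<gamma> (x 1)) (standard_simplex 1)))"

text \<open>The integral of \<open>Im (\<partial>X)\<close> along a curve.\<close>

definition integral_Im_del :: "'a chart set \<Rightarrow> ('a \<Rightarrow> real ^ 'n) \<Rightarrow> (real \<Rightarrow> 'a) \<Rightarrow> real ^ 'n"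
  where "integral_Im_del A X \<gamma> = (\<chi> j. integral {0..1} (\<lambda>t.
    let c = chart_at A (\<gamma> t)
    in Im (del_coeff c X (\<gamma> t) $ j * vector_derivative (snd c \<circ> \<gamma>) (at t))))"

definition additive_group_on :: "'b::ab_group_add set \<Rightarrow> 'b monoid"
  where "additive_group_on S = \<lparr>carrier = S, monoid.mult = (+), one = 0\<rparr>"

definition is_flux_map ::
    "'a topology \<Rightarrow> 'a chart set \<Rightarrow> ('a \<Rightarrow> real ^ 'n) \<Rightarrow> ('a chain set \<Rightarrow> real ^ 'n) \<Rightarrow> bool"
  where "is_flux_map M A X F \<longleftrightarrow>
    F \<in> hom (homology_group 1 M) (additive_group_on UNIV) \<and>
    (\<forall>\<gamma>. closed_curve M A \<gamma> \<longrightarrow> F (curve_class M \<gamma>) = integral_Im_del A X \<gamma>)"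

definition complexify :: "real ^ 'n \<Rightarrow> complex ^ 'n"
  where "complexify x = (\<chi> j. complex_of_real (x $ j))"


section \<open>Real analytic Banach manifolds\<close>

text \<open>
  Banach spaces live on carrier sets, so that a model space can be existentially quantified.
  The multiplicative structure that \<^typ>\<open>('c, 'b) module\<close> inherits from the ring record is not used.
\<close>

definition real_field :: "real ring"
  where "real_field = \<lparr>carrier = UNIV, monoid.mult = (*), one = 1, zero = 0, add = (+)\<rparr>"

record 'v normed_module = "(real, 'v) module" +
  nrm :: "'v \<Rightarrow> real"

text \<open>The locale \<^locale>\<open>Metric_space\<close> requires symmetry and nonnegativity also off the carrier.\<close>

definition norm_dist :: "('v, 'm) normed_module_scheme \<Rightarrow> 'v \<Rightarrow> 'v \<Rightarrow> real"
  where "norm_dist E x y =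
    (if x \<in> carrier E \<and> y \<in> carrier E then nrm E (x \<ominus>\<^bsub>E\<^esub> y) else 0)"

definition norm_topology :: "('v, 'm) normed_module_scheme \<Rightarrow> 'v topology"
  where "norm_topology E = Metric_space.mtopology (carrier E) (norm_dist E)"

definition real_Banach_space :: "('v, 'm) normed_module_scheme \<Rightarrow> bool"
  where "real_Banach_space E \<longleftrightarrow>
    Module.module real_field E \<and>
    (\<forall>x \<in> carrier E. 0 \<le> nrm E x \<and> (nrm E x = 0 \<longleftrightarrow> x = \<zero>\<^bsub>E\<^esub>)) \<and>
    (\<forall>a. \<forall>x \<in> carrier E. nrm E (a \<odot>\<^bsub>E\<^esub> x) = \<bar>a\<bar> * nrm E x) \<and>
    (\<forall>x \<in> carrier E. \<forall>y \<in> carrier E. nrm E (x \<oplus>\<^bsub>E\<^esub> y) \<le> nrm E x + nrm E y) \<and>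
    Metric_space.mcomplete (carrier E) (norm_dist E)"

text \<open>\<open>k\<close>-linear maps, taking the list of their \<open>k\<close> arguments, with norm at most \<open>C\<close>.\<close>

definition multilinear_bounded :: "('v, 'm) normed_module_scheme \<Rightarrow> ('w, 'l) normed_module_scheme \<Rightarrow>
    nat \<Rightarrow> real \<Rightarrow> ('v list \<Rightarrow> 'w) \<Rightarrow> bool"
  where "multilinear_bounded E F k C L \<longleftrightarrow>
    (\<forall>xs \<in> lists (carrier E). length xs = k \<longrightarrow>
      L xs \<in> carrier F \<and>
      nrm F (L xs) \<le> C * prod_list (map (nrm E) xs) \<and>
      (\<forall>i<k. \<forall>x \<in> carrier E. \<forall>y \<in> carrier E.
        L (xs[i := x \<oplus>\<^bsub>E\<^esub> y]) = L (xs[i := x]) \<oplus>\<^bsub>F\<^esub> L (xs[i := y])) \<and>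
      (\<forall>i<k. \<forall>a. \<forall>x \<in> carrier E. L (xs[i := a \<odot>\<^bsub>E\<^esub> x]) = a \<odot>\<^bsub>F\<^esub> L (xs[i := x])))"

text \<open>
  Around every point the map is the sum of a normally convergent series of continuous homogeneous
  polynomials; the \<open>k\<close>-th one is the \<open>k\<close>-linear map \<open>L k\<close> on the diagonal. Symmetry of \<open>L k\<close> need
  not be imposed, as symmetrizing changes neither the polynomial nor the bound.
\<close>

definition real_analytic_on :: "('v, 'm) normed_module_scheme \<Rightarrow> ('w, 'l) normed_module_scheme \<Rightarrow>
    'v set \<Rightarrow> ('v \<Rightarrow> 'w) \<Rightarrow> bool"
  where "real_analytic_on E F W g \<longleftrightarrow>
    (\<forall>x\<in>W. \<exists>r>0. \<exists>C L.
      (\<forall>k. 0 \<le> C k \<and> multilinear_bounded E F k (C k) (L k)) \<and>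
      summable (\<lambda>k. C k * r ^ k) \<and>
      (\<forall>h \<in> carrier E. nrm E h < r \<and> x \<oplus>\<^bsub>E\<^esub> h \<in> W \<longrightarrow>
        limitin (norm_topology F) (\<lambda>N. finsum F (\<lambda>k. L k (replicate k h)) {..<N})
          (g (x \<oplus>\<^bsub>E\<^esub> h)) sequentially))"

text \<open>
  An atlas of a real analytic Banach manifold structure on a topological space; model spaces may
  vary from chart to chart.
\<close>

definition real_analytic_Banach_atlas ::
    "'x topology \<Rightarrow> ('x set \<times> ('x \<Rightarrow> 'v) \<times> 'v normed_module) set \<Rightarrow> bool"
  where "real_analytic_Banach_atlas T B \<longleftrightarrow>
    (\<forall>(U, \<phi>, E) \<in> B. openin T U \<and> real_Banach_space E \<and>
      openin (norm_topology E) (\<phi> ` U) \<and>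
      homeomorphic_map (subtopology T U) (subtopology (norm_topology E) (\<phi> ` U)) \<phi>) \<and>
    (\<Union>(U, \<phi>, E) \<in> B. U) = topspace T \<and>
    (\<forall>(U, \<phi>, E) \<in> B. \<forall>(V, \<psi>, F) \<in> B.
      real_analytic_on E F (\<phi> ` (U \<inter> V)) (\<psi> \<circ> inv_into U \<phi>))"

text \<open>
  The model spaces are carried by subsets of the type of the points. This loses no generality: a
  Banach space with a nonempty open subset homeomorphic to a set of points has the cardinality of
  that subset, hence can be transported to a carrier inside the type.
\<close>

definition real_analytic_Banach_manifold :: "'x topology \<Rightarrow> bool"
  where "real_analytic_Banach_manifold T \<longleftrightarrow>
    Hausdorff_space T \<and>
    (\<exists>B :: ('x set \<times> ('x \<Rightarrow> 'x) \<times> 'x normed_module) set. real_analytic_Banach_atlas T B)"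

end

theory Submission
  imports Defs "HOL-Complex_Analysis.Conformal_Mappings"
begin

text \<open>
  A map \<open>X\<close> is a conformal minimal immersion with Gauss map \<open>\<pi> \<circ> f\<close> if and only if it is harmonic, \<open>\<partial>X\<close> lies
  at every point on the complex line spanned by \<open>f\<close>, and \<open>\<partial>X\<close> has no zeros
  (\<open>immersions_with_Gauss_map\<close>); conformality is automatic because \<open>f\<close> takes values in the null quadric. The
  first two conditions are real linear in \<open>X\<close> and pass to limits in \<open>C\<^sup>1\<close>, so they define a closed real subspace
  \<open>L\<close> of \<open>C\<^sup>r(M)\<close> (\<open>directed_harmonic_maps_closed\<close>). The third is an open condition, as \<open>M\<close> is compact
  (\<open>nondegenerate_maps_open\<close>). Hence the space of all immersions with this Gauss map is an open subset of the
  Banach space \<open>L\<close>. The flux along a closed curve is a continuous linear functional of \<open>X\<close> (\<open>flux_bound\<close>);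
  prescribing it cuts out of that open set either nothing or its intersection with a translate of a closed
  subspace of \<open>L\<close>. An open subset of a translate of a closed subspace is a manifold with a single chart,
  the translation, and the only transition map is the identity
  (\<open>open_in_affine_subspace_manifold\<close>).

  The substance is that \<open>C\<^sup>r(M)\<close>, with a norm built from finitely many charts and compact sets, is
  a Banach space (\<open>Cr_Banach\<close>) and that its norm gives the \<open>C\<^sup>r\<close> topology, which refers to all
  charts of the atlas (\<open>norm_topology_Cr\<close>). Both rest on \<open>chart_partial_change\<close>: the partial derivatives in one
  chart are combinations of those in another one, with coefficients that are continuous up to the boundary
  and do not depend on the map. There the transition maps have to be smooth up to the boundary, which is
  Schwarz reflection.

  Two more facts from analysis enter. A map is harmonic if and only if \<open>\<partial>X/\<partial>z\<close> is holomorphic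
  (\<open>harmonic_iff_holomorphic\<close>), which makes harmonicity stable under limits in \<open>C\<^sup>1\<close>. And the integrand of
  the flux, although written in charts that change along the curve, is piecewise continuous.
\<close>

section \<open>Affine pieces of Banach spaces\<close>

lemma cring_real_field: "cring real_field"
proof (rule cringI)
  show "abelian_group real_field"
    by (rule abelian_groupI) (auto simp: real_field_def intro: exI[of _ "- _"] add.left_inverse)
  show "comm_monoid real_field"
    by (rule comm_monoidI) (auto simp: real_field_def)
qed (auto simp: real_field_def algebra_simps)

text \<open>
  The norm axioms come without completeness, so that the metric is available when completeness is
  proved.
\<close>

locale normed_real_module = Module.module real_field E for E :: "'v normed_module" (structure) +
  assumes nrm_nonneg: "x \<in> carrier E \<Longrightarrow> 0 \<le> nrm E x"
    and nrm_eq_0: "x \<in> carrier E \<Longrightarrow> nrm E x = 0 \<longleftrightarrow> x = \<zero>\<^bsub>E\<^esub>"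
    and nrm_smult: "x \<in> carrier E \<Longrightarrow> nrm E (a \<odot>\<^bsub>E\<^esub> x) = \<bar>a\<bar> * nrm E x"
    and nrm_triangle: "x \<in> carrier E \<Longrightarrow> y \<in> carrier E \<Longrightarrow> nrm E (x \<oplus>\<^bsub>E\<^esub> y) \<le> nrm E x + nrm E y"

context normed_real_module
begin

lemma scalar [simp]: "a \<in> carrier real_field"
  by (simp add: real_field_def)

lemma minus_eq_smult:
  assumes "x \<in> carrier E" shows "\<ominus>\<^bsub>E\<^esub> x = (-1) \<odot>\<^bsub>E\<^esub> x"
proof -
  have "(-1) \<odot>\<^bsub>E\<^esub> x \<oplus>\<^bsub>E\<^esub> x = ((-1) \<oplus>\<^bsub>real_field\<^esub> \<one>\<^bsub>real_field\<^esub>) \<odot>\<^bsub>E\<^esub> x"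
    using assms smult_l_distr[of "-1" "\<one>\<^bsub>real_field\<^esub>" x] by simp
  also have "\<dots> = \<zero>\<^bsub>real_field\<^esub> \<odot>\<^bsub>E\<^esub> x"
    by (simp add: real_field_def)
  finally have "(-1) \<odot>\<^bsub>E\<^esub> x \<oplus>\<^bsub>E\<^esub> x = \<zero>\<^bsub>E\<^esub>" using assms by simp
  then show ?thesis
    using assms by (metis M.minus_equality scalar smult_closed)
qed

lemma nrm_minus: "x \<in> carrier E \<Longrightarrow> nrm E (\<ominus>\<^bsub>E\<^esub> x) = nrm E x"
  by (simp add: minus_eq_smult nrm_smult)

lemma minus_cancel:
  assumes "x \<in> carrier E" "y \<in> carrier E"
  shows "(x \<ominus>\<^bsub>E\<^esub> y) \<oplus>\<^bsub>E\<^esub> y = x" "(x \<oplus>\<^bsub>E\<^esub> y) \<ominus>\<^bsub>E\<^esub> y = x"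
  using assms by (simp_all add: a_minus_def M.a_assoc M.l_neg M.r_neg)

lemma minus_eq_zero_iff:
  assumes "x \<in> carrier E" "y \<in> carrier E" shows "x \<ominus>\<^bsub>E\<^esub> y = \<zero>\<^bsub>E\<^esub> \<longleftrightarrow> x = y"
  using minus_cancel(1)[OF assms] assms by (auto simp: a_minus_def M.r_neg)

sublocale metric: Metric_space "carrier E" "norm_dist E"
proof
  show "0 \<le> norm_dist E x y" for x y
    by (simp add: norm_dist_def nrm_nonneg)
  show "norm_dist E x y = norm_dist E y x" for x y
  proof (cases "x \<in> carrier E \<and> y \<in> carrier E")
    case True
    then have "x \<ominus>\<^bsub>E\<^esub> y = \<ominus>\<^bsub>E\<^esub> (y \<ominus>\<^bsub>E\<^esub> x)"
      by (simp add: M.minus_add a_minus_def M.add.m_comm)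
    with True show ?thesis by (simp add: norm_dist_def nrm_minus)
  qed (auto simp: norm_dist_def)
  show "norm_dist E x y = 0 \<longleftrightarrow> x = y" if "x \<in> carrier E" "y \<in> carrier E" for x y
    using that by (simp add: norm_dist_def nrm_eq_0 minus_eq_zero_iff)
  show "norm_dist E x z \<le> norm_dist E x y + norm_dist E y z"
    if "x \<in> carrier E" "y \<in> carrier E" "z \<in> carrier E" for x y z
  proof -
    have "x \<ominus>\<^bsub>E\<^esub> z = (x \<ominus>\<^bsub>E\<^esub> y) \<oplus>\<^bsub>E\<^esub> (y \<ominus>\<^bsub>E\<^esub> z)"
      using that minus_cancel(1)[of x y] by (simp add: a_minus_def M.a_assoc[symmetric])
    then show ?thesis
      using that nrm_triangle[of "x \<ominus>\<^bsub>E\<^esub> y" "y \<ominus>\<^bsub>E\<^esub> z"] by (simp add: norm_dist_def)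
  qed
qed

lemma minus_minus_cancel:
  assumes "x \<in> carrier E" "y \<in> carrier E" "z \<in> carrier E"
  shows "(x \<ominus>\<^bsub>E\<^esub> z) \<ominus>\<^bsub>E\<^esub> (y \<ominus>\<^bsub>E\<^esub> z) = x \<ominus>\<^bsub>E\<^esub> y"
proof -
  have "(x \<ominus>\<^bsub>E\<^esub> y) \<oplus>\<^bsub>E\<^esub> (y \<ominus>\<^bsub>E\<^esub> z) = x \<ominus>\<^bsub>E\<^esub> z"
    using assms minus_cancel(1)[of x y] by (simp add: a_minus_def M.a_assoc[symmetric])
  then show ?thesis
    using assms minus_cancel(2)[of "x \<ominus>\<^bsub>E\<^esub> y" "y \<ominus>\<^bsub>E\<^esub> z"] by simp
qed

lemma norm_dist_translate:
  assumes "x \<in> carrier E" "y \<in> carrier E" "a \<in> carrier E"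
  shows "norm_dist E (x \<ominus>\<^bsub>E\<^esub> a) (y \<ominus>\<^bsub>E\<^esub> a) = norm_dist E x y"
  using assms by (simp add: norm_dist_def minus_minus_cancel)

lemma topspace_norm_topology [simp]: "topspace (norm_topology E) = carrier E"
  by (simp add: norm_topology_def)

end

locale banach_module =
  fixes E :: "'v normed_module" (structure)
  assumes banach: "real_Banach_space E"

sublocale banach_module \<subseteq> normed_real_module E
  using banach
  by (intro normed_real_module.intro normed_real_module_axioms.intro) (auto simp: real_Banach_space_def)

lemma (in banach_module) complete: "metric.mcomplete"
  using banach by (auto simp: real_Banach_space_def)

text \<open>
  The function \<^const>\<open>norm_dist\<close> vanishes off the carrier. So the distance of a subspace and
  that of the ambient space agree on the subspace only, and this is all that topology and
  completeness can see.
\<close>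

lemma mtopology_cong:
  assumes "Metric_space S d" "Metric_space S d'" "\<And>x y. x \<in> S \<Longrightarrow> y \<in> S \<Longrightarrow> d x y = d' x y"
  shows "Metric_space.mtopology S d = Metric_space.mtopology S d'"
    and "Metric_space.mcomplete S d \<longleftrightarrow> Metric_space.mcomplete S d'"
proof -
  interpret A: Metric_space S d by fact
  interpret B: Metric_space S d' by fact
  have ball: "A.mball x r = B.mball x r" for x r
    using assms(3) by (auto simp: A.mball_def B.mball_def)
  show top: "A.mtopology = B.mtopology"
    by (simp add: topology_eq A.openin_mtopology B.openin_mtopology ball)
  have "A.MCauchy s = B.MCauchy s" for s
    using assms(3) unfolding A.MCauchy_def B.MCauchy_def by (metis rangeI subsetD)
  then show "A.mcomplete = B.mcomplete"
    by (simp add: A.mcomplete_def B.mcomplete_def top)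
qed

locale closed_subspace = banach_module +
  fixes V
  assumes submodule: "submodule V real_field E"
    and closed: "closedin (norm_topology E) V"

context closed_subspace
begin

abbreviation "EV \<equiv> E\<lparr>carrier := V\<rparr>"

lemma V_sub: "V \<subseteq> carrier E"
  using submoduleE(1)[OF submodule] .

lemma module_V: "Module.module real_field EV"
  using submodule.submodule_is_module[OF submodule module_axioms] .

lemma minus_V: assumes "x \<in> V" "y \<in> V" shows "x \<ominus>\<^bsub>EV\<^esub> y = x \<ominus>\<^bsub>E\<^esub> y"
proof -
  interpret V: Module.module real_field EV by (rule module_V)
  have "\<ominus>\<^bsub>EV\<^esub> y \<oplus>\<^bsub>E\<^esub> y = \<zero>\<^bsub>E\<^esub>" "\<ominus>\<^bsub>EV\<^esub> y \<in> V"
    using V.M.l_neg[of y] V.M.a_inv_closed[of y] assms by auto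
  then have "\<ominus>\<^bsub>EV\<^esub> y = \<ominus>\<^bsub>E\<^esub> y"
    using M.minus_equality[of "\<ominus>\<^bsub>EV\<^esub> y" y] V_sub assms by (simp add: subset_eq)
  then show ?thesis by (simp add: a_minus_def)
qed

lemma minus_in_V: assumes "x \<in> V" "y \<in> V" shows "x \<ominus>\<^bsub>E\<^esub> y \<in> V"
  using submoduleE(3,5)[OF submodule] assms by (simp add: a_minus_def)

lemma norm_dist_V: "x \<in> V \<Longrightarrow> y \<in> V \<Longrightarrow> norm_dist EV x y = norm_dist E x y"
  using V_sub by (auto simp: norm_dist_def minus_V)

sublocale sub: Submetric "carrier E" "norm_dist E" V
  by unfold_locales (rule V_sub)

lemma metric_V: "Metric_space V (norm_dist EV)"
proof
  show "0 \<le> norm_dist EV x y" for x y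
    using V_sub minus_V minus_in_V by (auto simp: norm_dist_def intro!: nrm_nonneg)
  show "norm_dist EV x y = norm_dist EV y x" for x y
    using norm_dist_V metric.commute by (cases "x \<in> V \<and> y \<in> V") (auto simp: norm_dist_def)
  show "norm_dist EV x y = 0 \<longleftrightarrow> x = y" if "x \<in> V" "y \<in> V" for x y
    using that norm_dist_V V_sub by auto
  show "norm_dist EV x z \<le> norm_dist EV x y + norm_dist EV y z"
    if "x \<in> V" "y \<in> V" "z \<in> V" for x y z
    using that norm_dist_V V_sub metric.triangle[of x y z] by (auto simp: subset_eq)
qed

lemma norm_topology_V: "norm_topology EV = subtopology (norm_topology E) V"
  using mtopology_cong(1)[OF metric_V sub.sub.Metric_space_axioms norm_dist_V] sub.mtopology_submetric
  by (simp add: norm_topology_def)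

lemma banach_V: "real_Banach_space EV"
proof -
  have "Metric_space.mcomplete V (norm_dist EV)"
    using mtopology_cong(2)[OF metric_V sub.sub.Metric_space_axioms norm_dist_V]
      sub.closedin_mcomplete_imp_mcomplete closed complete by (simp add: norm_topology_def)
  then show ?thesis
    using module_V V_sub nrm_nonneg nrm_eq_0 nrm_smult nrm_triangle
    by (auto simp: real_Banach_space_def subset_eq)
qed

end

text \<open>
  The transition map of an atlas with a single chart is the identity, which is its own power series.
\<close>

lemma real_analytic_on_identity:
  fixes E :: "'v normed_module"
  assumes "real_Banach_space E" and W: "W \<subseteq> carrier E" and g: "\<And>x. x \<in> W \<Longrightarrow> g x = x"
  shows "real_analytic_on E E W g"
proof -
  interpret banach_module E by standard fact
  show ?thesis
    unfolding real_analytic_on_def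
  proof
    fix x assume x: "x \<in> W"
    \<comment> \<open>The expansion \<open>x + h\<close>: a constant, a linear term, and nothing else.\<close>
    define L where "L = (\<lambda>(k::nat) xs. if k = 0 then x else if k = 1 then hd xs else \<zero>\<^bsub>E\<^esub>)"
    define C where "C = (\<lambda>k::nat. if k = 0 then nrm E x else if k = 1 then 1 else (0::real))"
    have "multilinear_bounded E E k (C k) (L k)" for k
    proof -
      consider "k = 0" | "k = 1" | "k \<ge> 2" by linarith
      then show ?thesis
      proof cases
        case 1 then show ?thesis using x W by (auto simp: multilinear_bounded_def L_def C_def)
      next
        case 2 then show ?thesis
          by (auto simp: multilinear_bounded_def L_def C_def length_Suc_conv)
      next
        case 3 then show ?thesis
          using nrm_eq_0[of "\<zero>\<^bsub>E\<^esub>"] by (auto simp: multilinear_bounded_def L_def C_def)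
      qed
    qed
    moreover have "0 \<le> C k" for k using x W nrm_nonneg by (auto simp: C_def)
    moreover have "summable (\<lambda>k. C k * 1 ^ k)"
      by (rule summable_finite[of "{0,1}"]) (auto simp: C_def)
    moreover have "limitin (norm_topology E) (\<lambda>N. finsum E (\<lambda>k. L k (replicate k h)) {..<N})
        (g (x \<oplus>\<^bsub>E\<^esub> h)) sequentially" if h: "h \<in> carrier E" "x \<oplus>\<^bsub>E\<^esub> h \<in> W" for h
    proof -
      have "finsum E (\<lambda>k. L k (replicate k h)) {..<N} = x \<oplus>\<^bsub>E\<^esub> h" if "N \<ge> 2" for N
        using that
      proof (induction N rule: dec_induct)
        case base
        have "{..<2::nat} = insert 1 {0}" by auto
        then show ?case using h x W by (auto simp: L_def M.a_comm)
      next
        case (step n)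
        have "finsum E (\<lambda>k. L k (replicate k h)) {..<Suc n}
            = L n (replicate n h) \<oplus>\<^bsub>E\<^esub> finsum E (\<lambda>k. L k (replicate k h)) {..<n}"
          unfolding lessThan_Suc
          using h x W by (intro M.finsum_insert) (auto simp: L_def gr0_conv_Suc)
        then show ?case using step h x W by (auto simp: L_def)
      qed
      then have "eventually (\<lambda>N. finsum E (\<lambda>k. L k (replicate k h)) {..<N} = g (x \<oplus>\<^bsub>E\<^esub> h)) sequentially"
        using g[OF h(2)] by (auto simp: eventually_sequentially)
      moreover have "g (x \<oplus>\<^bsub>E\<^esub> h) \<in> topspace (norm_topology E)"
        using h g W by (auto simp: norm_topology_def)
      ultimately show ?thesis
        by (simp add: limitin_eventually)
    qed
    ultimately show "\<exists>r>0. \<exists>C L. (\<forall>k. 0 \<le> C k \<and> multilinear_bounded E E k (C k) (L k)) \<and>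
        summable (\<lambda>k. C k * r ^ k) \<and>
        (\<forall>h\<in>carrier E. nrm E h < r \<and> x \<oplus>\<^bsub>E\<^esub> h \<in> W \<longrightarrow>
          limitin (norm_topology E) (\<lambda>N. \<Oplus>\<^bsub>E\<^esub>k\<in>{..<N}. L k (replicate k h)) (g (x \<oplus>\<^bsub>E\<^esub> h)) sequentially)"
      by (intro exI[of _ 1] exI[of _ C] exI[of _ L] conjI) auto
  qed
qed

lemma (in banach_module) translate_homeomorphic:
  assumes "S \<subseteq> carrier E" "a \<in> carrier E"
  shows "homeomorphic_map (subtopology (norm_topology E) S)
    (subtopology (norm_topology E) ((\<lambda>x. x \<ominus>\<^bsub>E\<^esub> a) ` S)) (\<lambda>x. x \<ominus>\<^bsub>E\<^esub> a)"
proof -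
  let ?S' = "(\<lambda>x. x \<ominus>\<^bsub>E\<^esub> a) ` S"
  interpret A: Submetric "carrier E" "norm_dist E" S by standard fact
  interpret B: Submetric "carrier E" "norm_dist E" ?S'
    using assms by unfold_locales auto
  interpret Metric_space12 S "norm_dist E" ?S' "norm_dist E"
    by (intro Metric_space12.intro A.sub.Metric_space_axioms B.sub.Metric_space_axioms)
  show ?thesis
    unfolding norm_topology_def A.mtopology_submetric[symmetric] B.mtopology_submetric[symmetric]
    using assms by (intro isometry_imp_homeomorphic_map norm_dist_translate) auto
qed

text \<open>
  The translation by \<open>- a\<close> is an isometry of \<open>S\<close> onto a relatively open subset of the Banach space
  \<open>V\<close>, and this chart alone is an atlas.
\<close>

theorem (in closed_subspace) open_in_affine_subspace_manifold:
  assumes S: "S \<subseteq> carrier E" and G: "openin (norm_topology E) G" and a: "a \<in> S"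
    and affine: "\<And>x. x \<in> carrier E \<Longrightarrow> x \<in> S \<longleftrightarrow> x \<ominus>\<^bsub>E\<^esub> a \<in> V \<and> x \<in> G"
  shows "real_analytic_Banach_manifold (subtopology (norm_topology E) S)"
proof -
  define \<phi> where "\<phi> = (\<lambda>x. x \<ominus>\<^bsub>E\<^esub> a)"
  define T where "T = subtopology (norm_topology E) S"
  have aE: "a \<in> carrier E" using a S by auto
  have topT: "topspace T = S" using S by (auto simp: T_def)
  have img: "\<phi> ` S \<subseteq> V" using S affine by (auto simp: \<phi>_def)
  have "\<phi> ` S = V \<inter> \<phi> ` G"
  proof -
    have GE: "G \<subseteq> carrier E" using openin_subset[OF G] by simp
    show ?thesis
    proof
      show "\<phi> ` S \<subseteq> V \<inter> \<phi> ` G" using S affine by (auto simp: \<phi>_def)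
      show "V \<inter> \<phi> ` G \<subseteq> \<phi> ` S" using affine GE by (auto simp: \<phi>_def)
    qed
  qed
  moreover have "openin (norm_topology E) (\<phi> ` G)"
  proof -
    have "homeomorphic_map (norm_topology E) (norm_topology E) \<phi>"
    proof -
      have "\<phi> ` carrier E = carrier E"
      proof
        show "\<phi> ` carrier E \<subseteq> carrier E" using aE by (auto simp: \<phi>_def)
        show "carrier E \<subseteq> \<phi> ` carrier E"
        proof
          fix x assume x: "x \<in> carrier E"
          then have "x = \<phi> (x \<oplus>\<^bsub>E\<^esub> a)" by (simp add: \<phi>_def minus_cancel aE)
          with x aE show "x \<in> \<phi> ` carrier E" by blast
        qed
      qed
      then show ?thesis
        using translate_homeomorphic[of "carrier E" a] aE subtopology_topspace[of "norm_topology E"]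
        unfolding \<phi>_def by simp
    qed
    then show ?thesis using G homeomorphic_imp_open_map unfolding open_map_def by metis
  qed
  ultimately have open_img: "openin (norm_topology EV) (\<phi> ` S)"
    unfolding norm_topology_V openin_subtopology by (metis Int_commute)
  have homeo: "homeomorphic_map (subtopology T S) (subtopology (norm_topology EV) (\<phi> ` S)) \<phi>"
  proof -
    have "subtopology (norm_topology EV) (\<phi> ` S) = subtopology (norm_topology E) (\<phi> ` S)"
      using img by (simp add: norm_topology_V subtopology_subtopology Int_absorb1)
    then show ?thesis
      using translate_homeomorphic[OF S aE] by (simp add: T_def \<phi>_def subtopology_subtopology)
  qed
  have inj: "inj_on \<phi> S"
    using homeomorphic_imp_injective_map[OF homeo] topT by simp
  have "real_analytic_on EV EV (\<phi> ` (S \<inter> S)) (\<phi> \<circ> inv_into S \<phi>)"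
    using img inj by (intro real_analytic_on_identity banach_V) (auto simp: f_inv_into_f)
  moreover have "openin T S" using openin_topspace[of T] topT by simp
  ultimately have "real_analytic_Banach_atlas T {(S, \<phi>, EV)}"
    using open_img homeo topT banach_V
    by (simp add: real_analytic_Banach_atlas_def)
  moreover have "Hausdorff_space T"
    using metric.Hausdorff_space_mtopology
    by (simp add: T_def norm_topology_def Hausdorff_space_subtopology)
  ultimately have "real_analytic_Banach_manifold T"
    unfolding real_analytic_Banach_manifold_def by (intro conjI exI)
  then show ?thesis by (simp add: T_def)
qed

lemma empty_manifold: "real_analytic_Banach_manifold (subtopology T {})"
proof -
  have "real_analytic_Banach_atlas (subtopology T {}) {}"
    by (simp add: real_analytic_Banach_atlas_def)
  moreover have "Hausdorff_space (subtopology T {})"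
    by (simp add: Hausdorff_space_def)
  ultimately show ?thesis by (auto simp: real_analytic_Banach_manifold_def)
qed

section \<open>Partial derivatives on relatively open subsets of the half-plane\<close>

abbreviation half_open :: "complex set \<Rightarrow> bool"
  where "half_open S \<equiv> openin (top_of_set upper_half_plane) S"

abbreviation words :: "complex list set"
  where "words \<equiv> lists {1, \<i>}"

text \<open>
  The real differential whose values in the directions \<open>1\<close> and \<open>\<i>\<close> are \<open>a\<close> and \<open>b\<close>.
\<close>

definition dlin :: "'b::real_vector \<Rightarrow> 'b \<Rightarrow> complex \<Rightarrow> 'b"
  where "dlin a b h = Re h *\<^sub>R a + Im h *\<^sub>R b"

lemma dlin_directions [simp]: "dlin a b 1 = a" "dlin a b \<i> = b"
  by (simp_all add: dlin_def)

lemma linear_eq_dlin: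
  assumes "bounded_linear D" shows "D = dlin (D 1) (D \<i>)"
proof
  fix h
  interpret bounded_linear D by fact
  have "h = Re h *\<^sub>R 1 + Im h *\<^sub>R \<i>" by (simp add: complex_eq_iff)
  then have "D h = D (Re h *\<^sub>R 1 + Im h *\<^sub>R \<i>)" by simp
  then show "D h = dlin (D 1) (D \<i>) h" by (simp only: add scaleR dlin_def)
qed

lemma half_open_ball:
  assumes "half_open S" "z \<in> S"
  obtains d where "d > 0" "ball z d \<inter> upper_half_plane \<subseteq> S"
  using assms unfolding openin_contains_ball by blast

lemma half_open_Im: "half_open S \<Longrightarrow> z \<in> S \<Longrightarrow> 0 \<le> Im z"
  using openin_imp_subset by (force simp: upper_half_plane_def)

text \<open>
  From each of its points, \<open>S\<close> contains short segments in the directions \<open>1\<close> and \<open>\<i>\<close>; at boundary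
  points only the upward one is available, but one side is enough to determine a derivative.
\<close>

lemma half_open_derivative_unique:
  fixes f :: "complex \<Rightarrow> 'b::real_normed_vector"
  assumes S: "half_open S" "z \<in> S"
    and "(f has_derivative D) (at z within S)" "(f has_derivative D') (at z within S)"
  shows "D = D'"
proof (rule frechet_derivative_unique_within[OF assms(3,4)])
  fix i :: complex and e :: real assume i: "i \<in> Basis" and "e > 0"
  obtain d where d: "d > 0" "ball z d \<inter> upper_half_plane \<subseteq> S"
    using half_open_ball[OF S] .
  define t where "t = min d e / 2"
  have t: "0 < t" "t < d" "t < e" using \<open>e > 0\<close> d by (auto simp: t_def)
  have "z + t *\<^sub>R i \<in> ball z d"
    using i t by (auto simp: dist_norm Basis_complex_def)
  moreover have "z + t *\<^sub>R i \<in> upper_half_plane"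
    using i t half_open_Im[OF S] by (auto simp: upper_half_plane_def Basis_complex_def)
  ultimately show "\<exists>t. 0 < \<bar>t\<bar> \<and> \<bar>t\<bar> < e \<and> z + t *\<^sub>R i \<in> S"
    using d t by (intro exI[of _ t]) auto
qed

lemma frechet_derivative_within_half_open:
  fixes f :: "complex \<Rightarrow> 'b::real_normed_vector"
  assumes "half_open S" "z \<in> S" "(f has_derivative D) (at z within S)"
  shows "frechet_derivative f (at z within S) = D"
  using half_open_derivative_unique[OF assms(1,2) _ assms(3)] assms(3)
  by (metis differentiableI frechet_derivative_works)

lemma partials_Nil [simp]: "partials S [] g = g"
  and partials_Cons: "partials S (v # vs) g z = frechet_derivative (partials S vs g) (at z within S) v"
  by (simp_all add: partials_def)

lemma Ck_on_has_derivative: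
  assumes "Ck_on r S g" "vs \<in> words" "length vs < r" "z \<in> S"
  shows "(partials S vs g has_derivative dlin (partials S (1 # vs) g z) (partials S (\<i> # vs) g z))
    (at z within S)"
proof -
  have "partials S vs g differentiable at z within S"
    using assms by (auto simp: Ck_on_def differentiable_on_def)
  then have *: "(partials S vs g has_derivative frechet_derivative (partials S vs g) (at z within S)) (at z within S)"
    using frechet_derivative_works by blast
  then show ?thesis
    using linear_eq_dlin[OF has_derivative_bounded_linear[OF *]] by (simp add: partials_Cons)
qed

lemma Ck_on_continuous: "Ck_on r S g \<Longrightarrow> vs \<in> words \<Longrightarrow> length vs \<le> r \<Longrightarrow> continuous_on S (partials S vs g)"
  by (simp add: Ck_on_def)

lemma Ck_on_mono: "Ck_on r S g \<Longrightarrow> k \<le> r \<Longrightarrow> Ck_on k S g"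
  by (auto simp: Ck_on_def)

text \<open>
  To compute iterated partial derivatives it suffices to exhibit functions, one for each word, that are
  derivatives of one another: uniqueness of derivatives then identifies them. Restrictions, linear
  combinations, limits and harmonic maps are all treated by naming such a family.
\<close>

lemma
  fixes g :: "complex \<Rightarrow> 'b::real_normed_vector"
  assumes S: "half_open S" and G0: "\<And>z. z \<in> S \<Longrightarrow> G [] z = g z"
    and der: "\<And>vs z. vs \<in> words \<Longrightarrow> length vs < r \<Longrightarrow> z \<in> S \<Longrightarrow>
      (G vs has_derivative dlin (G (1 # vs) z) (G (\<i> # vs) z)) (at z within S)"
    and cont: "\<And>vs. vs \<in> words \<Longrightarrow> length vs = r \<Longrightarrow> continuous_on S (G vs)"
  shows partials_family: "vs \<in> words \<Longrightarrow> length vs \<le> r \<Longrightarrow> z \<in> S \<Longrightarrow> partials S vs g z = G vs z"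
    and Ck_on_family: "Ck_on r S g"
proof -
  have der': "(partials S vs g has_derivative dlin (G (1 # vs) z) (G (\<i> # vs) z)) (at z within S)"
    if "vs \<in> words" "length vs < r" "z \<in> S" "\<And>w. w \<in> S \<Longrightarrow> partials S vs g w = G vs w" for vs z
    using has_derivative_transform[OF that(3,4) der[OF that(1-3)]] .
  have eq: "\<forall>z\<in>S. partials S vs g z = G vs z" if "vs \<in> words" "length vs \<le> r" for vs
    using that
  proof (induction vs)
    case Nil then show ?case using G0 by simp
  next
    case (Cons v vs)
    show ?case
    proof
      fix z assume z: "z \<in> S"
      have "frechet_derivative (partials S vs g) (at z within S) = dlin (G (1 # vs) z) (G (\<i> # vs) z)"
        using Cons z by (intro frechet_derivative_within_half_open S der') auto
      then show "partials S (v # vs) g z = G (v # vs) z"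
        using Cons by (auto simp: partials_Cons)
    qed
  qed
  then show "vs \<in> words \<Longrightarrow> length vs \<le> r \<Longrightarrow> z \<in> S \<Longrightarrow> partials S vs g z = G vs z" by blast
  have diff: "partials S vs g differentiable_on S" if "vs \<in> words" "length vs < r" for vs
    unfolding differentiable_on_def differentiable_def using der'[OF that] eq[OF that(1)] that(2) by fastforce
  show "Ck_on r S g"
    unfolding Ck_on_def
  proof (intro ballI conjI impI)
    fix vs :: "complex list" assume vs: "vs \<in> words"
    show "partials S vs g differentiable_on S" if "length vs < r" using diff vs that .
    show "continuous_on S (partials S vs g)" if "length vs \<le> r"
    proof (cases "length vs = r")
      case True
      then show ?thesis using cont[OF vs] eq[OF vs] by (simp cong: continuous_on_cong)
    next
      case False
      then show ?thesis using diff[OF vs] that differentiable_imp_continuous_on by auto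
    qed
  qed
qed

lemma
  fixes g :: "complex \<Rightarrow> 'b::real_normed_vector"
  assumes "Ck_on r S g" "half_open T" "T \<subseteq> S" "\<And>z. z \<in> T \<Longrightarrow> g' z = g z"
  shows partials_restrict: "vs \<in> words \<Longrightarrow> length vs \<le> r \<Longrightarrow> z \<in> T \<Longrightarrow> partials T vs g' z = partials S vs g z"
    and Ck_on_restrict: "Ck_on r T g'"
proof -
  have G0: "\<And>z. z \<in> T \<Longrightarrow> partials S [] g z = g' z" by (simp add: assms)
  have der: "\<And>vs z. vs \<in> words \<Longrightarrow> length vs < r \<Longrightarrow> z \<in> T \<Longrightarrow>
      (partials S vs g has_derivative dlin (partials S (1 # vs) g z) (partials S (\<i> # vs) g z)) (at z within T)"
    using Ck_on_has_derivative[OF assms(1)] assms(3) has_derivative_subset by blast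
  have cont: "\<And>vs. vs \<in> words \<Longrightarrow> length vs = r \<Longrightarrow> continuous_on T (partials S vs g)"
    using Ck_on_continuous[OF assms(1)] assms(3) continuous_on_subset by blast
  note * = assms(2) G0 der cont
  show "vs \<in> words \<Longrightarrow> length vs \<le> r \<Longrightarrow> z \<in> T \<Longrightarrow> partials T vs g' z = partials S vs g z"
    by (rule partials_family[where G = "\<lambda>vs. partials S vs g", OF *]) auto
  show "Ck_on r T g'"
    by (rule Ck_on_family[where G = "\<lambda>vs. partials S vs g", OF *]) auto
qed

lemma
  fixes g h :: "complex \<Rightarrow> 'b::real_normed_vector"
  assumes "Ck_on r S g" "Ck_on r S h" "half_open S" "\<And>z. z \<in> S \<Longrightarrow> k z = a *\<^sub>R g z + b *\<^sub>R h z"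
  shows partials_linear: "vs \<in> words \<Longrightarrow> length vs \<le> r \<Longrightarrow> z \<in> S \<Longrightarrow>
      partials S vs k z = a *\<^sub>R partials S vs g z + b *\<^sub>R partials S vs h z"
    and Ck_on_linear: "Ck_on r S k"
proof -
  define G where "G = (\<lambda>vs z. a *\<^sub>R partials S vs g z + b *\<^sub>R partials S vs h z)"
  have G0: "\<And>z. z \<in> S \<Longrightarrow> G [] z = k z" by (simp add: assms G_def)
  have der: "(G vs has_derivative dlin (G (1 # vs) z) (G (\<i> # vs) z)) (at z within S)"
    if "vs \<in> words" "length vs < r" "z \<in> S" for vs z
  proof -
    have "(G vs has_derivative (\<lambda>x. a *\<^sub>R dlin (partials S (1 # vs) g z) (partials S (\<i> # vs) g z) x
        + b *\<^sub>R dlin (partials S (1 # vs) h z) (partials S (\<i> # vs) h z) x)) (at z within S)"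
      unfolding G_def using assms(1,2)[THEN Ck_on_has_derivative] that
      by (intro has_derivative_add has_derivative_scaleR_right) auto
    then show ?thesis
      by (rule has_derivative_eq_rhs) (auto simp: G_def dlin_def algebra_simps)
  qed
  have cont: "continuous_on S (G vs)" if "vs \<in> words" "length vs = r" for vs
    unfolding G_def using assms(1,2)[THEN Ck_on_continuous] that by (intro continuous_intros) auto
  note * = assms(3) G0 der cont
  show "vs \<in> words \<Longrightarrow> length vs \<le> r \<Longrightarrow> z \<in> S \<Longrightarrow>
      partials S vs k z = a *\<^sub>R partials S vs g z + b *\<^sub>R partials S vs h z"
    using partials_family[where G = G, OF *] by (auto simp: G_def)
  show "Ck_on r S k"
    by (rule Ck_on_family[where G = G, OF *]) auto
qed

section \<open>Change of coordinates\<close>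

text \<open>
  Real polynomials in the real and imaginary parts of \<open>F\<close> and its derivatives (the factor \<open>w = - \<i>\<close>
  turns real parts into imaginary ones). These are the coefficients that the chain rule produces, and
  the point of the definition is that they are closed under differentiation.
\<close>

inductive_set jet_polynomials :: "(complex \<Rightarrow> complex) \<Rightarrow> (complex \<Rightarrow> real) set" for F where
  const: "(\<lambda>z. c) \<in> jet_polynomials F"
| jet: "(\<lambda>z. Re (w * (deriv ^^ k) F z)) \<in> jet_polynomials F"
| add: "a \<in> jet_polynomials F \<Longrightarrow> b \<in> jet_polynomials F \<Longrightarrow> (\<lambda>z. a z + b z) \<in> jet_polynomials F"
| mult: "a \<in> jet_polynomials F \<Longrightarrow> b \<in> jet_polynomials F \<Longrightarrow> (\<lambda>z. a z * b z) \<in> jet_polynomials F"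

lemma jet_polynomials_derivative:
  assumes "open W" "F holomorphic_on W" "a \<in> jet_polynomials F"
  shows "\<exists>b\<in>jet_polynomials F. \<exists>c\<in>jet_polynomials F.
    \<forall>z\<in>W. (a has_derivative dlin (b z) (c z)) (at z)"
  using assms(3)
proof induction
  case (const c)
  show ?case
    by (rule bexI[OF bexI[OF _ jet_polynomials.const[of 0]] jet_polynomials.const[of 0]])
      (auto simp: dlin_def)
next
  case (jet w k)
  have "((\<lambda>z. Re (w * (deriv ^^ k) F z)) has_derivative
      dlin (Re (w * (deriv ^^ Suc k) F z)) (Re ((w * \<i>) * (deriv ^^ Suc k) F z))) (at z)" if "z \<in> W" for z
  proof -
    have "((deriv ^^ k) F has_field_derivative (deriv ^^ Suc k) F z) (at z)"
      using holomorphic_higher_deriv[OF assms(2,1), of k] assms(1) that holomorphic_derivI by fastforce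
    then have "((\<lambda>z. Re (w * (deriv ^^ k) F z)) has_derivative (\<lambda>h. Re (w * ((deriv ^^ Suc k) F z * h)))) (at z)"
      unfolding has_field_derivative_def by (intro has_derivative_Re has_derivative_mult_right)
    then show ?thesis
      by (rule has_derivative_eq_rhs) (auto simp: dlin_def algebra_simps)
  qed
  then show ?case
    by (intro bexI[of _ "\<lambda>z. Re (w * (deriv ^^ Suc k) F z)"]
      bexI[of _ "\<lambda>z. Re ((w * \<i>) * (deriv ^^ Suc k) F z)"] ballI jet_polynomials.jet)
next
  case (add a b)
  then obtain a1 a2 b1 b2 where *: "a1 \<in> jet_polynomials F" "a2 \<in> jet_polynomials F"
      "b1 \<in> jet_polynomials F" "b2 \<in> jet_polynomials F"
    and d: "\<And>z. z \<in> W \<Longrightarrow> (a has_derivative dlin (a1 z) (a2 z)) (at z)"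
      "\<And>z. z \<in> W \<Longrightarrow> (b has_derivative dlin (b1 z) (b2 z)) (at z)" by meson
  have "((\<lambda>z. a z + b z) has_derivative dlin (a1 z + b1 z) (a2 z + b2 z)) (at z)" if "z \<in> W" for z
    by (rule has_derivative_eq_rhs[OF has_derivative_add[OF d[OF that]]])
      (auto simp: dlin_def algebra_simps)
  then show ?case
    using * jet_polynomials.add[of _ F] by (intro bexI[of _ "\<lambda>z. a1 z + b1 z"] bexI[of _ "\<lambda>z. a2 z + b2 z"]) auto
next
  case (mult a b)
  then obtain a1 a2 b1 b2 where *: "a1 \<in> jet_polynomials F" "a2 \<in> jet_polynomials F"
      "b1 \<in> jet_polynomials F" "b2 \<in> jet_polynomials F"
    and d: "\<And>z. z \<in> W \<Longrightarrow> (a has_derivative dlin (a1 z) (a2 z)) (at z)"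
      "\<And>z. z \<in> W \<Longrightarrow> (b has_derivative dlin (b1 z) (b2 z)) (at z)" by meson
  have "((\<lambda>z. a z * b z) has_derivative dlin (a z * b1 z + a1 z * b z) (a z * b2 z + a2 z * b z)) (at z)"
    if "z \<in> W" for z
    by (rule has_derivative_eq_rhs[OF has_derivative_mult[OF d[OF that]]])
      (auto simp: dlin_def algebra_simps)
  then show ?case
    using * mult.hyps jet_polynomials.add[of _ F] jet_polynomials.mult[of _ F]
    by (intro bexI[of _ "\<lambda>z. a z * b1 z + a1 z * b z"] bexI[of _ "\<lambda>z. a z * b2 z + a2 z * b z"]) auto
qed

lemma jet_polynomials_continuous:
  assumes "open W" "F holomorphic_on W" "a \<in> jet_polynomials F"
  shows "continuous_on W a"
  using jet_polynomials_derivative[OF assms] has_derivative_continuous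
    continuous_at_imp_continuous_on by metis

text \<open>
  Differentiating one term \<open>a \<cdot> (\<partial>\<^sub>w\<^sub>s g \<circ> F)\<close> gives three terms of the same kind, so no combinatorial
  formula for the coefficients is needed. What matters is that the list \<open>L\<close> is chosen before \<open>g\<close>: this
  makes the \<open>C\<^sup>k\<close> seminorms in two charts comparable uniformly in the map.
\<close>

lemma partials_compose_holomorphic:
  fixes F :: "complex \<Rightarrow> complex" 
  assumes W: "open W" "F holomorphic_on W" and T: "half_open T" "T \<subseteq> W" "F ` T \<subseteq> S"
    and "vs \<in> words"
  shows "\<exists>L. (\<forall>(a, ws) \<in> set L. a \<in> jet_polynomials F \<and> ws \<in> words \<and> length ws \<le> length vs) \<and>
    (\<forall>(g :: complex \<Rightarrow> 'b::real_normed_vector). Ck_on (length vs) S g \<longrightarrow> (\<forall>z\<in>T.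
      partials T vs (g \<circ> F) z = (\<Sum>(a, ws)\<leftarrow>L. a z *\<^sub>R partials S ws g (F z))))"
  using assms(6)
proof (induction vs)
  case Nil
  show ?case
    by (rule exI[of _ "[(\<lambda>z. 1, [])]"]) (auto intro: jet_polynomials.const)
next
  case (Cons v vs)
  then have v: "v \<in> {1, \<i>}" and vs: "vs \<in> words" by auto
  from Cons.IH obtain L where
    L0: "\<forall>(a, ws) \<in> set L. a \<in> jet_polynomials F \<and> ws \<in> words \<and> length ws \<le> length vs"
    and eq0: "\<forall>(g :: complex \<Rightarrow> 'b). Ck_on (length vs) S g \<longrightarrow> (\<forall>z\<in>T.
      partials T vs (g \<circ> F) z = (\<Sum>(a, ws)\<leftarrow>L. a z *\<^sub>R partials S ws g (F z)))"
    by (elim exE conjE)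
  have L: "a \<in> jet_polynomials F \<and> ws \<in> words \<and> length ws \<le> length vs" if "(a, ws) \<in> set L" for a ws
    using bspec[OF L0 that] by simp
  have eq: "partials T vs (g \<circ> F) z = (\<Sum>(a, ws)\<leftarrow>L. a z *\<^sub>R partials S ws g (F z))"
    if "Ck_on (length vs) S g" "z \<in> T" for g :: "complex \<Rightarrow> 'b" and z
    using eq0 that by blast
  have "\<forall>a\<in>jet_polynomials F. \<exists>b\<in>jet_polynomials F. \<exists>c\<in>jet_polynomials F. \<forall>z\<in>W. (a has_derivative dlin (b z) (c z)) (at z)"
    using jet_polynomials_derivative[OF W] by blast
  then obtain D1 D2 where D: "\<And>a. a \<in> jet_polynomials F \<Longrightarrow> D1 a \<in> jet_polynomials F"
      "\<And>a. a \<in> jet_polynomials F \<Longrightarrow> D2 a \<in> jet_polynomials F"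
      "\<And>a z. a \<in> jet_polynomials F \<Longrightarrow> z \<in> W \<Longrightarrow> (a has_derivative dlin (D1 a z) (D2 a z)) (at z)"
    by metis
  define D where "D = (if v = 1 then D1 else D2)"
  have Dv: "dlin (D1 a z) (D2 a z) v = D a z" for a z
    using v by (auto simp: D_def)
  have DJ: "D a \<in> jet_polynomials F" if "a \<in> jet_polynomials F" for a
    using that D by (auto simp: D_def)
  \<comment> \<open>The coordinates \<open>x + \<i> y = v F'(z)\<close> of the image of the direction \<open>v\<close>.\<close>
  define x where "x = (\<lambda>z. Re (v * (deriv ^^ 1) F z))"
  define y where "y = (\<lambda>z. Re ((- \<i> * v) * (deriv ^^ 1) F z))"
  have xy: "x \<in> jet_polynomials F" "y \<in> jet_polynomials F"
    unfolding x_def y_def by (rule jet_polynomials.jet)+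
  define L' where "L' = map (\<lambda>(a, ws). (D a, ws)) L @ map (\<lambda>(a, ws). (\<lambda>z. a z * x z, 1 # ws)) L
      @ map (\<lambda>(a, ws). (\<lambda>z. a z * y z, \<i> # ws)) L"
  have "a \<in> jet_polynomials F \<and> ws \<in> words \<and> length ws \<le> length (v # vs)" if "(a, ws) \<in> set L'" for a ws
    using that L xy DJ by (fastforce simp: L'_def intro: jet_polynomials.mult)
  moreover have "partials T (v # vs) (g \<circ> F) z = (\<Sum>(a, ws)\<leftarrow>L'. a z *\<^sub>R partials S ws g (F z))"
    if g: "Ck_on (length (v # vs)) S g" and z: "z \<in> T" for g :: "complex \<Rightarrow> 'b" and z
  proof -
    have zW: "z \<in> W" using z T by auto
    have Fd: "(F has_derivative (\<lambda>h. deriv F z * h)) (at z within T)"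
      using holomorphic_derivI[OF W(2,1) zW] by (simp add: has_field_derivative_def has_derivative_at_withinI)
    have summand: "((\<lambda>z. a z *\<^sub>R partials S ws g (F z)) has_derivative
        (\<lambda>h. a z *\<^sub>R dlin (partials S (1 # ws) g (F z)) (partials S (\<i> # ws) g (F z)) (deriv F z * h)
          + dlin (D1 a z) (D2 a z) h *\<^sub>R partials S ws g (F z))) (at z within T)"
      if "(a, ws) \<in> set L" for a ws
    proof -
      have ws: "ws \<in> words" "length ws < length (v # vs)" and a: "a \<in> jet_polynomials F"
        using L[OF that] by auto
      have "((\<lambda>z. partials S ws g (F z)) has_derivative
          (\<lambda>h. dlin (partials S (1 # ws) g (F z)) (partials S (\<i> # ws) g (F z)) (deriv F z * h))) (at z within T)"
        using Ck_on_has_derivative[OF g ws, of "F z"] z T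
        by (intro has_derivative_in_compose[OF Fd] has_derivative_subset[OF _ T(3)]) auto
      then show ?thesis
        using D(3)[OF a zW] by (intro has_derivative_scaleR) (auto intro: has_derivative_at_withinI)
    qed
    have "((\<lambda>z. \<Sum>(a, ws)\<leftarrow>K. a z *\<^sub>R partials S ws g (F z)) has_derivative
        (\<lambda>h. \<Sum>(a, ws)\<leftarrow>K. a z *\<^sub>R dlin (partials S (1 # ws) g (F z)) (partials S (\<i> # ws) g (F z)) (deriv F z * h)
          + dlin (D1 a z) (D2 a z) h *\<^sub>R partials S ws g (F z))) (at z within T)"
      if "set K \<subseteq> set L" for K
      using that
    proof (induction K)
      case Nil then show ?case by simp
    next
      case (Cons p K)
      obtain a ws where p: "p = (a, ws)" by fastforce
      show ?case using Cons by (auto simp: p intro!: has_derivative_add summand)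
    qed
    note sum = this[OF order_refl]
    have "(partials T vs (g \<circ> F) has_derivative
        (\<lambda>h. \<Sum>(a, ws)\<leftarrow>L. a z *\<^sub>R dlin (partials S (1 # ws) g (F z)) (partials S (\<i> # ws) g (F z)) (deriv F z * h)
          + dlin (D1 a z) (D2 a z) h *\<^sub>R partials S ws g (F z))) (at z within T)"
    proof (rule has_derivative_transform[OF z _ sum])
      show "partials T vs (g \<circ> F) x = (\<Sum>(a, ws)\<leftarrow>L. a x *\<^sub>R partials S ws g (F x))" if "x \<in> T" for x
        by (rule eq[OF Ck_on_mono[OF g] that]) simp
    qed
    then have "partials T (v # vs) (g \<circ> F) z
        = (\<Sum>(a, ws)\<leftarrow>L. a z *\<^sub>R dlin (partials S (1 # ws) g (F z)) (partials S (\<i> # ws) g (F z)) (deriv F z * v)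
          + dlin (D1 a z) (D2 a z) v *\<^sub>R partials S ws g (F z))"
      by (simp add: partials_Cons frechet_derivative_within_half_open[OF T(1) z])
    also have "\<dots> = (\<Sum>(a, ws)\<leftarrow>L'. a z *\<^sub>R partials S ws g (F z))"
      unfolding L'_def Dv
      by (induction L) (auto simp: x_def y_def dlin_def algebra_simps)
    finally show ?thesis .
  qed
  ultimately show ?case
    by (intro exI[of _ L']) (auto simp: comp_def)
qed

section \<open>Reflection\<close>

lemma half_open_upper_part:
  assumes "half_open S" shows "open (S \<inter> {z. 0 < Im z})"
proof -
  obtain O' where O: "open O'" "S = upper_half_plane \<inter> O'"
    using assms by (auto simp: openin_open)
  then have "S \<inter> {z. 0 < Im z} = O' \<inter> {z. 0 < Im z}" by (auto simp: upper_half_plane_def)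
  then show ?thesis using O open_halfspace_Im_gt[of 0] by (simp add: open_Int)
qed

text \<open>
  If \<open>w\<close> were an interior point, the open mapping theorem would give a full neighbourhood of the real
  point \<open>\<sigma> w\<close> inside the upper half-plane.
\<close>

lemma biholomorphic_preserves_boundary:
  assumes T: "half_open T" and T': "half_open T'"
    and \<sigma>: "\<sigma> holomorphic_on T'" "\<And>w. w \<in> T' \<Longrightarrow> \<sigma> w \<in> T" "inj_on \<sigma> T'"
    and w: "w \<in> T'" "Im (\<sigma> w) = 0"
  shows "Im w = 0"
proof (rule ccontr)
  assume "Im w \<noteq> 0"
  define B where "B = T' \<inter> {z. 0 < Im z}"
  have wB: "w \<in> B" using w(1) half_open_Im[OF T' w(1)] \<open>Im w \<noteq> 0\<close> by (auto simp: B_def)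
  have "open (\<sigma> ` B)"
    using \<sigma> by (intro open_mapping_thm3) (auto simp: B_def half_open_upper_part[OF T'] inj_on_subset intro: holomorphic_on_subset)
  then obtain e where e: "e > 0" "cball (\<sigma> w) e \<subseteq> \<sigma> ` B"
    using wB open_contains_cball by blast
  have "\<sigma> w - \<i> * of_real e \<in> cball (\<sigma> w) e" using e(1) by (simp add: dist_norm norm_mult)
  then have "\<sigma> w - \<i> * of_real e \<in> \<sigma> ` B" using e(2) by blast
  then have "\<sigma> w - \<i> * of_real e \<in> T" using \<sigma>(2) by (auto simp: B_def simp del: diff_conv_add_uminus)
  then show False using half_open_Im[OF T] w(2) e(1) by fastforce
qed

text \<open>
  Reflecting \<open>T\<close> in the real axis gives an open set, because near a real point \<open>T\<close> is a half-disc.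
\<close>

lemma Schwarz_extension:
  assumes T: "half_open T" and hol: "\<tau> holomorphic_on T" and real: "\<And>z. z \<in> T \<Longrightarrow> Im z = 0 \<Longrightarrow> Im (\<tau> z) = 0"
  obtains W F where "open W" "T \<subseteq> W" "F holomorphic_on W" "\<And>z. z \<in> T \<Longrightarrow> F z = \<tau> z"
proof -
  define W where "W = T \<union> cnj ` T"
  have W_eq: "W = {z. z \<in> T \<or> cnj z \<in> T}" by (auto simp: W_def image_iff) (metis complex_cnj_cnj)
  have "open W"
  proof (rule openI)
    have ball: "\<exists>e>0. ball z e \<subseteq> W" if z: "z \<in> T" for z
    proof -
      obtain d where d: "d > 0" "ball z d \<inter> upper_half_plane \<subseteq> T" using half_open_ball[OF T z] .
      show ?thesis
      proof (cases "Im z = 0")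
        case True
        have "ball z d \<subseteq> W"
        proof
          fix x assume x: "x \<in> ball z d"
          have "cnj z = z" using True by (simp add: complex_eq_iff)
          then have "cnj x \<in> ball z d" using x by (metis complex_cnj_diff complex_mod_cnj dist_norm mem_ball)
          then show "x \<in> W" using x d by (cases "0 \<le> Im x") (auto simp: W_eq upper_half_plane_def)
        qed
        then show ?thesis using d by blast
      next
        case False
        then have "z \<in> T \<inter> {z. 0 < Im z}" using half_open_Im[OF T z] z by auto
        then obtain e where "e > 0" "ball z e \<subseteq> T \<inter> {z. 0 < Im z}"
          using half_open_upper_part[OF T] open_contains_ball by blast
        then show ?thesis by (auto simp: W_def)
      qed
    qed
    fix z assume "z \<in> W"
    then consider "z \<in> T" | "cnj z \<in> T" by (auto simp: W_eq)
    then show "\<exists>e>0. ball z e \<subseteq> W"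
    proof cases
      case 1 then show ?thesis by (rule ball)
    next
      case 2
      then obtain e where e: "e > 0" "ball (cnj z) e \<subseteq> W" using ball by blast
      have "ball z e \<subseteq> W"
      proof
        fix x assume "x \<in> ball z e"
        then have "cnj x \<in> ball (cnj z) e" by (metis complex_cnj_diff complex_mod_cnj dist_norm mem_ball)
        then show "x \<in> W" using e by (auto simp: W_eq)
      qed
      then show ?thesis using e by blast
    qed
  qed
  moreover have WT: "W \<inter> {z. 0 \<le> Im z} = T"
  proof -
    have "z \<in> T" if "cnj z \<in> T" "0 \<le> Im z" for z
    proof -
      have "Im z = 0" using half_open_Im[OF T that(1)] that(2) by simp
      then have "cnj z = z" by (simp add: complex_eq_iff)
      then show ?thesis using that by simp
    qed
    then show ?thesis using half_open_Im[OF T] by (auto simp: W_eq)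
  qed
  moreover have "(\<lambda>z. if 0 \<le> Im z then \<tau> z else cnj (\<tau> (cnj z))) holomorphic_on W"
  proof (rule Schwarz_reflection)
    show "cnj ` W \<subseteq> W" by (auto simp: W_eq)
    have "W \<inter> {z. 0 < Im z} \<subseteq> T" using WT by auto
    then show "\<tau> holomorphic_on W \<inter> {z. 0 < Im z}" using hol holomorphic_on_subset by blast
    show "continuous_on (W \<inter> {z. 0 \<le> Im z}) \<tau>" using WT hol holomorphic_on_imp_continuous_on by simp
    show "\<tau> z \<in> \<real>" if "z \<in> W" "z \<in> \<real>" for z
      using that real[of z] WT by (auto simp: complex_is_Real_iff)
  qed fact
  ultimately show thesis using that[of W "\<lambda>z. if 0 \<le> Im z then \<tau> z else cnj (\<tau> (cnj z))"] half_open_Im[OF T]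
    by (auto simp: W_def)
qed

section \<open>Harmonic maps and holomorphic derivatives\<close>

lemma has_real_derivative_along_line:
  fixes u :: "complex \<Rightarrow> real"
  assumes "(u has_derivative D) (at (c + of_real s * v))"
  shows "((\<lambda>s. u (c + of_real s * v)) has_real_derivative D v) (at s)"
proof -
  interpret bounded_linear D using assms by (rule has_derivative_bounded_linear)
  have "((\<lambda>s. c + of_real s * v) has_derivative (\<lambda>h. of_real h * v)) (at s)"
    by (rule has_derivative_eq_rhs[OF has_derivative_add[OF has_derivative_const
        has_derivative_mult_left[OF has_derivative_of_real[OF has_derivative_ident]]]]) auto
  from diff_chain_at[OF this assms] have "((\<lambda>s. u (c + of_real s * v)) has_derivative (\<lambda>h. D (of_real h * v))) (at s)"
    by (simp add: o_def)
  moreover have "D (of_real h * v) = D v * h" for h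
    using scaleR[of h v] by (simp add: scaleR_conv_of_real mult.commute)
  ultimately show ?thesis by (simp add: has_field_derivative_def mult_commute_abs)
qed

lemma second_difference_mean_value:
  fixes u :: "complex \<Rightarrow> real"
  assumes "0 < t" and pos: "\<And>x y. 0 \<le> x \<Longrightarrow> x \<le> t \<Longrightarrow> 0 \<le> y \<Longrightarrow> y \<le> t \<Longrightarrow> p + of_real x * v + of_real y * w \<in> W"
    and u: "\<And>z. z \<in> W \<Longrightarrow> \<exists>D. (u has_derivative D) (at z) \<and> D v = a z"
    and a: "\<And>z. z \<in> W \<Longrightarrow> \<exists>D. (a has_derivative D) (at z) \<and> D w = c z"
  shows "\<exists>z\<in>W. u (p + of_real t * v + of_real t * w) - u (p + of_real t * v) - u (p + of_real t * w) + u p = t * t * c z"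
proof -
  have du: "((\<lambda>x. u (q + of_real x * v)) has_real_derivative a (q + of_real x * v)) (at x)" if "q + of_real x * v \<in> W" for q x
    using u[OF that] has_real_derivative_along_line by metis
  have da: "((\<lambda>y. a (q + of_real y * w)) has_real_derivative c (q + of_real y * w)) (at y)" if "q + of_real y * w \<in> W" for q y
    using a[OF that] has_real_derivative_along_line by metis
  have "\<exists>x. 0 < x \<and> x < t \<and>
    (u (p + of_real t * w + of_real t * v) - u (p + of_real t * v)) - (u (p + of_real t * w + of_real 0 * v) - u (p + of_real 0 * v))
      = (t - 0) * (a (p + of_real t * w + of_real x * v) - a (p + of_real x * v))"
  proof (rule MVT2[OF assms(1)])
    fix x :: real assume "0 \<le> x" "x \<le> t"
    then show "((\<lambda>x. u (p + of_real t * w + of_real x * v) - u (p + of_real x * v)) has_real_derivative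
       a (p + of_real t * w + of_real x * v) - a (p + of_real x * v)) (at x)"
      using pos[of x t] pos[of x 0] assms(1) by (intro DERIV_diff du) (auto simp: add_ac)
  qed
  then obtain x where x: "0 < x" "x < t" and 1: "u (p + of_real t * v + of_real t * w) - u (p + of_real t * v) - u (p + of_real t * w) + u p
      = t * (a (p + of_real x * v + of_real t * w) - a (p + of_real x * v))"
    by (auto simp: add_ac)
  have "\<exists>y. 0 < y \<and> y < t \<and> a (p + of_real x * v + of_real t * w) - a (p + of_real x * v + of_real 0 * w)
      = (t - 0) * c (p + of_real x * v + of_real y * w)"
    using pos[of x] x by (intro MVT2[OF assms(1)] da) auto
  then obtain y where "0 < y" "y < t"
    "a (p + of_real x * v + of_real t * w) - a (p + of_real x * v) = t * c (p + of_real x * v + of_real y * w)"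
    by auto
  then show ?thesis using 1 x pos[of x y] by (intro bexI[of _ "p + of_real x * v + of_real y * w"]) auto
qed

text \<open>
  By the mean value theorem, applied to the two directions in either order, the second difference of \<open>u\<close>
  over a small square at \<open>p\<close> is the area times a value of \<open>ab\<close> near \<open>p\<close>, and also the area times a value of
  \<open>ba\<close> near \<open>p\<close>. Both functions are continuous.
\<close>

lemma mixed_partials_equal:
  fixes u :: "complex \<Rightarrow> real"
  assumes "open W" "p \<in> W"
    and u: "\<And>z. z \<in> W \<Longrightarrow> (u has_derivative dlin (a z) (b z)) (at z)"
    and a: "\<And>z. z \<in> W \<Longrightarrow> (a has_derivative dlin (aa z) (ab z)) (at z)"
    and b: "\<And>z. z \<in> W \<Longrightarrow> (b has_derivative dlin (ba z) (bb z)) (at z)"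
    and cont: "continuous_on W ab" "continuous_on W ba"
  shows "ab p = ba p"
proof (rule ccontr)
  assume "ab p \<noteq> ba p"
  \<comment> \<open>Half the gap, so that values within \<open>e\<close> of \<open>ab p\<close> and of \<open>ba p\<close> cannot coincide.\<close>
  define e where "e = \<bar>ab p - ba p\<bar> / 2"
  have "e > 0" using \<open>ab p \<noteq> ba p\<close> by (simp add: e_def)
  obtain d where d: "d > 0" "ball p d \<subseteq> W" "\<And>w. w \<in> ball p d \<Longrightarrow> \<bar>ab w - ab p\<bar> < e \<and> \<bar>ba w - ba p\<bar> < e"
  proof -
    obtain d0 where "d0 > 0" "ball p d0 \<subseteq> W" using assms(1,2) open_contains_ball by blast
    moreover obtain d1 where "d1 > 0" "\<And>w. w \<in> W \<Longrightarrow> dist w p < d1 \<Longrightarrow> dist (ab w) (ab p) < e"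
      using cont(1) \<open>e > 0\<close> assms(2) unfolding continuous_on_iff by metis
    moreover obtain d2 where "d2 > 0" "\<And>w. w \<in> W \<Longrightarrow> dist w p < d2 \<Longrightarrow> dist (ba w) (ba p) < e"
      using cont(2) \<open>e > 0\<close> assms(2) unfolding continuous_on_iff by metis
    ultimately show thesis
      by (intro that[of "min d0 (min d1 d2)"]) (auto simp: dist_commute dist_real_def subset_eq)
  qed
  \<comment> \<open>The square with side \<open>t\<close> at \<open>p\<close> lies in the disc of radius \<open>d\<close>, as \<open>2 t < d\<close>.\<close>
  define t where "t = d / 3"
  have t: "t > 0" using d by (simp add: t_def)
  have in_ball: "p + of_real x + of_real y * \<i> \<in> ball p d" if "0 \<le> x" "x \<le> t" "0 \<le> y" "y \<le> t" for x y
  proof -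
    have "norm (of_real x + of_real y * \<i>) \<le> \<bar>x\<bar> + \<bar>y\<bar>"
      by (rule order_trans[OF norm_triangle_ineq]) (simp add: norm_mult)
    also have "\<dots> < d" using that d by (simp add: t_def)
    moreover have "p - (p + of_real x + of_real y * \<i>) = - (of_real x + of_real y * \<i>)" by simp
    ultimately show ?thesis by (simp only: mem_ball dist_norm norm_minus_cancel)
  qed
  have "\<exists>z\<in>ball p d. u (p + of_real t * 1 + of_real t * \<i>) - u (p + of_real t * 1) - u (p + of_real t * \<i>) + u p = t * t * ab z"
    using in_ball u[OF subsetD[OF d(2)]] a[OF subsetD[OF d(2)]]
    by (intro second_difference_mean_value[OF t, where a = a]) (auto intro!: exI[of _ "dlin _ _"])
  moreover have "\<exists>z\<in>ball p d. u (p + of_real t * \<i> + of_real t * 1) - u (p + of_real t * \<i>) - u (p + of_real t * 1) + u p = t * t * ba z"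
    using in_ball u[OF subsetD[OF d(2)]] b[OF subsetD[OF d(2)]]
    by (intro second_difference_mean_value[OF t, where a = b]) (auto simp: add_ac intro!: exI[of _ "dlin _ _"])
  ultimately obtain w w' where w: "w \<in> ball p d" "w' \<in> ball p d" and
    eq: "u (p + of_real t * 1 + of_real t * \<i>) - u (p + of_real t * 1) - u (p + of_real t * \<i>) + u p = t * t * ab w"
      "u (p + of_real t * \<i> + of_real t * 1) - u (p + of_real t * \<i>) - u (p + of_real t * 1) + u p = t * t * ba w'"
    by blast
  have "p + of_real t * \<i> + of_real t * 1 = p + of_real t * 1 + of_real t * \<i>" by simp
  then have "t * t * ab w = t * t * ba w'" using eq by (simp only:)
  then have "ab w = ba w'" using t by simp
  with w have "\<bar>ab p - ba p\<bar> < 2 * e" using d(3)[of w] d(3)[of w'] by linarith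
  then show False by (simp add: e_def)
qed


lemma has_derivative_vecI:
  fixes f :: "'b::real_normed_vector \<Rightarrow> real ^ 'n"
  assumes "\<And>j. ((\<lambda>z. f z $ j) has_derivative (\<lambda>h. D h $ j)) (at x within S)"
  shows "(f has_derivative D) (at x within S)"
  unfolding has_derivative_componentwise_within[of f]
  using assms by (auto simp: Basis_vec_def inner_axis)

lemma has_derivative_vec_nth:
  fixes f :: "complex \<Rightarrow> real ^ 'n"
  assumes "(f has_derivative dlin a b) F"
  shows "((\<lambda>z. f z $ j) has_derivative dlin (a $ j) (b $ j)) F"
  by (rule has_derivative_eq_rhs[OF bounded_linear.has_derivative[OF bounded_linear_vec_nth assms]])
    (auto simp: dlin_def)

text \<open>
  The derivative \<open>\<partial>g/\<partial>z\<close>.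
\<close>

definition wirtinger :: "complex set \<Rightarrow> (complex \<Rightarrow> real ^ 'n) \<Rightarrow> complex \<Rightarrow> complex ^ 'n"
  where "wirtinger S g z = (\<chi> j.
    (complex_of_real (partials S [1] g z $ j) - \<i> * complex_of_real (partials S [\<i>] g z $ j)) / 2)"

lemma partials_wirtinger:
  "partials S [1] g z = (\<chi> j. 2 * Re (wirtinger S g z $ j))"
  "partials S [\<i>] g z = (\<chi> j. - 2 * Im (wirtinger S g z $ j))"
  by (simp_all add: wirtinger_def vec_eq_iff)

text \<open>
  Laplace's equation together with the symmetry of second derivatives is the system of
  Cauchy-Riemann equations for \<open>\<partial>g/\<partial>z\<close>.
\<close>

lemma harmonic_imp_holomorphic_wirtinger:
  fixes g :: "complex \<Rightarrow> real ^ 'n"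
  assumes "open W" "harmonic_on W g"
  shows "(\<lambda>z. wirtinger W g z $ j) holomorphic_on W"
proof (rule holomorphic_onI)
  fix z assume z: "z \<in> W"
  have C: "Ck_on 2 W g" and lap: "\<And>z. z \<in> W \<Longrightarrow> partials W [1, 1] g z + partials W [\<i>, \<i>] g z = 0"
    using assms by (auto simp: harmonic_on_def)
  define P where "P = (\<lambda>vs z. partials W vs g z $ j)"
  have P: "(P vs has_derivative dlin (P (1 # vs) w) (P (\<i> # vs) w)) (at w)"
    if "vs \<in> words" "length vs < 2" "w \<in> W" for vs w
    unfolding P_def
    by (rule has_derivative_vec_nth[OF Ck_on_has_derivative[OF C that,
            unfolded at_within_open[OF that(3) assms(1)]]])
  have cont: "continuous_on W (P vs)" if "vs \<in> words" "length vs \<le> 2" for vs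
    unfolding P_def using Ck_on_continuous[OF C that] by (intro continuous_intros)
  have mixed: "P [\<i>, 1] z = P [1, \<i>] z"
    using assms(1) z P[of "[]"] P[of "[1]"] P[of "[\<i>]"] cont[of "[\<i>, 1]"] cont[of "[1, \<i>]"]
    by (intro mixed_partials_equal[of W z "P []" "P [1]" "P [\<i>]" "P [1, 1]" _ _ "P [\<i>, \<i>]"]) auto
  have lap': "P [\<i>, \<i>] z = - P [1, 1] z"
    using arg_cong[OF lap[OF z], of "\<lambda>v. v $ j"] by (simp add: P_def)
  have "((\<lambda>z. (of_real (P [1] z) - \<i> * of_real (P [\<i>] z)) / 2) has_derivative
      (\<lambda>h. (of_real (dlin (P [1, 1] z) (P [\<i>, 1] z) h) - \<i> * of_real (dlin (P [1, \<i>] z) (P [\<i>, \<i>] z) h)) / 2)) (at z)"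
    using P[of "[1]" z] P[of "[\<i>]" z] z
    by (intro bounded_linear.has_derivative[OF bounded_linear_divide] has_derivative_diff
        has_derivative_mult_right has_derivative_of_real) auto
  then have "((\<lambda>z. wirtinger W g z $ j) has_derivative (*) ((of_real (P [1, 1] z) - \<i> * of_real (P [\<i>, 1] z)) / 2)) (at z)"
    unfolding wirtinger_def P_def vec_lambda_beta
    by (rule has_derivative_eq_rhs)
      (use mixed lap' in \<open>auto simp: dlin_def P_def complex_eq_iff field_simps\<close>)
  then show "(\<lambda>z. wirtinger W g z $ j) field_differentiable at z within W"
    by (meson field_differentiable_at_within field_differentiable_def has_field_derivative_def)
qed

text \<open>
  With \<open>w = \<partial>g/\<partial>z\<close> the derivative of \<open>g\<close> in direction \<open>v\<close> is \<open>Re (2 v w)\<close>. As \<open>w\<close> is holomorphic, the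
  partial derivative along a word of length \<open>k + 1\<close> is the real part of \<open>2 w\<^sup>(\<^sup>k\<^sup>)\<close> times the product of the
  word, and \<open>1\<^sup>2 + \<i>\<^sup>2 = 0\<close>.
\<close>

lemma holomorphic_wirtinger_imp_harmonic:
  fixes g :: "complex \<Rightarrow> real ^ 'n"
  assumes "open W" "half_open W" "Ck_on 1 W g" and hol: "\<And>j. (\<lambda>z. wirtinger W g z $ j) holomorphic_on W"
  shows "harmonic_on W g"
proof -
  define H where "H = (\<lambda>j z. wirtinger W g z $ j)"
  define G where "G = (\<lambda>vs z. if vs = [] then g z else
    (\<chi> j. Re (2 * prod_list vs * (deriv ^^ (length vs - 1)) (H j) z)))"
  have hd: "(deriv ^^ k) (H j) holomorphic_on W" for k j
    using hol assms(1) unfolding H_def by (intro holomorphic_higher_deriv) auto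
  have der: "(G vs has_derivative dlin (G (1 # vs) z) (G (\<i> # vs) z)) (at z within W)"
    if vs: "vs \<in> words" "length vs < 2" and z: "z \<in> W" for vs z
  proof (cases "vs = []")
    case True
    have "partials W [1] g z = G [1] z" "partials W [\<i>] g z = G [\<i>] z"
      by (simp_all add: partials_wirtinger G_def H_def vec_eq_iff)
    then show ?thesis using Ck_on_has_derivative[OF assms(3), of "[]" z] z True by (simp add: G_def)
  next
    case False
    show ?thesis
    proof (rule has_derivative_vecI)
      fix j
      define k where "k = length vs - 1"
      have k: "length vs = Suc k" using False by (simp add: k_def)
      have "((deriv ^^ k) (H j) has_field_derivative (deriv ^^ Suc k) (H j) z) (at z)"
        using holomorphic_derivI[OF hd assms(1) z] by simp
      then have "((\<lambda>z. Re (2 * prod_list vs * (deriv ^^ k) (H j) z)) has_derivative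
          (\<lambda>h. Re (2 * prod_list vs * ((deriv ^^ Suc k) (H j) z * h)))) (at z within W)"
        unfolding has_field_derivative_def
        by (intro has_derivative_Re has_derivative_mult_right) (rule has_derivative_at_withinI)
      then show "((\<lambda>z. G vs z $ j) has_derivative (\<lambda>h. dlin (G (1 # vs) z) (G (\<i> # vs) z) h $ j)) (at z within W)"
        unfolding G_def using False
        by (auto simp: k dlin_def algebra_simps elim!: has_derivative_eq_rhs)
    qed
  qed
  have cont: "continuous_on W (G vs)" if "vs \<in> words" "length vs = 2" for vs
  proof -
    have "vs \<noteq> []" using that by auto
    then have "G vs = (\<lambda>z. \<chi> j. Re (2 * prod_list vs * (deriv ^^ (length vs - 1)) (H j) z))"
      by (auto simp: G_def)
    then show ?thesis
      by (simp only:) (intro continuous_intros hd[THEN holomorphic_on_imp_continuous_on])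
  qed
  have G0: "G [] z = g z" if "z \<in> W" for z by (simp add: G_def)
  have p: "partials W vs g z = G vs z" if "vs \<in> words" "length vs \<le> 2" "z \<in> W" for vs z
    using assms(2) G0 der cont that by (rule partials_family)
  have "partials W [1, 1] g z + partials W [\<i>, \<i>] g z = 0" if "z \<in> W" for z
    using that p[of "[1, 1]" z] p[of "[\<i>, \<i>]" z] by (simp add: G_def vec_eq_iff)
  moreover have "Ck_on 2 W g"
    using assms(2) G0 der cont by (rule Ck_on_family)
  ultimately show ?thesis by (simp add: harmonic_on_def)
qed

section \<open>Charts and transition maps\<close>

definition transition :: "'a chart \<Rightarrow> 'a chart \<Rightarrow> complex \<Rightarrow> complex"
  where "transition c d = snd d \<circ> inv_into (fst c) (snd c)"

definition overlap :: "'a chart \<Rightarrow> 'a chart \<Rightarrow> complex set"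
  where "overlap c d = snd c ` (fst c \<inter> fst d)"

definition chart_partial :: "'a chart \<Rightarrow> complex list \<Rightarrow> ('a \<Rightarrow> 'b::real_normed_vector) \<Rightarrow> 'a \<Rightarrow> 'b"
  where "chart_partial c vs X p = partials (chart_image c) vs (in_chart c X) (snd c p)"

locale bordered_surface =
  fixes M :: "'a topology" and A :: "'a chart set"
  assumes surface: "compact_bordered_Riemann_surface M A"
begin

lemma compact_M: "compact_space M" and Hausdorff_M: "Hausdorff_space M"
  using surface by (auto simp: compact_bordered_Riemann_surface_def)

lemma
  assumes "c \<in> A"
  shows chart_open: "openin M (fst c)"
    and chart_half_open: "half_open (chart_image c)"
    and chart_homeo: "homeomorphic_map (subtopology M (fst c)) (top_of_set (chart_image c)) (snd c)"
  using assms surface by (cases c; force simp: compact_bordered_Riemann_surface_def chart_image_def)+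

lemma chart_subset: "c \<in> A \<Longrightarrow> fst c \<subseteq> topspace M"
  using chart_open openin_subset by blast

lemma charts_cover: "p \<in> topspace M \<Longrightarrow> \<exists>c\<in>A. p \<in> fst c"
  using surface by (force simp: compact_bordered_Riemann_surface_def)

lemma nonempty: "topspace M \<noteq> {}"
  using surface chart_subset by (fastforce simp: compact_bordered_Riemann_surface_def surface_boundary_def)

lemma chart_inj: "c \<in> A \<Longrightarrow> inj_on (snd c) (fst c)"
  using homeomorphic_imp_injective_map[OF chart_homeo] chart_subset by (simp add: Int_absorb1)

lemma chart_inverse: "c \<in> A \<Longrightarrow> p \<in> fst c \<Longrightarrow> inv_into (fst c) (snd c) (snd c p) = p"
  using chart_inj by (rule inv_into_f_f)

lemma in_chart_image: "p \<in> fst c \<Longrightarrow> snd c p \<in> chart_image c"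
  by (simp add: chart_image_def)

lemma in_chart_at: "c \<in> A \<Longrightarrow> p \<in> fst c \<Longrightarrow> in_chart c X (snd c p) = X p"
  by (simp add: in_chart_def chart_inverse)

lemma chart_image_openin:
  assumes "c \<in> A" "openin M U" "U \<subseteq> fst c" shows "half_open (snd c ` U)"
proof -
  have "openin (subtopology M (fst c)) U" using assms by (simp add: openin_open_subtopology chart_open)
  then have "openin (top_of_set (chart_image c)) (snd c ` U)"
    using homeomorphic_imp_open_map[OF chart_homeo[OF assms(1)]] by (auto simp: open_map_def)
  then show ?thesis using chart_half_open[OF assms(1)] openin_trans by blast
qed

lemma chart_image_compact:
  assumes "c \<in> A" "compactin M K" "K \<subseteq> fst c" shows "compact (snd c ` K)"
proof -
  have "compactin (subtopology M (fst c)) K" using assms by (simp add: compactin_subtopology)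
  then have "compactin (top_of_set (chart_image c)) (snd c ` K)"
    using image_compactin homeomorphic_imp_continuous_map[OF chart_homeo[OF assms(1)]] by blast
  then show ?thesis by (simp add: compactin_subtopology)
qed

lemma chart_preimage_compact:
  assumes "c \<in> A" "compact S" "S \<subseteq> chart_image c" shows "compactin M (inv_into (fst c) (snd c) ` S)"
proof -
  have "homeomorphic_map (top_of_set (chart_image c)) (subtopology M (fst c)) (inv_into (fst c) (snd c))"
  proof -
    obtain g where g: "homeomorphic_maps (subtopology M (fst c)) (top_of_set (chart_image c)) (snd c) g"
      using chart_homeo[OF assms(1)] homeomorphic_map_maps by blast
    have "g z = inv_into (fst c) (snd c) z" if "z \<in> chart_image c" for z
      using that g chart_inverse[OF assms(1)] chart_subset[OF assms(1)]
      by (auto simp: homeomorphic_maps_def chart_image_def)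
    moreover have "homeomorphic_map (top_of_set (chart_image c)) (subtopology M (fst c)) g"
      using g homeomorphic_maps_sym homeomorphic_maps_map by blast
    ultimately show ?thesis by (auto intro: homeomorphic_map_eq)
  qed
  moreover have "compactin (top_of_set (chart_image c)) S" using assms by (simp add: compactin_subtopology)
  ultimately have "compactin (subtopology M (fst c)) (inv_into (fst c) (snd c) ` S)"
    using homeomorphic_imp_continuous_map image_compactin by blast
  then show ?thesis by (simp add: compactin_subtopology)
qed

lemma overlap_half_open: "c \<in> A \<Longrightarrow> d \<in> A \<Longrightarrow> half_open (overlap c d)"
  unfolding overlap_def by (rule chart_image_openin) (auto intro: chart_open)

lemma overlap_subset: "overlap c d \<subseteq> chart_image c"
  by (auto simp: overlap_def chart_image_def)

lemma transition_at: "c \<in> A \<Longrightarrow> p \<in> fst c \<Longrightarrow> transition c d (snd c p) = snd d p"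
  by (simp add: transition_def chart_inverse)

lemma transition_overlap: "c \<in> A \<Longrightarrow> z \<in> overlap c d \<Longrightarrow> transition c d z \<in> overlap d c"
  by (auto simp: overlap_def transition_at)

lemma transition_inverse:
  "c \<in> A \<Longrightarrow> d \<in> A \<Longrightarrow> z \<in> overlap c d \<Longrightarrow> transition d c (transition c d z) = z"
  by (auto simp: overlap_def transition_at)

lemma in_chart_transition:
  "c \<in> A \<Longrightarrow> d \<in> A \<Longrightarrow> z \<in> overlap c d \<Longrightarrow> in_chart c X z = in_chart d X (transition c d z)"
  by (auto simp: overlap_def transition_at in_chart_at)

lemma transition_holomorphic: "c \<in> A \<Longrightarrow> d \<in> A \<Longrightarrow> transition c d holomorphic_on overlap c d"
  using surface by (cases c; cases d) (fastforce simp: compact_bordered_Riemann_surface_def transition_def overlap_def)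

lemma transition_extension:
  assumes "c \<in> A" "d \<in> A"
  obtains W F where "open W" "overlap c d \<subseteq> W" "F holomorphic_on W"
    "\<And>z. z \<in> overlap c d \<Longrightarrow> F z = transition c d z"
proof (rule Schwarz_extension[OF overlap_half_open transition_holomorphic])
  fix z assume z: "z \<in> overlap c d" "Im z = 0"
  show "Im (transition c d z) = 0"
  proof (rule biholomorphic_preserves_boundary[OF overlap_half_open[OF assms]
        overlap_half_open[OF assms(2,1)] transition_holomorphic[OF assms(2,1)]])
    show "inj_on (transition d c) (overlap d c)"
      using transition_inverse assms by (metis inj_onI)
  qed (use assms z in \<open>auto simp: transition_overlap transition_inverse\<close>)
qed (use assms that in auto)

text \<open>
  Reflection makes the transition map holomorphic in a full neighbourhood of the overlap, so all its
  derivatives are continuous up to the boundary of the surface.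
\<close>

lemma chart_partial_change:
  assumes cd: "c \<in> A" "d \<in> A" and vs: "vs \<in> words"
  obtains L where
    "\<And>a ws. (a, ws) \<in> set L \<Longrightarrow> continuous_on (overlap c d) a \<and> ws \<in> words \<and> length ws \<le> length vs"
    "\<And>(X :: 'a \<Rightarrow> 'b::real_normed_vector) p. Ck_on (length vs) (chart_image c) (in_chart c X) \<Longrightarrow>
      Ck_on (length vs) (chart_image d) (in_chart d X) \<Longrightarrow> p \<in> fst c \<inter> fst d \<Longrightarrow>
      chart_partial c vs X p = (\<Sum>(a, ws)\<leftarrow>L. a (snd c p) *\<^sub>R chart_partial d ws X p)"
proof -
  obtain W F where W: "open W" "overlap c d \<subseteq> W" "F holomorphic_on W"
    and F: "\<And>z. z \<in> overlap c d \<Longrightarrow> F z = transition c d z"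
    using transition_extension[OF cd] by metis
  have "F ` overlap c d \<subseteq> chart_image d"
    using F transition_overlap[OF cd(1)] overlap_subset by (metis image_subsetI subsetD)
  from partials_compose_holomorphic[OF W(1,3) overlap_half_open[OF cd] W(2) this vs, where ?'b = 'b]
  obtain L where L: "\<forall>(a, ws) \<in> set L. a \<in> jet_polynomials F \<and> ws \<in> words \<and> length ws \<le> length vs"
    and eq: "\<forall>(g :: complex \<Rightarrow> 'b). Ck_on (length vs) (chart_image d) g \<longrightarrow> (\<forall>z\<in>overlap c d.
      partials (overlap c d) vs (g \<circ> F) z = (\<Sum>(a, ws)\<leftarrow>L. a z *\<^sub>R partials (chart_image d) ws g (F z)))"
    by (elim exE conjE)
  show thesis
  proof (rule that)
    show "continuous_on (overlap c d) a \<and> ws \<in> words \<and> length ws \<le> length vs" if "(a, ws) \<in> set L" for a ws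
      using bspec[OF L that] continuous_on_subset[OF jet_polynomials_continuous[OF W(1,3)] W(2)] by simp
    fix X :: "'a \<Rightarrow> 'b" and p
    assume X: "Ck_on (length vs) (chart_image c) (in_chart c X)" "Ck_on (length vs) (chart_image d) (in_chart d X)"
      and p: "p \<in> fst c \<inter> fst d"
    have z: "snd c p \<in> overlap c d" using p by (simp add: overlap_def)
    have "chart_partial c vs X p = partials (overlap c d) vs (in_chart d X \<circ> F) (snd c p)"
      unfolding chart_partial_def
      by (rule partials_restrict[OF X(1) overlap_half_open[OF cd] overlap_subset _ vs order_refl z, symmetric])
        (simp add: in_chart_transition[OF cd] F)
    also have "\<dots> = (\<Sum>(a, ws)\<leftarrow>L. a (snd c p) *\<^sub>R partials (chart_image d) ws (in_chart d X) (F (snd c p)))"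
      using eq X(2) z by blast
    also have "F (snd c p) = snd d p" using F[OF z] p cd by (simp add: transition_at)
    finally show "chart_partial c vs X p = (\<Sum>(a, ws)\<leftarrow>L. a (snd c p) *\<^sub>R chart_partial d ws X p)"
      by (simp add: chart_partial_def)
  qed
qed

text \<open>
  The coefficients of the chain rule are continuous on the overlap, hence bounded on \<open>K\<close>.
\<close>

lemma chart_partial_bound_change:
  assumes cd: "c \<in> A" "d \<in> A" and vs: "vs \<in> words" "length vs \<le> r"
    and K: "compactin M K" "K \<subseteq> fst c" "K \<subseteq> fst d"
  obtains C where "C \<ge> 0" "\<And>(X :: 'a \<Rightarrow> real ^ 'n) B p. X \<in> Cr_maps M A r \<Longrightarrow>
    (\<And>p ws. p \<in> K \<Longrightarrow> ws \<in> words \<Longrightarrow> length ws \<le> r \<Longrightarrow> norm (chart_partial d ws X p) \<le> B) \<Longrightarrow>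
    p \<in> K \<Longrightarrow> norm (chart_partial c vs X p) \<le> C * B"
proof -
  obtain L where L: "\<And>a ws. (a, ws) \<in> set L \<Longrightarrow> continuous_on (overlap c d) a \<and> ws \<in> words \<and> length ws \<le> length vs"
    and eq: "\<And>(X :: 'a \<Rightarrow> real ^ 'n) p. Ck_on (length vs) (chart_image c) (in_chart c X) \<Longrightarrow>
      Ck_on (length vs) (chart_image d) (in_chart d X) \<Longrightarrow> p \<in> fst c \<inter> fst d \<Longrightarrow>
      chart_partial c vs X p = (\<Sum>(a, ws)\<leftarrow>L. a (snd c p) *\<^sub>R chart_partial d ws X p)"
    using chart_partial_change[OF cd vs(1)] by metis
  have "\<exists>b\<ge>0. \<forall>p\<in>K. \<bar>a (snd c p)\<bar> \<le> b" if "(a, ws) \<in> set L" for a ws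
  proof -
    have "snd c ` K \<subseteq> overlap c d" using K by (auto simp: overlap_def)
    then have "compact (a ` (snd c ` K))"
      using L[OF that] chart_image_compact[OF cd(1) K(1,2)] compact_continuous_image continuous_on_subset by blast
    then show ?thesis
      using compact_imp_bounded bounded_pos[of "a ` (snd c ` K)"] by (auto intro: less_imp_le)
  qed
  then have "\<exists>b. b \<ge> 0 \<and> (\<forall>p\<in>K. \<bar>fst q (snd c p)\<bar> \<le> b)" if "q \<in> set L" for q
    using that by (metis prod.collapse)
  then obtain b where b: "\<And>q. q \<in> set L \<Longrightarrow> b q \<ge> 0" "\<And>q p. q \<in> set L \<Longrightarrow> p \<in> K \<Longrightarrow> \<bar>fst q (snd c p)\<bar> \<le> b q"
    by metis
  show thesis
  proof (rule that)
    show "sum_list (map b L) \<ge> 0" using b(1) by (intro sum_list_nonneg) auto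
    fix X :: "'a \<Rightarrow> real ^ 'n" and B p
    assume X: "X \<in> Cr_maps M A r" and p: "p \<in> K"
      and B: "\<And>p ws. p \<in> K \<Longrightarrow> ws \<in> words \<Longrightarrow> length ws \<le> r \<Longrightarrow> norm (chart_partial d ws X p) \<le> B"
    have "chart_partial c vs X p = (\<Sum>(a, ws)\<leftarrow>L. a (snd c p) *\<^sub>R chart_partial d ws X p)"
      using X cd vs p K by (intro eq) (auto simp: Cr_maps_def intro: Ck_on_mono)
    also have "norm \<dots> \<le> (\<Sum>(a, ws)\<leftarrow>L. norm (a (snd c p) *\<^sub>R chart_partial d ws X p))"
      by (induction L) (auto intro: order_trans[OF norm_triangle_ineq])
    also have "\<dots> \<le> (\<Sum>q\<leftarrow>L. b q * B)"
    proof (rule sum_list_mono)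
      fix q assume q: "q \<in> set L"
      have "\<bar>fst q (snd c p)\<bar> * norm (chart_partial d (snd q) X p) \<le> b q * B"
        using b[OF q] p B[OF p, of "snd q"] L[of "fst q" "snd q"] q vs by (intro mult_mono) auto
      then show "(case q of (a, ws) \<Rightarrow> norm (a (snd c p) *\<^sub>R chart_partial d ws X p)) \<le> b q * B"
        by (auto split: prod.splits)
    qed
    finally show "norm (chart_partial c vs X p) \<le> sum_list (map b L) * B"
      by (simp add: sum_list_mult_const)
  qed
qed

lemma compact_chart_cover:
  obtains \<K> where "finite \<K>" "\<And>c K. (c, K) \<in> \<K> \<Longrightarrow> c \<in> A \<and> compactin M K \<and> K \<subseteq> fst c"
    "\<And>p. p \<in> topspace M \<Longrightarrow> \<exists>c K. (c, K) \<in> \<K> \<and> p \<in> K"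
proof -
  have nb: "neighbourhood_base_of (\<lambda>K. compactin M K \<and> closedin M K) M"
    using compact_M Hausdorff_M compact_imp_locally_compact_space
      locally_compact_Hausdorff_imp_regular_space locally_compact_regular_space_neighbourhood_base by blast
  have "\<exists>c U K. c \<in> A \<and> openin M U \<and> compactin M K \<and> p \<in> U \<and> U \<subseteq> K \<and> K \<subseteq> fst c" if "p \<in> topspace M" for p
  proof -
    obtain c where c: "c \<in> A" "p \<in> fst c" using charts_cover \<open>p \<in> topspace M\<close> by blast
    then show ?thesis
      using nb chart_open[OF c(1)] unfolding neighbourhood_base_of by meson
  qed
  then obtain c U K where cUK: "\<And>p. p \<in> topspace M \<Longrightarrow>
      c p \<in> A \<and> openin M (U p) \<and> compactin M (K p) \<and> p \<in> U p \<and> U p \<subseteq> K p \<and> K p \<subseteq> fst (c p)"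
    by metis
  have "\<forall>B \<in> U ` topspace M. openin M B" "topspace M \<subseteq> \<Union>(U ` topspace M)"
    using cUK by auto
  then obtain \<F> where \<F>: "finite \<F>" "\<F> \<subseteq> U ` topspace M" "topspace M \<subseteq> \<Union>\<F>"
    using compact_M unfolding compact_space_alt by meson
  obtain P where P0: "P \<subseteq> topspace M" "finite P" "\<F> = U ` P"
    using finite_subset_image[OF \<F>(1,2)] by blast
  with \<F> have P: "finite P" "P \<subseteq> topspace M" "topspace M \<subseteq> \<Union>(U ` P)" by auto
  show thesis
  proof (rule that[of "(\<lambda>p. (c p, K p)) ` P"])
    show "finite ((\<lambda>p. (c p, K p)) ` P)" using P by simp
  next
    fix d J assume "(d, J) \<in> (\<lambda>p. (c p, K p)) ` P"
    then show "d \<in> A \<and> compactin M J \<and> J \<subseteq> fst d" using cUK P by auto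
  next
    fix p assume "p \<in> topspace M"
    then obtain q where "q \<in> P" "p \<in> U q" using P by blast
    then show "\<exists>c' J. (c', J) \<in> (\<lambda>p. (c p, K p)) ` P \<and> p \<in> J" using cUK[of q] P by blast
  qed
qed

end

section \<open>The Banach space of maps of class \<open>C\<^sup>r\<close>\<close>

text \<open>
  Restricted to the surface, so that the result is again an \<^const>\<open>extensional\<close> representative.
\<close>

definition lin_comb :: "'a topology \<Rightarrow> real \<Rightarrow> ('a \<Rightarrow> real ^ 'n) \<Rightarrow> real \<Rightarrow> ('a \<Rightarrow> real ^ 'n) \<Rightarrow> 'a \<Rightarrow> real ^ 'n"
  where "lin_comb M a X b Y = (\<lambda>p\<in>topspace M. a *\<^sub>R X p + b *\<^sub>R Y p)"

context bordered_surface
begin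

lemma
  assumes X: "X \<in> Cr_maps M A r" and Y: "Y \<in> Cr_maps M A r"
  shows lin_comb_Cr: "lin_comb M a X b Y \<in> Cr_maps M A r"
    and chart_partial_lin_comb: "c \<in> A \<Longrightarrow> p \<in> fst c \<Longrightarrow> vs \<in> words \<Longrightarrow> length vs \<le> r \<Longrightarrow>
      chart_partial c vs (lin_comb M a X b Y) p = a *\<^sub>R chart_partial c vs X p + b *\<^sub>R chart_partial c vs Y p"
proof -
  have eq: "in_chart c (lin_comb M a X b Y) z = a *\<^sub>R in_chart c X z + b *\<^sub>R in_chart c Y z"
    if c: "c \<in> A" and z: "z \<in> chart_image c" for c z
  proof -
    obtain p where p: "p \<in> fst c" "z = snd c p" using z by (auto simp: chart_image_def)
    then show ?thesis using c chart_subset[OF c] by (auto simp: in_chart_at lin_comb_def)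
  qed
  have C: "Ck_on r (chart_image c) (in_chart c X)" "Ck_on r (chart_image c) (in_chart c Y)" if "c \<in> A" for c
    using X Y that by (auto simp: Cr_maps_def)
  show "lin_comb M a X b Y \<in> Cr_maps M A r"
    unfolding Cr_maps_def using Ck_on_linear[OF C chart_half_open eq]
    by (auto simp: lin_comb_def)
  show "chart_partial c vs (lin_comb M a X b Y) p = a *\<^sub>R chart_partial c vs X p + b *\<^sub>R chart_partial c vs Y p"
    if "c \<in> A" "p \<in> fst c" "vs \<in> words" "length vs \<le> r"
    unfolding chart_partial_def
    by (rule partials_linear[OF C chart_half_open eq]) (use that in \<open>auto intro: in_chart_image\<close>)
qed

lemma zero_Cr: "(\<lambda>p\<in>topspace M. 0) \<in> Cr_maps M A r"
proof -
  have "Ck_on r (chart_image c) (in_chart c (\<lambda>p\<in>topspace M. 0 :: real ^ 'n))" if c: "c \<in> A" for c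
  proof (rule Ck_on_family[OF chart_half_open[OF c], where G = "\<lambda>_ _. 0"])
    fix z assume "z \<in> chart_image c"
    then obtain p where "p \<in> fst c" "z = snd c p" by (auto simp: chart_image_def)
    then show "0 = in_chart c (\<lambda>p\<in>topspace M. 0) z" using c chart_subset[OF c] by (auto simp: in_chart_at)
  qed (auto simp: dlin_def[abs_def])
  then show ?thesis by (auto simp: Cr_maps_def)
qed

lemma compact_image_chart_partial:
  assumes X: "X \<in> Cr_maps M A r" and c: "c \<in> A" and vs: "vs \<in> words" "length vs \<le> r"
    and K: "compactin M K" "K \<subseteq> fst c"
  shows "compact (chart_partial c vs X ` K)"
proof -
  have "continuous_on (chart_image c) (partials (chart_image c) vs (in_chart c X))"
    using X c vs by (auto simp: Cr_maps_def intro: Ck_on_continuous)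
  moreover have "snd c ` K \<subseteq> chart_image c" using K by (auto simp: chart_image_def)
  ultimately have "compact (partials (chart_image c) vs (in_chart c X) ` (snd c ` K))"
    using chart_image_compact[OF c K] compact_continuous_image continuous_on_subset by blast
  then show ?thesis by (simp add: chart_partial_def[abs_def] image_image)
qed

end

lemma finite_words: "finite {vs \<in> words. length vs \<le> r}"
  using finite_lists_length_le[of "{1, \<i>}" r] by (simp add: lists_eq_set)

text \<open>
  The norm of \<open>C\<^sup>r(M)\<close> is built from one fixed finite cover \<open>\<K>\<close> of the surface by compact pieces of
  chart domains.
\<close>

locale covered_surface = bordered_surface M A for M :: "'a topology" and A +
  fixes \<K> :: "('a chart \<times> 'a set) set" and r :: nat
  assumes finite_cover: "finite \<K>"
    and cover_pieces: "(c, K) \<in> \<K> \<Longrightarrow> c \<in> A \<and> compactin M K \<and> K \<subseteq> fst c"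
    and cover_all: "p \<in> topspace M \<Longrightarrow> \<exists>c K. (c, K) \<in> \<K> \<and> p \<in> K"
begin

definition norm_index :: "('a chart \<times> complex list \<times> 'a) set"
  where "norm_index = {(c, vs, p). vs \<in> words \<and> length vs \<le> r \<and> (\<exists>K. (c, K) \<in> \<K> \<and> p \<in> K)}"

definition Cr_norm :: "('a \<Rightarrow> real ^ 'n) \<Rightarrow> real"
  where "Cr_norm X = (SUP (c, vs, p)\<in>norm_index. norm (chart_partial c vs X p))"

lemma norm_index_nonempty: "norm_index \<noteq> {}"
proof -
  obtain p where "p \<in> topspace M" using nonempty by blast
  then obtain c K where "(c, K) \<in> \<K>" "p \<in> K" using cover_all by blast
  then have "(c, [], p) \<in> norm_index" by (auto simp: norm_index_def)
  then show ?thesis by blast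
qed

lemma Cr_norm_bdd:
  assumes "X \<in> Cr_maps M A r"
  shows "bdd_above ((\<lambda>(c, vs, p). norm (chart_partial c vs X p)) ` norm_index)"
proof -
  let ?I = "\<K> \<times> {vs \<in> words. length vs \<le> r}"
  let ?F = "\<lambda>i. norm ` (chart_partial (fst (fst i)) (snd i) X ` snd (fst i))"
  have "(\<lambda>(c, vs, p). norm (chart_partial c vs X p)) ` norm_index \<subseteq> (\<Union>i\<in>?I. ?F i)"
  proof
    fix x assume "x \<in> (\<lambda>(c, vs, p). norm (chart_partial c vs X p)) ` norm_index"
    then obtain q where q: "q \<in> norm_index" "x = (case q of (c, vs, p) \<Rightarrow> norm (chart_partial c vs X p))" by blast
    obtain c vs p where q_eq: "q = (c, vs, p)" by (rule prod_cases3)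
    then obtain K where *: "x = norm (chart_partial c vs X p)" "(c, K) \<in> \<K>" "p \<in> K"
      "vs \<in> words" "length vs \<le> r"
      using q unfolding norm_index_def by auto
    show "x \<in> (\<Union>i\<in>?I. ?F i)"
      by (rule UN_I[of "((c, K), vs)"]) (use * in auto)
  qed
  moreover have "bdd_above (\<Union>i\<in>?I. ?F i)"
  proof (subst bdd_above_UN)
    show "finite ?I" using finite_cover finite_words by blast
    show "\<forall>i\<in>?I. bdd_above (?F i)"
    proof
      fix i assume i: "i \<in> ?I"
      then have "(fst (fst i), snd (fst i)) \<in> \<K>" "snd i \<in> words" "length (snd i) \<le> r"
        by (simp_all add: mem_Times_iff)
      then show "bdd_above (?F i)"
        using compact_image_chart_partial[OF assms, of "fst (fst i)" "snd i" "snd (fst i)"]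
          cover_pieces[of "fst (fst i)" "snd (fst i)"]
        by (intro bounded_imp_bdd_above compact_imp_bounded compact_continuous_image continuous_intros) auto
    qed
  qed
  ultimately show ?thesis by (rule bdd_above_mono[rotated])
qed

lemma Cr_norm_upper:
  assumes "X \<in> Cr_maps M A r" "(c, K) \<in> \<K>" "p \<in> K" "vs \<in> words" "length vs \<le> r"
  shows "norm (chart_partial c vs X p) \<le> Cr_norm X"
  unfolding Cr_norm_def
  using cSUP_upper[OF _ Cr_norm_bdd[OF assms(1)], of "(c, vs, p)"] assms by (auto simp: norm_index_def)

lemma Cr_norm_least:
  assumes "\<And>c K p vs. (c, K) \<in> \<K> \<Longrightarrow> p \<in> K \<Longrightarrow> vs \<in> words \<Longrightarrow> length vs \<le> r \<Longrightarrow>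
    norm (chart_partial c vs X p) \<le> B"
  shows "Cr_norm X \<le> B"
  unfolding Cr_norm_def
proof (rule cSUP_least[OF norm_index_nonempty])
  fix q assume q: "q \<in> norm_index"
  obtain c vs p where q_eq: "q = (c, vs, p)" by (rule prod_cases3)
  then obtain K where "(c, K) \<in> \<K>" "p \<in> K" "vs \<in> words" "length vs \<le> r"
    using q unfolding norm_index_def by auto
  then have "norm (chart_partial c vs X p) \<le> B" by (rule assms)
  then show "(case q of (c, vs, p) \<Rightarrow> norm (chart_partial c vs X p)) \<le> B" by (simp add: q_eq)
qed

lemma Cr_norm_nonneg: "X \<in> Cr_maps M A r \<Longrightarrow> 0 \<le> Cr_norm X"
proof -
  assume X: "X \<in> Cr_maps M A r"
  obtain p where "p \<in> topspace M" using nonempty by blast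
  then obtain c K where "(c, K) \<in> \<K>" "p \<in> K" using cover_all by blast
  then have "norm (chart_partial c [] X p) \<le> Cr_norm X" by (intro Cr_norm_upper[OF X]) auto
  then show ?thesis using norm_ge_zero order_trans by blast
qed

lemma Cr_norm_eq_0:
  assumes X: "X \<in> Cr_maps M A r" and "Cr_norm X = 0"
  shows "X = (\<lambda>p\<in>topspace M. 0)"
proof
  fix p
  show "X p = (\<lambda>p\<in>topspace M. 0) p"
  proof (cases "p \<in> topspace M")
    case True
    then obtain c K where cK: "(c, K) \<in> \<K>" "p \<in> K" using cover_all by blast
    then have "norm (chart_partial c [] X p) \<le> 0" using Cr_norm_upper[OF X cK, of "[]"] assms by simp
    then show ?thesis using True cK cover_pieces[OF cK(1)] by (auto simp: chart_partial_def in_chart_at)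
  next
    case False
    then show ?thesis using X by (auto simp: Cr_maps_def extensional_def)
  qed
qed

lemma Cr_norm_lin_comb:
  assumes X: "X \<in> Cr_maps M A r" and Y: "Y \<in> Cr_maps M A r"
  shows "Cr_norm (lin_comb M a X b Y) \<le> \<bar>a\<bar> * Cr_norm X + \<bar>b\<bar> * Cr_norm Y"
proof (rule Cr_norm_least)
  fix c K p vs assume *: "(c, K) \<in> \<K>" "p \<in> K" "vs \<in> words" "length vs \<le> r"
  then have "chart_partial c vs (lin_comb M a X b Y) p = a *\<^sub>R chart_partial c vs X p + b *\<^sub>R chart_partial c vs Y p"
    using cover_pieces[OF *(1)] X Y by (intro chart_partial_lin_comb) auto
  also have "norm \<dots> \<le> \<bar>a\<bar> * norm (chart_partial c vs X p) + \<bar>b\<bar> * norm (chart_partial c vs Y p)"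
    by (rule order_trans[OF norm_triangle_ineq]) simp
  also have "\<dots> \<le> \<bar>a\<bar> * Cr_norm X + \<bar>b\<bar> * Cr_norm Y"
    using Cr_norm_upper[OF X *] Cr_norm_upper[OF Y *] by (intro add_mono mult_left_mono) auto
  finally show "norm (chart_partial c vs (lin_comb M a X b Y) p) \<le> \<bar>a\<bar> * Cr_norm X + \<bar>b\<bar> * Cr_norm Y" .
qed

text \<open>
  The finitely many pieces in the norm control every other chart of the atlas: cut \<open>K\<close> along the cover
  and compare the two charts on each part.
\<close>

lemma chart_partial_bound:
  assumes c: "c \<in> A" and K: "compactin M K" "K \<subseteq> fst c"
  obtains C where "C > 0" "\<And>(X :: 'a \<Rightarrow> real ^ 'n) p vs. X \<in> Cr_maps M A r \<Longrightarrow> p \<in> K \<Longrightarrow>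
    vs \<in> words \<Longrightarrow> length vs \<le> r \<Longrightarrow> norm (chart_partial c vs X p) \<le> C * Cr_norm X"
proof -
  let ?I = "\<K> \<times> {vs \<in> words. length vs \<le> r}"
  have "\<exists>C\<ge>0. \<forall>(X :: 'a \<Rightarrow> real ^ 'n). X \<in> Cr_maps M A r \<longrightarrow> (\<forall>p \<in> K \<inter> snd (fst i).
      norm (chart_partial c (snd i) X p) \<le> C * Cr_norm X)" if i: "i \<in> ?I" for i
  proof -
    obtain d J vs where i_eq: "i = ((d, J), vs)" by (metis prod.collapse)
    then have dJ: "(d, J) \<in> \<K>" and vs: "vs \<in> words" "length vs \<le> r" using i by auto
    note J = cover_pieces[OF dJ]
    have "compactin M (K \<inter> J)"
      using K J Hausdorff_M compactin_imp_closedin closed_Int_compactin compactin_subset_topspace by metis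
    then obtain C where "C \<ge> 0" and C: "\<And>(X :: 'a \<Rightarrow> real ^ 'n) B p. X \<in> Cr_maps M A r \<Longrightarrow>
      (\<And>p ws. p \<in> K \<inter> J \<Longrightarrow> ws \<in> words \<Longrightarrow> length ws \<le> r \<Longrightarrow> norm (chart_partial d ws X p) \<le> B) \<Longrightarrow>
      p \<in> K \<inter> J \<Longrightarrow> norm (chart_partial c vs X p) \<le> C * B"
      using chart_partial_bound_change[OF c _ vs, of d "K \<inter> J"] J K(2) by (metis le_infI1 le_infI2)
    have "norm (chart_partial c vs X p) \<le> C * Cr_norm X" if "X \<in> Cr_maps M A r" "p \<in> K \<inter> J" for X :: "'a \<Rightarrow> real ^ 'n" and p
      using that Cr_norm_upper[OF that(1) dJ] by (intro C) auto
    with \<open>C \<ge> 0\<close> show ?thesis by (auto simp: i_eq)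
  qed
  then have "\<forall>i\<in>?I. \<exists>C. C \<ge> 0 \<and> (\<forall>(X :: 'a \<Rightarrow> real ^ 'n). X \<in> Cr_maps M A r \<longrightarrow> (\<forall>p \<in> K \<inter> snd (fst i).
      norm (chart_partial c (snd i) X p) \<le> C * Cr_norm X))"
    by blast
  from bchoice[OF this] obtain C where C0: "\<forall>i\<in>?I. C i \<ge> 0 \<and> (\<forall>(X :: 'a \<Rightarrow> real ^ 'n). X \<in> Cr_maps M A r \<longrightarrow>
      (\<forall>p \<in> K \<inter> snd (fst i). norm (chart_partial c (snd i) X p) \<le> C i * Cr_norm X))"
    by (elim exE)
  have C: "C i \<ge> 0" "X \<in> Cr_maps M A r \<Longrightarrow> p \<in> K \<inter> snd (fst i) \<Longrightarrow>
      norm (chart_partial c (snd i) X p) \<le> C i * Cr_norm X" if "i \<in> ?I" for i and X :: "'a \<Rightarrow> real ^ 'n" and p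
    using bspec[OF C0 that] by blast+
  have fin: "finite ?I" using finite_cover finite_words by blast
  show thesis
  proof (rule that)
    show "sum C ?I + 1 > 0" using sum_nonneg[of ?I C] C(1) by force
    fix X :: "'a \<Rightarrow> real ^ 'n" and p vs
    assume *: "X \<in> Cr_maps M A r" "p \<in> K" "vs \<in> words" "length vs \<le> r"
    obtain d J where dJ: "(d, J) \<in> \<K>" "p \<in> J" using cover_all * K chart_subset[OF c] by blast
    then have i: "((d, J), vs) \<in> ?I" using * by auto
    have "norm (chart_partial c vs X p) \<le> C ((d, J), vs) * Cr_norm X" using C(2)[OF i *(1), of p] * dJ by auto
    also have "\<dots> \<le> (sum C ?I + 1) * Cr_norm X"
      using member_le_sum[OF i, of C] C(1) fin Cr_norm_nonneg[OF *(1)] by (intro mult_right_mono) force+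
    finally show "norm (chart_partial c vs X p) \<le> (sum C ?I + 1) * Cr_norm X" .
  qed
qed

definition Cr_module :: "('a \<Rightarrow> real ^ 'n) normed_module"
  where "Cr_module = \<lparr>carrier = Cr_maps M A r, monoid.mult = (\<lambda>X Y. X), one = (\<lambda>p\<in>topspace M. 0),
    zero = (\<lambda>p\<in>topspace M. 0), add = (\<lambda>X Y. lin_comb M 1 X 1 Y), module.smult = (\<lambda>a X. lin_comb M a X 0 X),
    nrm = Cr_norm\<rparr>"

lemma Cr_module_simps [simp]:
  "carrier Cr_module = Cr_maps M A r" "\<zero>\<^bsub>Cr_module\<^esub> = (\<lambda>p\<in>topspace M. 0)"
  "X \<oplus>\<^bsub>Cr_module\<^esub> Y = lin_comb M 1 X 1 Y" "a \<odot>\<^bsub>Cr_module\<^esub> X = lin_comb M a X 0 X"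
  "nrm Cr_module = Cr_norm"
  by (simp_all add: Cr_module_def)

lemma Cr_extensional: "X \<in> Cr_maps M A r \<Longrightarrow> p \<notin> topspace M \<Longrightarrow> X p = undefined"
  by (auto simp: Cr_maps_def extensional_def)

lemma Cr_is_module: "Module.module real_field (Cr_module :: ('a \<Rightarrow> real ^ 'n) normed_module)"
proof (rule moduleI)
  show "abelian_group (Cr_module :: ('a \<Rightarrow> real ^ 'n) normed_module)"
  proof (rule abelian_groupI)
    fix X :: "'a \<Rightarrow> real ^ 'n" assume X: "X \<in> carrier Cr_module"
    show "\<exists>Y\<in>carrier Cr_module. Y \<oplus>\<^bsub>Cr_module\<^esub> X = \<zero>\<^bsub>Cr_module\<^esub>"
      using lin_comb_Cr[of X r X "-1" 0] X by (intro bexI[of _ "lin_comb M (-1) X 0 X"]) (auto simp: lin_comb_def fun_eq_iff)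
  qed (simp_all add: lin_comb_Cr zero_Cr, auto simp: lin_comb_def fun_eq_iff Cr_extensional)
qed (simp_all add: cring_real_field lin_comb_Cr,
    auto simp: lin_comb_def fun_eq_iff Cr_extensional real_field_def algebra_simps)

lemma Cr_module_minus:
  assumes "X \<in> Cr_maps M A r" "Y \<in> Cr_maps M A r"
  shows "X \<ominus>\<^bsub>Cr_module\<^esub> Y = lin_comb M 1 X (-1) (Y :: 'a \<Rightarrow> real ^ 'n)"
proof -
  interpret Module.module real_field "Cr_module :: ('a \<Rightarrow> real ^ 'n) normed_module" by (rule Cr_is_module)
  have "lin_comb M (-1) Y 0 Y \<oplus>\<^bsub>Cr_module\<^esub> Y = \<zero>\<^bsub>Cr_module\<^esub>" by (auto simp: lin_comb_def fun_eq_iff)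
  then have "\<ominus>\<^bsub>Cr_module\<^esub> Y = lin_comb M (-1) Y 0 Y"
    using M.minus_equality[of "lin_comb M (-1) Y 0 Y" Y] assms lin_comb_Cr[OF assms(2,2)] by simp
  then show ?thesis by (auto simp: a_minus_def lin_comb_def fun_eq_iff)
qed

lemma Cr_normed: "normed_real_module (Cr_module :: ('a \<Rightarrow> real ^ 'n) normed_module)"
proof (intro normed_real_module.intro normed_real_module_axioms.intro Cr_is_module)
  fix X Y :: "'a \<Rightarrow> real ^ 'n" and a
  assume "X \<in> carrier Cr_module"
  then have X: "X \<in> Cr_maps M A r" by simp
  show "0 \<le> nrm Cr_module X" using X Cr_norm_nonneg by simp
  have zero: "Cr_norm (lin_comb M 0 X 0 X) = 0"
    using Cr_norm_lin_comb[OF X X, of 0 0] Cr_norm_nonneg[OF lin_comb_Cr[OF X X, of 0 0]] by simp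
  have "lin_comb M 0 X 0 X = (\<lambda>p\<in>topspace M. 0)" by (auto simp: lin_comb_def)
  then show "nrm Cr_module X = 0 \<longleftrightarrow> X = \<zero>\<^bsub>Cr_module\<^esub>"
    using Cr_norm_eq_0[OF X] zero by auto
  have le: "Cr_norm (lin_comb M b Z 0 Z) \<le> \<bar>b\<bar> * Cr_norm Z" if "Z \<in> Cr_maps M A r" for b and Z :: "'a \<Rightarrow> real ^ 'n"
    using Cr_norm_lin_comb[OF that that, of b 0] by simp
  show "nrm Cr_module (a \<odot>\<^bsub>Cr_module\<^esub> X) = \<bar>a\<bar> * nrm Cr_module X"
  proof (cases "a = 0")
    case True then show ?thesis using zero by simp
  next
    case False
    let ?Y = "lin_comb M a X 0 X"
    have "X = lin_comb M (inverse a) ?Y 0 ?Y"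
      using False Cr_extensional[OF X] by (auto simp: lin_comb_def fun_eq_iff)
    then have "Cr_norm X \<le> \<bar>inverse a\<bar> * Cr_norm ?Y" using le[OF lin_comb_Cr[OF X X]] by metis
    then have "\<bar>a\<bar> * Cr_norm X \<le> Cr_norm ?Y" using False by (simp add: field_simps)
    then show ?thesis using le[OF X, of a] by simp
  qed
  assume "Y \<in> carrier Cr_module"
  then show "nrm Cr_module (X \<oplus>\<^bsub>Cr_module\<^esub> Y) \<le> nrm Cr_module X + nrm Cr_module Y"
    using Cr_norm_lin_comb[OF X, of Y 1 1] by simp
qed

end

lemma norm_dlin_diff_le:
  "norm (dlin a b h - dlin a' b' h) \<le> (norm (a - a') + norm (b - b')) * norm (h :: complex)"
proof -
  have "dlin a b h - dlin a' b' h = Re h *\<^sub>R (a - a') + Im h *\<^sub>R (b - b')"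
    by (simp add: dlin_def algebra_simps)
  also have "norm \<dots> \<le> \<bar>Re h\<bar> * norm (a - a') + \<bar>Im h\<bar> * norm (b - b')"
    by (rule order_trans[OF norm_triangle_ineq]) simp
  also have "\<dots> \<le> norm h * norm (a - a') + norm h * norm (b - b')"
    by (intro add_mono mult_right_mono abs_Re_le_cmod abs_Im_le_cmod) auto
  finally show ?thesis by (simp add: algebra_simps)
qed

text \<open>
  The theorem on differentiating a limit of functions asks for a convex domain. Half-discs provide one
  around each point without changing the notion of derivative there.
\<close>

lemma half_disc:
  assumes "half_open S" "z \<in> S"
  obtains D where "z \<in> D" "D \<subseteq> S" "compact D" "convex D" "at z within D = at z within S"
proof -
  obtain e where e: "e > 0" "ball z e \<inter> upper_half_plane \<subseteq> S" using half_open_ball[OF assms] .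
  define D where "D = cball z (e / 2) \<inter> upper_half_plane"
  have sub: "S \<subseteq> upper_half_plane" using assms(1) openin_imp_subset by blast
  have UHP: "closed upper_half_plane" "convex upper_half_plane"
    by (auto simp: upper_half_plane_def closed_halfspace_Im_ge convex_halfspace_Im_ge)
  have "D \<subseteq> S" using e by (auto simp: D_def subset_eq)
  moreover have "at z within D = at z within S"
    by (rule at_within_nhd[of _ "ball z (e / 2)"]) (use e sub in \<open>auto simp: D_def subset_eq\<close>)
  ultimately show thesis
    using that[of D] UHP e assms sub by (auto simp: D_def compact_Int_closed convex_Int)
qed

text \<open>
  The limits \<open>H vs\<close> are successive derivatives of one another, because differentiation commutes with locally
  uniform limits of derivatives.
\<close>

lemma
  fixes g :: "nat \<Rightarrow> complex \<Rightarrow> 'b::banach"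
  assumes S: "half_open S" and g: "\<And>n. Ck_on r S (g n)"
    and lim: "\<And>D e. compact D \<Longrightarrow> D \<subseteq> S \<Longrightarrow> e > 0 \<Longrightarrow> \<exists>N. \<forall>n\<ge>N. \<forall>z\<in>D. \<forall>vs\<in>words.
      length vs \<le> r \<longrightarrow> norm (partials S vs (g n) z - H vs z) \<le> e"
  shows partials_uniform_limit: "vs \<in> words \<Longrightarrow> length vs \<le> r \<Longrightarrow> z \<in> S \<Longrightarrow>
      partials S vs (H []) z = H vs z"
    and Ck_on_uniform_limit: "Ck_on r S (H [])"
proof -
  have unif: "uniform_limit D (\<lambda>n. partials S vs (g n)) (H vs) sequentially"
    if D: "compact D" "D \<subseteq> S" and vs: "vs \<in> words" "length vs \<le> r" for D vs
  proof (rule uniform_limitI)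
    fix e :: real assume "e > 0"
    then obtain N where "\<forall>n\<ge>N. \<forall>z\<in>D. \<forall>vs\<in>words. length vs \<le> r \<longrightarrow> norm (partials S vs (g n) z - H vs z) \<le> e / 2"
      using lim[OF D, of "e / 2"] by auto
    then have "\<forall>n\<ge>N. \<forall>z\<in>D. norm (partials S vs (g n) z - H vs z) \<le> e / 2" using vs by blast
    then show "\<forall>\<^sub>F n in sequentially. \<forall>x\<in>D. dist (partials S vs (g n) x) (H vs x) < e"
      using \<open>e > 0\<close> unfolding eventually_sequentially dist_norm by fastforce
  qed
  have pointwise: "(\<lambda>n. partials S vs (g n) z) \<longlonglongrightarrow> H vs z"
    if "vs \<in> words" "length vs \<le> r" "z \<in> S" for vs z
    by (rule tendsto_uniform_limitI[OF unif[of "{z}"]]) (use that in auto)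
  have der: "(H vs has_derivative dlin (H (1 # vs) z) (H (\<i> # vs) z)) (at z within S)"
    if vs: "vs \<in> words" "length vs < r" and z: "z \<in> S" for vs z
  proof -
    obtain D where D: "z \<in> D" "D \<subseteq> S" "compact D" "convex D" "at z within D = at z within S"
      using half_disc[OF S z] .
    have "\<exists>h. \<forall>x\<in>D. (\<lambda>n. partials S vs (g n) x) \<longlonglongrightarrow> h x \<and> (h has_derivative dlin (H (1 # vs) x) (H (\<i> # vs) x)) (at x within D)"
    proof (rule has_derivative_sequence[OF D(4) _ _ D(1)])
      show "(partials S vs (g n) has_derivative dlin (partials S (1 # vs) (g n) x) (partials S (\<i> # vs) (g n) x)) (at x within D)"
        if "x \<in> D" for n x
        using that D(2) by (intro has_derivative_subset[OF Ck_on_has_derivative[OF g vs] D(2)]) auto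
      show "(\<lambda>n. partials S vs (g n) z) \<longlonglongrightarrow> H vs z" using pointwise vs z by simp
      fix e :: real assume "e > 0"
      then obtain N where N: "\<forall>n\<ge>N. \<forall>z\<in>D. \<forall>vs\<in>words. length vs \<le> r \<longrightarrow> norm (partials S vs (g n) z - H vs z) \<le> e / 2"
        using lim[OF D(3,2), of "e / 2"] by auto
      have "norm (dlin (partials S (1 # vs) (g n) x) (partials S (\<i> # vs) (g n) x) h - dlin (H (1 # vs) x) (H (\<i> # vs) x) h) \<le> e * norm h"
        if "n \<ge> N" "x \<in> D" for n x h
      proof -
        have "norm (partials S (v # vs) (g n) x - H (v # vs) x) \<le> e / 2" if "v \<in> {1, \<i>}" for v
        proof -
          have "v # vs \<in> words" "length (v # vs) \<le> r" using vs that by auto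
          then show ?thesis using N \<open>n \<ge> N\<close> \<open>x \<in> D\<close> by blast
        qed
        from this[of 1] this[of \<i>] have "(norm (partials S (1 # vs) (g n) x - H (1 # vs) x)
            + norm (partials S (\<i> # vs) (g n) x - H (\<i> # vs) x)) * norm h \<le> e * norm h"
          by (intro mult_right_mono) auto
        then show ?thesis using norm_dlin_diff_le order_trans by blast
      qed
      then show "\<forall>\<^sub>F n in sequentially. \<forall>x\<in>D. \<forall>h. norm (dlin (partials S (1 # vs) (g n) x) (partials S (\<i> # vs) (g n) x) h
          - dlin (H (1 # vs) x) (H (\<i> # vs) x) h) \<le> e * norm h"
        by (auto simp: eventually_sequentially)
    qed
    then obtain h where h: "\<And>x. x \<in> D \<Longrightarrow> (\<lambda>n. partials S vs (g n) x) \<longlonglongrightarrow> h x"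
      "(h has_derivative dlin (H (1 # vs) z) (H (\<i> # vs) z)) (at z within D)" using D(1) by blast
    have "H vs x = h x" if x: "x \<in> D" for x
      using LIMSEQ_unique[OF pointwise[of vs x] h(1)[OF x]] vs x D(2) by auto
    then show ?thesis using has_derivative_transform[OF D(1) _ h(2)] D(5) by simp
  qed
  have cont: "continuous_on S (H vs)" if vs: "vs \<in> words" "length vs = r" for vs
    unfolding continuous_on_eq_continuous_within
  proof
    fix z assume z: "z \<in> S"
    obtain D where D: "z \<in> D" "D \<subseteq> S" "compact D" "at z within D = at z within S"
      using half_disc[OF S z] by metis
    have "\<forall>\<^sub>F n in sequentially. continuous_on D (partials S vs (g n))"
      using continuous_on_subset[OF Ck_on_continuous[OF g] D(2)] vs by auto
    then have "continuous_on D (H vs)"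
      using unif[OF D(3,2) vs(1)] vs(2) by (intro uniform_limit_theorem[where F = sequentially]) auto
    then have "(H vs \<longlongrightarrow> H vs z) (at z within D)" using D(1) by (simp add: continuous_on_def)
    then show "continuous (at z within S) (H vs)" unfolding continuous_within D(4) .
  qed
  show "partials S vs (H []) z = H vs z" if "vs \<in> words" "length vs \<le> r" "z \<in> S"
    using S refl der cont that by (rule partials_family)
  show "Ck_on r S (H [])"
    using S refl der cont by (rule Ck_on_family)
qed

context covered_surface
begin

lemma norm_dist_Cr:
  fixes X Y :: "'a \<Rightarrow> real ^ 'n"
  assumes "X \<in> Cr_maps M A r" "Y \<in> Cr_maps M A r"
  shows "norm_dist Cr_module X Y = Cr_norm (lin_comb M 1 X (-1) Y)"
  using assms by (simp add: norm_dist_def Cr_module_minus)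

lemma chart_partial_diff_bound:
  assumes c: "c \<in> A" and K: "compactin M K" "K \<subseteq> fst c"
  obtains C where "C > 0" "\<And>(X :: 'a \<Rightarrow> real ^ 'n) Y p vs. X \<in> Cr_maps M A r \<Longrightarrow> Y \<in> Cr_maps M A r \<Longrightarrow> p \<in> K \<Longrightarrow>
    vs \<in> words \<Longrightarrow> length vs \<le> r \<Longrightarrow>
    norm (chart_partial c vs X p - chart_partial c vs Y p) \<le> C * norm_dist Cr_module X Y"
proof -
  obtain C where "C > 0" and C: "\<And>(X :: 'a \<Rightarrow> real ^ 'n) p vs. X \<in> Cr_maps M A r \<Longrightarrow> p \<in> K \<Longrightarrow>
    vs \<in> words \<Longrightarrow> length vs \<le> r \<Longrightarrow> norm (chart_partial c vs X p) \<le> C * Cr_norm X"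
    using chart_partial_bound[OF assms, where ?'n = 'n] by metis
  show thesis
  proof (rule that[OF \<open>C > 0\<close>])
    fix X Y :: "'a \<Rightarrow> real ^ 'n" and p vs
    assume *: "X \<in> Cr_maps M A r" "Y \<in> Cr_maps M A r" "p \<in> K" "vs \<in> words" "length vs \<le> r"
    have "p \<in> fst c" using * K by blast
    then have "chart_partial c vs X p - chart_partial c vs Y p = chart_partial c vs (lin_comb M 1 X (-1) Y) p"
      using chart_partial_lin_comb[OF *(1,2) c _ *(4,5), of p 1 "-1"] by simp
    then show "norm (chart_partial c vs X p - chart_partial c vs Y p) \<le> C * norm_dist Cr_module X Y"
      using C[OF lin_comb_Cr[OF *(1,2)] *(3,4,5)] by (simp only: norm_dist_Cr[OF *(1,2)])
  qed
qed

text \<open>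
  In every chart and on every compact set the partial derivatives of a Cauchy sequence converge
  uniformly, by the comparison of charts. So the pointwise limit is of class \<open>C\<^sup>r\<close> in all charts
  of the atlas, not only in those that occur in the norm.
\<close>

lemma Cr_complete: "Metric_space.mcomplete (Cr_maps M A r)
  (norm_dist (Cr_module :: ('a \<Rightarrow> real ^ 'n) normed_module))"
proof -
  let ?N = "Cr_module :: ('a \<Rightarrow> real ^ 'n) normed_module"
  interpret N: normed_real_module ?N by (rule Cr_normed)
  have "\<exists>X. limitin N.metric.mtopology \<sigma> X sequentially" if Cauchy: "N.metric.MCauchy \<sigma>" for \<sigma>
  proof -
    have \<sigma>: "\<sigma> n \<in> Cr_maps M A r" for n
      using Cauchy unfolding N.metric.MCauchy_def by auto
    have \<sigma>C: "\<exists>N. \<forall>n n'. N \<le> n \<longrightarrow> N \<le> n' \<longrightarrow> norm_dist ?N (\<sigma> n) (\<sigma> n') < e" if "e > 0" for e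
      using Cauchy that unfolding N.metric.MCauchy_def by auto
    have unifC: "\<exists>N. \<forall>m\<ge>N. \<forall>n\<ge>N. \<forall>p\<in>K. \<forall>vs\<in>words. length vs \<le> r \<longrightarrow>
        norm (chart_partial c vs (\<sigma> m) p - chart_partial c vs (\<sigma> n) p) \<le> e"
      if cK: "c \<in> A" "compactin M K" "K \<subseteq> fst c" and "e > 0" for c K e
    proof -
      obtain C where "C > 0" and C: "\<And>(X :: 'a \<Rightarrow> real ^ 'n) Y p vs. X \<in> Cr_maps M A r \<Longrightarrow> Y \<in> Cr_maps M A r \<Longrightarrow> p \<in> K \<Longrightarrow>
        vs \<in> words \<Longrightarrow> length vs \<le> r \<Longrightarrow>
        norm (chart_partial c vs X p - chart_partial c vs Y p) \<le> C * norm_dist Cr_module X Y"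
        using chart_partial_diff_bound[OF cK, where ?'n = 'n] by metis
      obtain N where N: "\<forall>n n'. N \<le> n \<longrightarrow> N \<le> n' \<longrightarrow> norm_dist ?N (\<sigma> n) (\<sigma> n') < e / C"
        using \<sigma>C[of "e / C"] \<open>e > 0\<close> \<open>C > 0\<close> by auto
      show ?thesis
      proof (intro exI[of _ N] allI impI ballI)
        fix m n p vs assume *: "N \<le> m" "N \<le> n" "p \<in> K" "vs \<in> words" "length vs \<le> r"
        have "norm_dist ?N (\<sigma> m) (\<sigma> n) < e / C" using N * by blast
        then have "C * norm_dist ?N (\<sigma> m) (\<sigma> n) \<le> e" using \<open>C > 0\<close> by (simp add: field_simps)
        then show "norm (chart_partial c vs (\<sigma> m) p - chart_partial c vs (\<sigma> n) p) \<le> e"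
          using C[OF \<sigma> \<sigma> *(3-5)] order_trans by blast
      qed
    qed
    \<comment> \<open>The pointwise limits of the partial derivatives, the family that will turn out to consist of the
      partial derivatives of the limit.\<close>
    define G where "G = (\<lambda>c vs p. lim (\<lambda>n. chart_partial c vs (\<sigma> n) p))"
    have G: "(\<lambda>n. chart_partial c vs (\<sigma> n) p) \<longlonglongrightarrow> G c vs p"
      if *: "c \<in> A" "p \<in> fst c" "vs \<in> words" "length vs \<le> r" for c vs p
    proof -
      have K: "compactin M {p}" "{p} \<subseteq> fst c" using * chart_subset[OF *(1)] by auto
      have "Cauchy (\<lambda>n. chart_partial c vs (\<sigma> n) p)"
      proof (rule metric_CauchyI)
        fix e :: real assume "e > 0"
        then obtain N where N: "\<forall>m\<ge>N. \<forall>n\<ge>N. \<forall>p\<in>{p}. \<forall>vs\<in>words. length vs \<le> r \<longrightarrow>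
          norm (chart_partial c vs (\<sigma> m) p - chart_partial c vs (\<sigma> n) p) \<le> e / 2"
          using unifC[OF *(1) K, of "e / 2"] by auto
        then have "dist (chart_partial c vs (\<sigma> m) p) (chart_partial c vs (\<sigma> n) p) \<le> e / 2" if "m \<ge> N" "n \<ge> N" for m n
          using that *(3,4) unfolding dist_norm by blast
        then show "\<exists>N. \<forall>m\<ge>N. \<forall>n\<ge>N. dist (chart_partial c vs (\<sigma> m) p) (chart_partial c vs (\<sigma> n) p) < e"
          using \<open>e > 0\<close> by (metis field_sum_of_halves less_add_same_cancel1 half_gt_zero order_le_less_trans)
      qed
      then show ?thesis unfolding G_def using Cauchy_convergent convergent_LIMSEQ_iff by blast
    qed
    have unif: "\<exists>N. \<forall>n\<ge>N. \<forall>p\<in>K. \<forall>vs\<in>words. length vs \<le> r \<longrightarrow>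
        norm (chart_partial c vs (\<sigma> n) p - G c vs p) \<le> e"
      if *: "c \<in> A" "compactin M K" "K \<subseteq> fst c" "e > 0" for c K e
    proof -
      obtain N where N: "\<forall>m\<ge>N. \<forall>n\<ge>N. \<forall>p\<in>K. \<forall>vs\<in>words. length vs \<le> r \<longrightarrow>
          norm (chart_partial c vs (\<sigma> m) p - chart_partial c vs (\<sigma> n) p) \<le> e"
        using unifC[OF *] by blast
      show ?thesis
      proof (intro exI[of _ N] allI impI ballI)
        fix n p vs assume n: "N \<le> n" and p: "p \<in> K" and vs: "vs \<in> words" "length vs \<le> r"
        have "(\<lambda>m. norm (chart_partial c vs (\<sigma> n) p - chart_partial c vs (\<sigma> m) p)) \<longlonglongrightarrow>
            norm (chart_partial c vs (\<sigma> n) p - G c vs p)"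
          using p *(3) by (intro tendsto_norm[OF tendsto_diff[OF tendsto_const G[OF *(1) _ vs]]]) blast
        moreover have "\<forall>m\<ge>N. norm (chart_partial c vs (\<sigma> n) p - chart_partial c vs (\<sigma> m) p) \<le> e"
          using N n p vs by blast
        ultimately show "norm (chart_partial c vs (\<sigma> n) p - G c vs p) \<le> e"
          by (intro LIMSEQ_le_const2) blast+
      qed
    qed
    define X where "X = (\<lambda>p\<in>topspace M. lim (\<lambda>n. \<sigma> n p))"
    have X: "Ck_on r (chart_image c) (in_chart c X) \<and> (\<forall>vs\<in>words. length vs \<le> r \<longrightarrow>
        (\<forall>p\<in>fst c. chart_partial c vs X p = G c vs p))" if c: "c \<in> A" for c
    proof -
      let ?S = "chart_image c" and ?i = "inv_into (fst c) (snd c)"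
      note S = chart_half_open[OF c]
      define H where "H = (\<lambda>vs z. G c vs (?i z))"
      define P where "P = (\<lambda>n vs. partials ?S vs (in_chart c (\<sigma> n)))"
      have i: "?i z \<in> fst c" "snd c (?i z) = z" if "z \<in> ?S" for z
        using that by (auto simp: chart_image_def inv_into_into f_inv_into_f)
      have P: "chart_partial c vs (\<sigma> n) (?i z) = P n vs z" if "z \<in> ?S" for n vs z
        using i[OF that] by (simp add: chart_partial_def P_def)
      have CkP: "Ck_on r ?S (in_chart c (\<sigma> n))" for n using \<sigma>[of n] c by (auto simp: Cr_maps_def)
      have unifP: "\<exists>N. \<forall>n\<ge>N. \<forall>z\<in>D. \<forall>vs\<in>words. length vs \<le> r \<longrightarrow> norm (P n vs z - H vs z) \<le> e"
        if D: "compact D" "D \<subseteq> ?S" "e > 0" for D e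
      proof -
        have "?i ` D \<subseteq> fst c" using i(1) D(2) by blast
        then obtain N where N: "\<forall>n\<ge>N. \<forall>p\<in>?i ` D. \<forall>vs\<in>words. length vs \<le> r \<longrightarrow>
            norm (chart_partial c vs (\<sigma> n) p - G c vs p) \<le> e"
          using unif[OF c chart_preimage_compact[OF c D(1,2)] _ D(3)] by blast
        show ?thesis
        proof (intro exI[of _ N] allI impI ballI)
          fix n z vs assume *: "N \<le> n" "z \<in> D" "vs \<in> words" "length vs \<le> r"
          have "?i z \<in> ?i ` D" using *(2) by (rule imageI)
          then have "norm (chart_partial c vs (\<sigma> n) (?i z) - G c vs (?i z)) \<le> e" using N * by blast
          moreover have "z \<in> ?S" using D(2) *(2) by blast
          ultimately show "norm (P n vs z - H vs z) \<le> e" by (simp only: P H_def)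
        qed
      qed
      have H0: "H [] z = in_chart c X z" if z: "z \<in> ?S" for z
        using i[OF z] c chart_subset[OF c]
        by (auto simp: H_def G_def X_def chart_partial_def in_chart_def)
      have CkH: "Ck_on r ?S (H [])"
        by (rule Ck_on_uniform_limit[OF S CkP unifP[unfolded P_def]])
      have "Ck_on r ?S (in_chart c X)"
        by (rule Ck_on_restrict[OF CkH S order_refl H0[symmetric]])
      moreover have "chart_partial c vs X p = G c vs p"
        if vs: "vs \<in> words" "length vs \<le> r" and p: "p \<in> fst c" for vs p
      proof -
        have "partials ?S vs (in_chart c X) (snd c p) = partials ?S vs (H []) (snd c p)"
          by (rule partials_restrict[OF CkH S order_refl H0[symmetric] vs in_chart_image[OF p]])
        also have "\<dots> = H vs (snd c p)"
          by (rule partials_uniform_limit[OF S CkP unifP[unfolded P_def] vs in_chart_image[OF p]])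
        finally show ?thesis using chart_inverse[OF c p] by (simp add: chart_partial_def H_def)
      qed
      ultimately show ?thesis by blast
    qed
    have XC: "X \<in> Cr_maps M A r" using X by (auto simp: Cr_maps_def X_def)
    have "\<exists>N. \<forall>n\<ge>N. norm_dist ?N (\<sigma> n) X < e" if "e > 0" for e
    proof -
      have "\<exists>N. \<forall>n\<ge>N. \<forall>p\<in>snd i. \<forall>vs\<in>words. length vs \<le> r \<longrightarrow>
          norm (chart_partial (fst i) vs (\<sigma> n) p - G (fst i) vs p) \<le> e / 2" if "i \<in> \<K>" for i
        using cover_pieces[of "fst i" "snd i"] that \<open>e > 0\<close> by (intro unif) auto
      then obtain N where N: "\<And>i. i \<in> \<K> \<Longrightarrow> \<forall>n\<ge>N i. \<forall>p\<in>snd i. \<forall>vs\<in>words. length vs \<le> r \<longrightarrow>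
          norm (chart_partial (fst i) vs (\<sigma> n) p - G (fst i) vs p) \<le> e / 2"
        by metis
      have "norm_dist ?N (\<sigma> n) X < e" if n: "n \<ge> Max (N ` \<K>)" for n
      proof -
        have "Cr_norm (lin_comb M 1 (\<sigma> n) (-1) X) \<le> e / 2"
        proof (rule Cr_norm_least)
          fix c K p vs assume *: "(c, K) \<in> \<K>" "p \<in> K" "vs \<in> words" "length vs \<le> r"
          have c: "c \<in> A" "p \<in> fst c" using cover_pieces[OF *(1)] *(2) by auto
          have "N (c, K) \<le> n" by (rule order_trans[OF Max_ge n]) (use *(1) finite_cover in auto)
          then have "norm (chart_partial c vs (\<sigma> n) p - G c vs p) \<le> e / 2"
            using N[OF *(1)] * by auto
          moreover have "chart_partial c vs X p = G c vs p" using X[OF c(1)] c * by blast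
          ultimately show "norm (chart_partial c vs (lin_comb M 1 (\<sigma> n) (-1) X) p) \<le> e / 2"
            using chart_partial_lin_comb[OF \<sigma>[of n] XC c *(3,4), of 1 "-1"] by simp
        qed
        then show ?thesis using \<open>e > 0\<close> by (simp only: norm_dist_Cr[OF \<sigma> XC])
      qed
      then show ?thesis by blast
    qed
    then have "limitin N.metric.mtopology \<sigma> X sequentially"
      unfolding N.metric.limit_metric_sequentially using XC \<sigma> by simp
    then show ?thesis by (rule exI[where x = X])
  qed
  then show ?thesis unfolding Cr_module_simps(1)[symmetric] N.metric.mcomplete_def by blast
qed

lemma Cr_Banach: "real_Banach_space (Cr_module :: ('a \<Rightarrow> real ^ 'n) normed_module)"
proof -
  interpret N: normed_real_module "Cr_module :: ('a \<Rightarrow> real ^ 'n) normed_module" by (rule Cr_normed)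
  show ?thesis
    unfolding real_Banach_space_def
    using Cr_is_module N.nrm_nonneg N.nrm_eq_0 N.nrm_smult N.nrm_triangle Cr_complete by simp
qed

lemma Cr_nbhd_open:
  fixes X :: "'a \<Rightarrow> real ^ 'n"
  assumes X: "X \<in> Cr_maps M A r" and c: "c \<in> A" and K: "compactin M K" "K \<subseteq> fst c"
  shows "openin (norm_topology Cr_module) (Cr_nbhd M A r X c K \<epsilon>)"
proof -
  let ?N = "Cr_module :: ('a \<Rightarrow> real ^ 'n) normed_module"
  let ?W = "{vs \<in> words. length vs \<le> r}"
  interpret N: normed_real_module ?N by (rule Cr_normed)
  obtain C where "C > 0" and C: "\<And>(X :: 'a \<Rightarrow> real ^ 'n) Y p vs. X \<in> Cr_maps M A r \<Longrightarrow> Y \<in> Cr_maps M A r \<Longrightarrow> p \<in> K \<Longrightarrow>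
    vs \<in> words \<Longrightarrow> length vs \<le> r \<Longrightarrow>
    norm (chart_partial c vs X p - chart_partial c vs Y p) \<le> C * norm_dist Cr_module X Y"
    using chart_partial_diff_bound[OF c K, where ?'n = 'n] by metis
  have "\<exists>\<rho>>0. N.metric.mball Y \<rho> \<subseteq> Cr_nbhd M A r X c K \<epsilon>" if "Y \<in> Cr_nbhd M A r X c K \<epsilon>" for Y
  proof -
    have Y: "Y \<in> Cr_maps M A r" and less: "\<And>p vs. p \<in> K \<Longrightarrow> vs \<in> words \<Longrightarrow> length vs \<le> r \<Longrightarrow>
        norm (chart_partial c vs Y p - chart_partial c vs X p) < \<epsilon>"
      using that by (auto simp: Cr_nbhd_def chart_partial_def)
    let ?D = "lin_comb M 1 Y (-1) X"
    have D: "chart_partial c vs ?D p = chart_partial c vs Y p - chart_partial c vs X p"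
      if "p \<in> K" "vs \<in> words" "length vs \<le> r" for vs p
      using chart_partial_lin_comb[OF Y X c _ that(2,3), of p 1 "-1"] that(1) K(2) by auto
    \<comment> \<open>By compactness the strict inequalities that define the neighbourhood leave a margin.\<close>
    have "\<exists>m<\<epsilon>. \<forall>p\<in>K. norm (chart_partial c vs Y p - chart_partial c vs X p) \<le> m" if vs: "vs \<in> ?W" for vs
    proof (cases "K = {}")
      case True
      then show ?thesis using lt_ex[of \<epsilon>] by auto
    next
      case False
      have vs': "vs \<in> words" "length vs \<le> r" using vs by blast+
      have "compact (norm ` (chart_partial c vs ?D ` K))"
        using compact_image_chart_partial[OF lin_comb_Cr[OF Y X] c vs' K]
        by (intro compact_continuous_image continuous_intros)
      then obtain m where m: "m \<in> norm ` (chart_partial c vs ?D ` K)"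
        "\<forall>x \<in> norm ` (chart_partial c vs ?D ` K). x \<le> m"
        using compact_attains_sup False by (metis image_is_empty)
      then obtain p where p: "p \<in> K" "m = norm (chart_partial c vs ?D p)" by blast
      have "m < \<epsilon>" using less[OF p(1) vs'] D[OF p(1) vs'] p(2) by simp
      moreover have "norm (chart_partial c vs Y q - chart_partial c vs X q) \<le> m" if "q \<in> K" for q
        using m(2) that D[OF that vs'] by (metis imageI)
      ultimately show ?thesis by blast
    qed
    then have "\<forall>vs\<in>?W. \<exists>m. m < \<epsilon> \<and> (\<forall>p\<in>K. norm (chart_partial c vs Y p - chart_partial c vs X p) \<le> m)" by blast
    from bchoice[OF this] obtain m where
      m: "\<forall>vs\<in>?W. m vs < \<epsilon> \<and> (\<forall>p\<in>K. norm (chart_partial c vs Y p - chart_partial c vs X p) \<le> m vs)"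
      by (elim exE)
    define m' where "m' = Max (m ` ?W)"
    have W: "finite (m ` ?W)" "m ` ?W \<noteq> {}" using finite_words[of r] by (auto intro!: exI[of _ "[]"])
    have "m' < \<epsilon>" unfolding m'_def using Max_in[OF W] m by fastforce
    have m': "norm (chart_partial c vs Y p - chart_partial c vs X p) \<le> m'" if "p \<in> K" "vs \<in> ?W" for vs p
      using m that Max_ge[OF W(1) imageI[OF that(2)]] unfolding m'_def by (meson order_trans)
    define \<rho> where "\<rho> = (\<epsilon> - m') / C"
    have "\<rho> > 0" using \<open>m' < \<epsilon>\<close> \<open>C > 0\<close> by (simp add: \<rho>_def)
    moreover have "N.metric.mball Y \<rho> \<subseteq> Cr_nbhd M A r X c K \<epsilon>"
    proof
      fix Z assume "Z \<in> N.metric.mball Y \<rho>"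
      then have Z: "Z \<in> Cr_maps M A r" and "norm_dist ?N Y Z < \<rho>" unfolding N.metric.in_mball by auto
      then have "norm_dist ?N Z Y < \<rho>" by (simp only: N.metric.commute)
      then have small: "C * norm_dist ?N Z Y < \<epsilon> - m'" using \<open>C > 0\<close> by (simp add: \<rho>_def field_simps)
      have "norm (chart_partial c vs Z p - chart_partial c vs X p) < \<epsilon>"
        if vs: "vs \<in> words" "length vs \<le> r" and p: "p \<in> K" for vs p
      proof -
        have "norm (chart_partial c vs Y p - chart_partial c vs X p) \<le> m'" using m' p vs by blast
        moreover have "norm (chart_partial c vs Z p - chart_partial c vs Y p) \<le> C * norm_dist ?N Z Y"
          using C[OF Z Y p vs] .
        ultimately show ?thesis
          using small norm_triangle_ineq[of "chart_partial c vs Z p - chart_partial c vs Y p"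
              "chart_partial c vs Y p - chart_partial c vs X p"] by simp
      qed
      then show "Z \<in> Cr_nbhd M A r X c K \<epsilon>" using Z by (auto simp: Cr_nbhd_def chart_partial_def)
    qed
    ultimately show ?thesis by blast
  qed
  moreover have "Cr_nbhd M A r X c K \<epsilon> \<subseteq> carrier ?N" by (auto simp: Cr_nbhd_def)
  ultimately show ?thesis unfolding norm_topology_def N.metric.openin_mtopology by blast
qed

text \<open>
  A basic neighbourhood involves an arbitrary chart and compact set and is norm-open by the comparison of
  charts; conversely, finitely many basic neighbourhoods, one for each piece of the cover, fit into a ball.
\<close>

theorem norm_topology_Cr:
  "norm_topology (Cr_module :: ('a \<Rightarrow> real ^ 'n) normed_module) = Cr_topology M A r"
  unfolding topology_eq
proof (intro allI iffI)
  let ?N = "Cr_module :: ('a \<Rightarrow> real ^ 'n) normed_module"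
  interpret N: normed_real_module ?N by (rule Cr_normed)
  let ?B = "{Cr_nbhd M A r X c K \<epsilon> | (X :: 'a \<Rightarrow> real ^ 'n) c K \<epsilon>.
      X \<in> Cr_maps M A r \<and> c \<in> A \<and> compactin M K \<and> K \<subseteq> fst c \<and> 0 < \<epsilon>}"
  fix U :: "('a \<Rightarrow> real ^ 'n) set"
  {
    assume "openin (Cr_topology M A r) U"
    then have "generate_topology_on ?B U" by (simp add: Cr_topology_def openin_topology_generated_by_iff)
    then show "openin (norm_topology ?N) U"
    proof (rule generate_topology_on_coarsest[OF istopology_openin, rotated])
      show "openin (norm_topology ?N) s" if "s \<in> ?B" for s using that Cr_nbhd_open by blast
    qed
  }
  assume U: "openin (norm_topology ?N) U"
  have "\<exists>T. openin (Cr_topology M A r) T \<and> X \<in> T \<and> T \<subseteq> U" if XU: "X \<in> U" for X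
  proof -
    have X: "X \<in> Cr_maps M A r" using openin_subset[OF U] XU by auto
    obtain \<rho> where \<rho>: "\<rho> > 0" "N.metric.mball X \<rho> \<subseteq> U"
      using U XU unfolding norm_topology_def N.metric.openin_mtopology by blast
    define T where "T = (\<Inter>i\<in>\<K>. Cr_nbhd M A r X (fst i) (snd i) (\<rho> / 2))"
    obtain p where "p \<in> topspace M" using nonempty by blast
    then have ne: "\<K> \<noteq> {}" using cover_all by blast
    have "openin (Cr_topology M A r) (Cr_nbhd M A r X (fst i) (snd i) (\<rho> / 2))" if "i \<in> \<K>" for i
      unfolding Cr_topology_def
    proof (rule topology_generated_by_Basis)
      show "Cr_nbhd M A r X (fst i) (snd i) (\<rho> / 2) \<in> ?B"
        using X \<rho>(1) cover_pieces[of "fst i" "snd i"] that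
        by (intro CollectI exI[of _ X] exI[of _ "fst i"] exI[of _ "snd i"] exI[of _ "\<rho> / 2"] conjI refl) auto
    qed
    then have "openin (Cr_topology M A r) T" unfolding T_def using ne finite_cover by blast
    moreover have "X \<in> T" using X \<rho>(1) by (auto simp: T_def Cr_nbhd_def)
    moreover have "T \<subseteq> U"
    proof
      fix Y assume Y: "Y \<in> T"
      then have YC: "Y \<in> Cr_maps M A r" using ne by (auto simp: T_def Cr_nbhd_def)
      have "Cr_norm (lin_comb M 1 Y (-1) X) \<le> \<rho> / 2"
      proof (rule Cr_norm_least)
        fix c K p vs assume *: "(c, K) \<in> \<K>" "p \<in> K" "vs \<in> words" "length vs \<le> r"
        have "Y \<in> Cr_nbhd M A r X c K (\<rho> / 2)" using Y *(1) unfolding T_def by force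
        then have "norm (chart_partial c vs Y p - chart_partial c vs X p) < \<rho> / 2"
          using * unfolding Cr_nbhd_def chart_partial_def by blast
        moreover have "chart_partial c vs (lin_comb M 1 Y (-1) X) p = chart_partial c vs Y p - chart_partial c vs X p"
          using chart_partial_lin_comb[OF YC X _ _ *(3,4), of c p 1 "-1"] cover_pieces[OF *(1)] *(2) by auto
        ultimately show "norm (chart_partial c vs (lin_comb M 1 Y (-1) X) p) \<le> \<rho> / 2" by simp
      qed
      then have "norm_dist ?N Y X < \<rho>" using \<rho>(1) by (simp only: norm_dist_Cr[OF YC X])
      then have "Y \<in> N.metric.mball X \<rho>" using X YC unfolding N.metric.in_mball by (simp add: N.metric.commute)
      then show "Y \<in> U" using \<rho>(2) by blast
    qed
    ultimately show ?thesis by blast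
  qed
  then show "openin (Cr_topology M A r) U" by (meson openin_subopen)
qed

end

section \<open>The derivative \<open>\<partial>X\<close>\<close>

lemma norm_complexify [simp]: "norm (complexify a) = norm a"
  by (simp add: complexify_def norm_vec_def)

lemma norm_smult_vec: "norm (c *s v) = norm (c :: complex) * norm v"
  by (simp add: norm_vec_def L2_set_def vector_scalar_mult_def norm_mult power_mult_distrib
      sum_distrib_left[symmetric] real_sqrt_mult)

lemma del_coeff_chart_partial:
  "del_coeff c X p = (1 / 2) *s (complexify (chart_partial c [1] X p) - \<i> *s complexify (chart_partial c [\<i>] X p))"
  by (simp add: del_coeff_def chart_partial_def complexify_def vec_eq_iff)

lemma del_coeff_wirtinger:
  "del_coeff c X p = wirtinger (chart_image c) (in_chart c X) (snd c p)"
  by (simp add: del_coeff_def wirtinger_def)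

lemma norm_del_le:
  "norm ((1 / 2) *s (complexify a - \<i> *s complexify b)) \<le> norm a + norm b"
proof -
  have "norm ((1 / 2) *s (complexify a - \<i> *s complexify b)) \<le> norm (complexify a - \<i> *s complexify b)"
    by (simp add: norm_smult_vec del: vector_ssub_ldistrib)
  also have "\<dots> \<le> norm a + norm b"
    using norm_triangle_ineq4[of "complexify a" "\<i> *s complexify b"] by (simp add: norm_smult_vec)
  finally show ?thesis .
qed

lemma norm_del_coeff_le:
  "norm (del_coeff c X p) \<le> norm (chart_partial c [1] X p) + norm (chart_partial c [\<i>] X p)"
  unfolding del_coeff_chart_partial by (rule norm_del_le)

lemma norm_del_coeff_diff_le:
  "norm (del_coeff c X p - del_coeff c Y p)
    \<le> norm (chart_partial c [1] X p - chart_partial c [1] Y p) + norm (chart_partial c [\<i>] X p - chart_partial c [\<i>] Y p)"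
proof -
  have "del_coeff c X p - del_coeff c Y p = (1 / 2) *s (complexify (chart_partial c [1] X p - chart_partial c [1] Y p)
      - \<i> *s complexify (chart_partial c [\<i>] X p - chart_partial c [\<i>] Y p))"
    by (simp add: del_coeff_chart_partial complexify_def vec_eq_iff algebra_simps)
  then show ?thesis by (simp only: norm_del_le)
qed

text \<open>
  The real and imaginary parts of \<open>\<Sum> w\<^sub>j\<^sup>2 = 0\<close> say that \<open>a\<close> and \<open>b\<close> have equal length and are orthogonal.
\<close>

lemma conformal_dlin:
  fixes a b :: "real ^ 'n" and w :: "complex ^ 'n"
  assumes w: "w = (1 / 2) *s (complexify a - \<i> *s complexify b)" "w \<noteq> 0" "(\<Sum>j\<in>UNIV. (w $ j)\<^sup>2) = 0"
  shows "inj (dlin a b) \<and> (\<exists>s>0. \<forall>u v. dlin a b u \<bullet> dlin a b v = s * (u \<bullet> v))"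
proof -
  have "(2 * w $ j)\<^sup>2 = of_real ((a $ j)\<^sup>2 - (b $ j)\<^sup>2) - \<i> * of_real (2 * (a $ j * b $ j))" for j
    by (simp add: w(1) complexify_def power2_eq_square algebra_simps complex_eq_iff)
  then have "(\<Sum>j\<in>UNIV. (2 * w $ j)\<^sup>2) = of_real (a \<bullet> a - b \<bullet> b) - \<i> * of_real (2 * (a \<bullet> b))"
    by (simp add: inner_vec_def sum_subtractf sum_distrib_left power2_eq_square)
  moreover have "(\<Sum>j\<in>UNIV. (2 * w $ j)\<^sup>2) = 0"
    using w(3) by (simp add: power_mult_distrib sum_distrib_left[symmetric])
  ultimately have ab: "a \<bullet> a = b \<bullet> b" "a \<bullet> b = 0" by (auto simp: complex_eq_iff)
  have "a \<noteq> 0"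
  proof
    assume "a = 0"
    moreover from this have "b = 0" using ab by simp
    ultimately have "w = 0" by (simp add: w(1) complexify_def vec_eq_iff)
    then show False using w(2) by simp
  qed
  then have pos: "a \<bullet> a > 0" by simp
  have inner: "dlin a b u \<bullet> dlin a b v = (a \<bullet> a) * (u \<bullet> v)" for u v
    using ab by (simp add: dlin_def inner_add_left inner_add_right inner_complex_def inner_commute[of b a] algebra_simps)
  have "inj (dlin a b)"
  proof (rule injI)
    fix u v assume "dlin a b u = dlin a b v"
    then have "dlin a b (u - v) = 0" by (simp add: dlin_def algebra_simps)
    then have "(a \<bullet> a) * ((u - v) \<bullet> (u - v)) = 0" using inner[of "u - v" "u - v"] by simp
    then show "u = v" using pos by simp
  qed
  then show ?thesis using pos inner by blast
qed

context bordered_surface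
begin

lemma chart_at: "p \<in> topspace M \<Longrightarrow> chart_at A p \<in> A \<and> p \<in> fst (chart_at A p)"
  unfolding chart_at_def by (rule someI_ex) (use charts_cover in blast)

lemma del_coeff_lin_comb:
  fixes X Y :: "'a \<Rightarrow> real ^ 'n"
  assumes "X \<in> Cr_maps M A r" "Y \<in> Cr_maps M A r" "1 \<le> r" "c \<in> A" "p \<in> fst c"
  shows "del_coeff c (lin_comb M a X b Y) p = of_real a *s del_coeff c X p + of_real b *s del_coeff c Y p"
proof -
  have *: "chart_partial c [v] (lin_comb M a X b Y) p = a *\<^sub>R chart_partial c [v] X p + b *\<^sub>R chart_partial c [v] Y p"
    if "v \<in> {1, \<i>}" for v
    using assms that by (intro chart_partial_lin_comb) auto
  show ?thesis
    by (simp add: del_coeff_chart_partial * complexify_def vec_eq_iff algebra_simps)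
qed

text \<open>
  The coefficient of the form \<open>\<partial>X\<close> is multiplied by the derivative of the transition map, which is nonzero
  because the transition map has a differentiable inverse.
\<close>

lemma del_coeff_change:
  assumes cd: "c \<in> A" "d \<in> A" and p: "p \<in> fst c" "p \<in> fst d"
  obtains \<tau> where "\<tau> \<noteq> 0" "(transition c d has_field_derivative \<tau>) (at (snd c p) within overlap c d)"
    "\<And>(X :: 'a \<Rightarrow> real ^ 'n) r. X \<in> Cr_maps M A r \<Longrightarrow> 1 \<le> r \<Longrightarrow> del_coeff c X p = \<tau> *s del_coeff d X p"
proof -
  let ?z = "snd c p" and ?w = "snd d p"
  have z: "?z \<in> overlap c d" "?w \<in> overlap d c" using p by (auto simp: overlap_def)
  have tz: "transition c d ?z = ?w" using transition_at[OF cd(1) p(1)] .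
  obtain \<tau> where \<tau>: "(transition c d has_field_derivative \<tau>) (at ?z within overlap c d)"
    using transition_holomorphic[OF cd] z(1) by (auto simp: holomorphic_on_def field_differentiable_def)
  obtain \<sigma> where \<sigma>: "(transition d c has_field_derivative \<sigma>) (at ?w within overlap d c)"
    using transition_holomorphic[OF cd(2,1)] z(2) by (auto simp: holomorphic_on_def field_differentiable_def)
  have image: "transition c d ` overlap c d \<subseteq> overlap d c" using transition_overlap[OF cd(1)] by blast
  have \<tau>D: "(transition c d has_derivative (*) \<tau>) (at ?z within overlap c d)"
    using \<tau> by (simp add: has_field_derivative_def)
  have "\<tau> \<noteq> 0"
  proof
    assume "\<tau> = 0"
    have "((\<lambda>z. transition d c (transition c d z)) has_derivative (\<lambda>h. \<sigma> * (\<tau> * h))) (at ?z within overlap c d)"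
      using \<sigma> by (intro has_derivative_in_compose[OF \<tau>D] has_derivative_subset[OF _ image]) (simp add: tz has_field_derivative_def)
    moreover have "((\<lambda>z. transition d c (transition c d z)) has_derivative (\<lambda>h. h)) (at ?z within overlap c d)"
      by (rule has_derivative_transform[OF z(1) _ has_derivative_ident]) (simp add: transition_inverse[OF cd])
    ultimately have "(\<lambda>h. \<sigma> * (\<tau> * h)) = (\<lambda>h. h)"
      by (rule half_open_derivative_unique[OF overlap_half_open[OF cd] z(1)])
    from fun_cong[OF this, of 1] show False using \<open>\<tau> = 0\<close> by simp
  qed
  moreover have "del_coeff c X p = \<tau> *s del_coeff d X p" if X: "X \<in> Cr_maps M A r" and "1 \<le> r" for X :: "'a \<Rightarrow> real ^ 'n" and r
  proof -
    let ?a = "chart_partial c [1] X p" and ?b = "chart_partial c [\<i>] X p"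
    let ?a' = "chart_partial d [1] X p" and ?b' = "chart_partial d [\<i>] X p"
    have C: "Ck_on r (chart_image e) (in_chart e X)" if "e \<in> A" for e using X that by (auto simp: Cr_maps_def)
    have der: "(in_chart e X has_derivative dlin (chart_partial e [1] X p) (chart_partial e [\<i>] X p)) (at (snd e p) within chart_image e)"
      if "e \<in> A" "p \<in> fst e" for e
      using Ck_on_has_derivative[OF C[OF that(1)], of "[]" "snd e p"] in_chart_image[OF that(2)] \<open>1 \<le> r\<close> by (simp add: chart_partial_def)
    have 1: "(in_chart c X has_derivative dlin ?a ?b) (at ?z within overlap c d)"
      using der[OF cd(1) p(1)] overlap_subset by (rule has_derivative_subset)
    have "(in_chart d X has_derivative dlin ?a' ?b') (at (transition c d ?z) within transition c d ` overlap c d)"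
      unfolding tz using der[OF cd(2) p(2)] by (rule has_derivative_subset) (use image overlap_subset in blast)
    from has_derivative_in_compose[OF \<tau>D this]
    have 2: "(in_chart c X has_derivative (\<lambda>h. dlin ?a' ?b' (\<tau> * h))) (at ?z within overlap c d)"
      by (rule has_derivative_transform[OF z(1), rotated]) (simp add: in_chart_transition[OF cd])
    have "dlin ?a ?b = (\<lambda>h. dlin ?a' ?b' (\<tau> * h))"
      using half_open_derivative_unique[OF overlap_half_open[OF cd] z(1) 1 2] .
    from fun_cong[OF this, of 1] fun_cong[OF this, of \<i>]
    have "?a = Re \<tau> *\<^sub>R ?a' + Im \<tau> *\<^sub>R ?b'" "?b = - Im \<tau> *\<^sub>R ?a' + Re \<tau> *\<^sub>R ?b'"
      by (simp_all add: dlin_def)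
    then show ?thesis
      by (simp add: del_coeff_chart_partial complexify_def vec_eq_iff complex_eq_iff algebra_simps)
  qed
  ultimately show thesis using that \<tau> by blast
qed

text \<open>
  Harmonicity is a condition on second derivatives; holomorphy of \<open>\<partial>X/\<partial>z\<close> expresses it by first derivatives,
  and so it can be passed to limits even when \<open>r = 1\<close>.
\<close>

lemma harmonic_iff_holomorphic:
  assumes X: "X \<in> Cr_maps M A r" and "1 \<le> r" and c: "c \<in> A"
  shows "harmonic_on (interior (chart_image c)) (in_chart c X) \<longleftrightarrow>
    (\<forall>j. (\<lambda>z. wirtinger (chart_image c) (in_chart c X) z $ j) holomorphic_on interior (chart_image c))"
proof -
  let ?S = "chart_image c" and ?g = "in_chart c X"
  have C: "Ck_on 1 ?S ?g" using X c \<open>1 \<le> r\<close> by (auto simp: Cr_maps_def intro: Ck_on_mono)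
  have sub: "interior ?S \<subseteq> upper_half_plane"
    using interior_subset openin_imp_subset[OF chart_half_open[OF c]] by blast
  have half: "half_open (interior ?S)"
    using sub open_openin_trans[of upper_half_plane "interior ?S"] by (metis Int_absorb1 open_interior openin_open)
  have eq: "wirtinger (interior ?S) ?g z = wirtinger ?S ?g z" if z: "z \<in> interior ?S" for z
  proof -
    have "partials (interior ?S) [v] ?g z = partials ?S [v] ?g z" if "v \<in> {1, \<i>}" for v
      using that z by (intro partials_restrict[OF C half interior_subset]) auto
    then show ?thesis by (simp add: wirtinger_def)
  qed
  have C': "Ck_on 1 (interior ?S) ?g" using Ck_on_restrict[OF C half interior_subset] by simp
  have "harmonic_on (interior ?S) ?g \<longleftrightarrow> (\<forall>j. (\<lambda>z. wirtinger (interior ?S) ?g z $ j) holomorphic_on interior ?S)"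
    using harmonic_imp_holomorphic_wirtinger[OF open_interior] holomorphic_wirtinger_imp_harmonic[OF open_interior half C'] by blast
  also have "\<dots> \<longleftrightarrow> (\<forall>j. (\<lambda>z. wirtinger ?S ?g z $ j) holomorphic_on interior ?S)"
    using eq by (intro all_cong1 holomorphic_cong) auto
  finally show ?thesis .
qed

end

section \<open>Maps with \<open>\<partial>X\<close> proportional to a given map\<close>

text \<open>
  The real linear part of the conditions on an immersion with Gauss map \<open>\<pi> \<circ> f\<close>; zeros of \<open>\<partial>X\<close> are allowed.
\<close>

definition directed_harmonic_maps ::
    "'a topology \<Rightarrow> 'a chart set \<Rightarrow> nat \<Rightarrow> ('a \<Rightarrow> complex ^ 'n) \<Rightarrow> ('a \<Rightarrow> real ^ 'n) set"
  where "directed_harmonic_maps M A r f = {X \<in> Cr_maps M A r.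
    (\<forall>c\<in>A. harmonic_on (interior (chart_image c)) (in_chart c X)) \<and>
    (\<forall>p\<in>topspace M. \<exists>l. del_coeff (chart_at A p) X p = l *s f p)}"

definition nondegenerate_maps :: "'a topology \<Rightarrow> 'a chart set \<Rightarrow> nat \<Rightarrow> ('a \<Rightarrow> real ^ 'n) set"
  where "nondegenerate_maps M A r = {X \<in> Cr_maps M A r. \<forall>p\<in>topspace M. del_coeff (chart_at A p) X p \<noteq> 0}"

lemma proj_point_eq_iff:
  assumes "w \<noteq> 0"
  shows "proj_point z = proj_point w \<longleftrightarrow> (\<exists>c. c \<noteq> 0 \<and> z = c *s w)"
proof
  assume "proj_point z = proj_point w"
  moreover have "z \<in> proj_point z" unfolding proj_point_def by (auto intro!: exI[of _ 1])
  ultimately show "\<exists>c. c \<noteq> 0 \<and> z = c *s w" by (auto simp: proj_point_def)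
next
  assume "\<exists>c. c \<noteq> 0 \<and> z = c *s w"
  then obtain c where c: "c \<noteq> 0" "z = c *s w" by blast
  show "proj_point z = proj_point w"
  proof
    show "proj_point z \<subseteq> proj_point w"
      using c by (auto simp: proj_point_def vector_smult_assoc)
    show "proj_point w \<subseteq> proj_point z"
    proof
      fix x assume "x \<in> proj_point w"
      then obtain d where d: "d \<noteq> 0" "x = d *s w" by (auto simp: proj_point_def)
      then have "x = (d / c) *s z" "d / c \<noteq> 0" using c by (simp_all add: vector_smult_assoc)
      then show "x \<in> proj_point z" unfolding proj_point_def by blast
    qed
  qed
qed

context bordered_surface
begin

lemma conformal_immersion_directed:
  assumes X: "X \<in> directed_harmonic_maps M A r f" "X \<in> nondegenerate_maps M A r" and "1 \<le> r"
    and f: "f ` topspace M \<subseteq> null_quadric_punctured"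
  shows "conformal_immersion A X"
  unfolding conformal_immersion_def Let_def
proof (intro ballI)
  fix c z assume c: "c \<in> A" and z: "z \<in> chart_image c"
  have XC: "X \<in> Cr_maps M A r" using X by (simp add: directed_harmonic_maps_def)
  obtain p where p: "p \<in> fst c" "z = snd c p" using z by (auto simp: chart_image_def)
  then have pM: "p \<in> topspace M" using chart_subset[OF c] by blast
  let ?d = "chart_at A p"
  let ?w = "del_coeff c X p"
  obtain \<tau> where \<tau>: "\<tau> \<noteq> 0" "?w = \<tau> *s del_coeff ?d X p"
    using del_coeff_change[OF c _ p(1), of ?d, where ?'n = 'b] chart_at[OF pM] XC \<open>1 \<le> r\<close> by metis
  obtain l where l: "del_coeff ?d X p = l *s f p" using X pM by (auto simp: directed_harmonic_maps_def)
  have nz: "del_coeff ?d X p \<noteq> 0" using X pM by (auto simp: nondegenerate_maps_def)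
  have "?w \<noteq> 0" using nz \<tau> by simp
  moreover have "(\<Sum>j\<in>UNIV. (?w $ j)\<^sup>2) = 0"
  proof -
    have "(\<Sum>j\<in>UNIV. (f p $ j)\<^sup>2) = 0" using f pM by (auto simp: null_quadric_punctured_def)
    then show ?thesis by (simp add: \<tau> l power_mult_distrib sum_distrib_left[symmetric])
  qed
  moreover have "frechet_derivative (in_chart c X) (at z within chart_image c)
      = dlin (chart_partial c [1] X p) (chart_partial c [\<i>] X p)"
  proof -
    have "Ck_on r (chart_image c) (in_chart c X)" using XC c by (auto simp: Cr_maps_def)
    from Ck_on_has_derivative[OF this, of "[]" z] show ?thesis
      using z p \<open>1 \<le> r\<close>
      by (intro frechet_derivative_within_half_open chart_half_open c) (auto simp: chart_partial_def)
  qed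
  ultimately show "inj (frechet_derivative (in_chart c X) (at z within chart_image c)) \<and>
      (\<exists>s>0. \<forall>v w. frechet_derivative (in_chart c X) (at z within chart_image c) v \<bullet>
        frechet_derivative (in_chart c X) (at z within chart_image c) w = s * (v \<bullet> w))"
    using conformal_dlin[OF del_coeff_chart_partial] by simp
qed

text \<open>
  Equality with the point \<open>\<pi> (f p)\<close> says that \<open>\<partial>X\<close> is a nonzero multiple of \<open>f p\<close>. Conformality
  follows, since the null quadric is a cone.
\<close>

lemma immersions_with_Gauss_map:
  assumes "1 \<le> r" and f: "f ` topspace M \<subseteq> null_quadric_punctured"
  shows "{X. conformal_minimal_immersion M A r X \<and> (\<forall>p \<in> topspace M. Gauss_map A X p = proj_point (f p))}
    = directed_harmonic_maps M A r f \<inter> nondegenerate_maps M A r"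
proof -
  have fp: "f p \<noteq> 0" if "p \<in> topspace M" for p using f that by (auto simp: null_quadric_punctured_def)
  have "Gauss_map A X p = proj_point (f p) \<longleftrightarrow> (\<exists>l. del_coeff (chart_at A p) X p = l *s f p) \<and> del_coeff (chart_at A p) X p \<noteq> 0"
    if "p \<in> topspace M" for X p
    using fp[OF that] proj_point_eq_iff[OF fp[OF that]] by (auto simp: Gauss_map_def)
  then show ?thesis
    using conformal_immersion_directed[OF _ _ assms]
    by (auto simp: conformal_minimal_immersion_def directed_harmonic_maps_def nondegenerate_maps_def)
qed

end

context covered_surface
begin

lemma del_coeff_diff_bound:
  assumes "1 \<le> r" and c: "c \<in> A" and K: "compactin M K" "K \<subseteq> fst c"
  obtains C where "C > 0" "\<And>(X :: 'a \<Rightarrow> real ^ 'n) Y p. X \<in> Cr_maps M A r \<Longrightarrow> Y \<in> Cr_maps M A r \<Longrightarrow> p \<in> K \<Longrightarrow>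
    norm (del_coeff c X p - del_coeff c Y p) \<le> C * norm_dist Cr_module X Y"
proof -
  obtain C where "C > 0" and C: "\<And>(X :: 'a \<Rightarrow> real ^ 'n) Y p vs. X \<in> Cr_maps M A r \<Longrightarrow> Y \<in> Cr_maps M A r \<Longrightarrow> p \<in> K \<Longrightarrow>
    vs \<in> words \<Longrightarrow> length vs \<le> r \<Longrightarrow>
    norm (chart_partial c vs X p - chart_partial c vs Y p) \<le> C * norm_dist Cr_module X Y"
    using chart_partial_diff_bound[OF c K, where ?'n = 'n] by metis
  show thesis
  proof (rule that)
    show "2 * C > 0" using \<open>C > 0\<close> by simp
    fix X Y :: "'a \<Rightarrow> real ^ 'n" and p assume *: "X \<in> Cr_maps M A r" "Y \<in> Cr_maps M A r" "p \<in> K"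
    have "norm (chart_partial c [v] X p - chart_partial c [v] Y p) \<le> C * norm_dist Cr_module X Y" if "v \<in> {1, \<i>}" for v
      using that \<open>1 \<le> r\<close> by (intro C *) auto
    from this[of 1] this[of \<i>] norm_del_coeff_diff_le[of c X p Y]
    show "norm (del_coeff c X p - del_coeff c Y p) \<le> (2 * C) * norm_dist Cr_module X Y" by simp
  qed
qed

lemma directed_harmonic_maps_lin_comb:
  fixes X Y :: "'a \<Rightarrow> real ^ 'n"
  assumes "1 \<le> r" and X: "X \<in> directed_harmonic_maps M A r f" and Y: "Y \<in> directed_harmonic_maps M A r f"
  shows "lin_comb M a X b Y \<in> directed_harmonic_maps M A r f"
proof -
  let ?Z = "lin_comb M a X b Y"
  have XY: "X \<in> Cr_maps M A r" "Y \<in> Cr_maps M A r" using X Y by (auto simp: directed_harmonic_maps_def)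
  note Z = lin_comb_Cr[OF XY, of a b]
  have "harmonic_on (interior (chart_image c)) (in_chart c ?Z)" if c: "c \<in> A" for c
    unfolding harmonic_iff_holomorphic[OF Z \<open>1 \<le> r\<close> c]
  proof
    fix j
    let ?w = "\<lambda>(X :: 'a \<Rightarrow> real ^ 'n) z. wirtinger (chart_image c) (in_chart c X) z $ j"
    have eq: "?w ?Z z = of_real a * ?w X z + of_real b * ?w Y z" if z: "z \<in> interior (chart_image c)" for z
    proof -
      obtain p where p: "p \<in> fst c" "z = snd c p"
        using z interior_subset by (fastforce simp: chart_image_def)
      show ?thesis
        using del_coeff_lin_comb[OF XY \<open>1 \<le> r\<close> c p(1), of a b] by (simp add: p del_coeff_wirtinger)
    qed
    have "?w X holomorphic_on interior (chart_image c)" "?w Y holomorphic_on interior (chart_image c)"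
      using X Y c harmonic_iff_holomorphic[OF XY(1) \<open>1 \<le> r\<close> c] harmonic_iff_holomorphic[OF XY(2) \<open>1 \<le> r\<close> c]
      by (auto simp: directed_harmonic_maps_def)
    then have "(\<lambda>z. of_real a * ?w X z + of_real b * ?w Y z) holomorphic_on interior (chart_image c)"
      by (intro holomorphic_intros)
    then show "?w ?Z holomorphic_on interior (chart_image c)"
      by (rule holomorphic_transform) (simp add: eq)
  qed
  moreover have "\<exists>l. del_coeff (chart_at A p) ?Z p = l *s f p" if p: "p \<in> topspace M" for p
  proof -
    obtain k l where "del_coeff (chart_at A p) X p = k *s f p" "del_coeff (chart_at A p) Y p = l *s f p"
      using X Y p unfolding directed_harmonic_maps_def by blast
    then have "del_coeff (chart_at A p) ?Z p = (of_real a * k + of_real b * l) *s f p"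
      using del_coeff_lin_comb[OF XY \<open>1 \<le> r\<close>, of "chart_at A p" p a b] chart_at[OF p]
      by (simp add: vector_smult_assoc vector_sadd_rdistrib)
    then show ?thesis ..
  qed
  ultimately show ?thesis using Z by (simp add: directed_harmonic_maps_def)
qed

lemma zero_directed:
  fixes f :: "'a \<Rightarrow> complex ^ 'n"
  assumes "1 \<le> r" shows "(\<lambda>p\<in>topspace M. 0) \<in> directed_harmonic_maps M A r f"
proof -
  let ?O = "\<lambda>p\<in>topspace M. 0 :: real ^ 'n"
  have eq: "lin_comb M 0 ?O 0 ?O = ?O" by (auto simp: lin_comb_def fun_eq_iff)
  have 0: "del_coeff c ?O p = 0" if "c \<in> A" "p \<in> fst c" for c p
    using del_coeff_lin_comb[where ?'n = 'n, OF zero_Cr zero_Cr assms that, of 0 0] unfolding eq by simp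
  have "harmonic_on (interior (chart_image c)) (in_chart c ?O)" if c: "c \<in> A" for c
    unfolding harmonic_iff_holomorphic[OF zero_Cr assms c]
  proof
    fix j
    have "wirtinger (chart_image c) (in_chart c ?O) z $ j = 0" if z: "z \<in> interior (chart_image c)" for z
    proof -
      obtain p where p: "p \<in> fst c" "z = snd c p"
        using z interior_subset by (fastforce simp: chart_image_def)
      then show ?thesis using 0[OF c p(1)] by (simp add: del_coeff_wirtinger)
    qed
    then show "(\<lambda>z. wirtinger (chart_image c) (in_chart c ?O) z $ j) holomorphic_on interior (chart_image c)"
      by (intro holomorphic_transform[OF holomorphic_on_const[of 0]]) simp
  qed
  moreover have "\<exists>l. del_coeff (chart_at A p) ?O p = l *s f p" if p: "p \<in> topspace M" for p
    using 0 chart_at[OF p] by (intro exI[of _ 0]) simp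
  ultimately show ?thesis using zero_Cr by (simp add: directed_harmonic_maps_def)
qed

text \<open>
  Convergence in \<open>C\<^sup>1\<close> makes \<open>\<partial>X/\<partial>z\<close> converge locally uniformly. Uniform limits of holomorphic functions
  are holomorphic, and complex lines are closed.
\<close>

lemma directed_harmonic_maps_closed:
  fixes X :: "'a \<Rightarrow> real ^ 'n"
  assumes "1 \<le> r" and \<sigma>: "\<And>n. \<sigma> n \<in> directed_harmonic_maps M A r f" and X: "X \<in> Cr_maps M A r"
    and lim: "(\<lambda>n. norm_dist Cr_module (\<sigma> n) X) \<longlonglongrightarrow> 0"
  shows "X \<in> directed_harmonic_maps M A r f"
proof -
  have \<sigma>C: "\<sigma> n \<in> Cr_maps M A r" for n using \<sigma> by (auto simp: directed_harmonic_maps_def)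
  have unif: "uniform_limit K (\<lambda>n. del_coeff c (\<sigma> n)) (del_coeff c X) sequentially"
    if cK: "c \<in> A" "compactin M K" "K \<subseteq> fst c" for c K
  proof -
    obtain C where "C > 0" and C: "\<And>(X :: 'a \<Rightarrow> real ^ 'n) Y p. X \<in> Cr_maps M A r \<Longrightarrow> Y \<in> Cr_maps M A r \<Longrightarrow> p \<in> K \<Longrightarrow>
      norm (del_coeff c X p - del_coeff c Y p) \<le> C * norm_dist Cr_module X Y"
      using del_coeff_diff_bound[OF \<open>1 \<le> r\<close> cK, where ?'n = 'n] by metis
    show ?thesis
    proof (rule uniform_limitI)
      fix e :: real assume "e > 0"
      have "(\<lambda>n. C * norm_dist Cr_module (\<sigma> n) X) \<longlonglongrightarrow> 0"
        using tendsto_mult_right_zero[OF lim] .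
      then have "\<forall>\<^sub>F n in sequentially. C * norm_dist Cr_module (\<sigma> n) X < e"
        using \<open>e > 0\<close> by (rule order_tendstoD(2))
      then show "\<forall>\<^sub>F n in sequentially. \<forall>p\<in>K. dist (del_coeff c (\<sigma> n) p) (del_coeff c X p) < e"
        using C[OF \<sigma>C X] by (auto elim!: eventually_mono simp: dist_norm intro: order_le_less_trans)
    qed
  qed
  have "harmonic_on (interior (chart_image c)) (in_chart c X)" if c: "c \<in> A" for c
    unfolding harmonic_iff_holomorphic[OF X \<open>1 \<le> r\<close> c]
  proof
    fix j
    let ?S = "interior (chart_image c)"
    let ?w = "\<lambda>(X :: 'a \<Rightarrow> real ^ 'n) z. wirtinger (chart_image c) (in_chart c X) z $ j"
    show "?w X holomorphic_on ?S"
    proof (rule holomorphic_uniform_sequence[OF open_interior])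
      show "?w (\<sigma> n) holomorphic_on ?S" for n
        using \<sigma>[of n] c harmonic_iff_holomorphic[OF \<sigma>C \<open>1 \<le> r\<close> c] by (auto simp: directed_harmonic_maps_def)
      fix x assume "x \<in> ?S"
      then obtain d where d: "d > 0" "cball x d \<subseteq> ?S" using open_contains_cball open_interior by blast
      then have sub: "cball x d \<subseteq> chart_image c" using interior_subset by blast
      let ?K = "inv_into (fst c) (snd c) ` cball x d"
      have "?K \<subseteq> fst c" using sub by (auto simp: chart_image_def intro: inv_into_into)
      then have "uniform_limit ?K (\<lambda>n. del_coeff c (\<sigma> n)) (del_coeff c X) sequentially"
        using unif[OF c chart_preimage_compact[OF c compact_cball sub]] by blast
      then have "uniform_limit (cball x d) (\<lambda>n z. del_coeff c (\<sigma> n) (inv_into (fst c) (snd c) z))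
          (\<lambda>z. del_coeff c X (inv_into (fst c) (snd c) z)) sequentially"
        by (auto simp: uniform_limit_iff)
      moreover have "snd c (inv_into (fst c) (snd c) z) = z" if "z \<in> cball x d" for z
        using sub that by (auto simp: chart_image_def f_inv_into_f)
      ultimately have "uniform_limit (cball x d) (\<lambda>n. wirtinger (chart_image c) (in_chart c (\<sigma> n)))
          (wirtinger (chart_image c) (in_chart c X)) sequentially"
        by (simp add: uniform_limit_iff del_coeff_wirtinger)
      then have "uniform_limit (cball x d) (\<lambda>n. ?w (\<sigma> n)) (?w X) sequentially"
        by (rule bounded_linear.uniform_limit[OF bounded_linear_vec_nth])
      then show "\<exists>d>0. cball x d \<subseteq> ?S \<and> uniform_limit (cball x d) (\<lambda>n. ?w (\<sigma> n)) (?w X) sequentially"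
        using d by blast
    qed
  qed
  moreover have "\<exists>l. del_coeff (chart_at A p) X p = l *s f p" if p: "p \<in> topspace M" for p
  proof -
    let ?c = "chart_at A p"
    have "closed {l *s f p | l. True}"
    proof -
      have "subspace {l *s f p | l. True}"
        unfolding subspace_def
      proof (intro conjI ballI allI)
        show "0 \<in> {l *s f p | l. True}" by (auto intro: exI[of _ 0])
        fix x assume "x \<in> {l *s f p | l. True}"
        then obtain k where k: "x = k *s f p" by blast
        show "x + y \<in> {l *s f p | l. True}" if "y \<in> {l *s f p | l. True}" for y
        proof -
          obtain l where "y = l *s f p" using \<open>y \<in> _\<close> by blast
          then have "x + y = (k + l) *s f p" using k by (simp add: vector_sadd_rdistrib)
          then show ?thesis by blast
        qed
        have "s *\<^sub>R x = (of_real s * k) *s f p" for s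
          by (simp add: k vec_eq_iff) (simp add: scaleR_conv_of_real)
        then show "s *\<^sub>R x \<in> {l *s f p | l. True}" for s by blast
      qed
      then show ?thesis by (rule closed_subspace)
    qed
    moreover have "del_coeff ?c (\<sigma> n) p \<in> {l *s f p | l. True}" for n
      using \<sigma>[of n] p by (auto simp: directed_harmonic_maps_def)
    moreover have "(\<lambda>n. del_coeff ?c (\<sigma> n) p) \<longlonglongrightarrow> del_coeff ?c X p"
      using unif[of ?c "{p}"] chart_at[OF p] p by (auto intro: tendsto_uniform_limitI)
    ultimately have "del_coeff ?c X p \<in> {l *s f p | l. True}" by (rule closed_sequentially)
    then show ?thesis by blast
  qed
  ultimately show ?thesis using X by (simp add: directed_harmonic_maps_def)
qed

text \<open>
  On each compact piece of the cover \<open>\<partial>X\<close> stays at a positive distance from zero.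
\<close>

lemma nondegenerate_maps_open:
  assumes "1 \<le> r"
  shows "openin (norm_topology (Cr_module :: ('a \<Rightarrow> real ^ 'n) normed_module)) (nondegenerate_maps M A r)"
proof -
  let ?N = "Cr_module :: ('a \<Rightarrow> real ^ 'n) normed_module"
  interpret N: normed_real_module ?N by (rule Cr_normed)
  have "\<exists>\<rho>>0. N.metric.mball X \<rho> \<subseteq> nondegenerate_maps M A r" if X: "X \<in> nondegenerate_maps M A r" for X
  proof -
    have XC: "X \<in> Cr_maps M A r" using X by (simp add: nondegenerate_maps_def)
    have "\<exists>\<rho>>0. \<forall>Y \<in> N.metric.mball X \<rho>. \<forall>p\<in>snd i. del_coeff (fst i) Y p \<noteq> 0" if i: "i \<in> \<K>" for i
    proof -
      obtain c K where iK: "i = (c, K)" by fastforce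
      note cK = cover_pieces[of c K, OF i[unfolded iK]]
      let ?F = "\<lambda>a :: (real ^ 'n) \<times> (real ^ 'n). (1 / 2) *s (complexify (fst a) - \<i> *s complexify (snd a))"
      obtain C where "C > 0" and C: "\<And>(X :: 'a \<Rightarrow> real ^ 'n) Y p. X \<in> Cr_maps M A r \<Longrightarrow> Y \<in> Cr_maps M A r \<Longrightarrow> p \<in> K \<Longrightarrow>
        norm (del_coeff c X p - del_coeff c Y p) \<le> C * norm_dist Cr_module X Y"
        using del_coeff_diff_bound[OF \<open>1 \<le> r\<close>, of c K, where ?'n = 'n] cK by metis
      have nz: "del_coeff c X p \<noteq> 0" if "p \<in> K" for p
      proof -
        have pM: "p \<in> topspace M" "p \<in> fst c" using cK that chart_subset by blast+
        obtain \<tau> where \<tau>: "\<tau> \<noteq> 0" "del_coeff c X p = \<tau> *s del_coeff (chart_at A p) X p"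
          using del_coeff_change[of c "chart_at A p" p, where ?'n = 'n] chart_at[OF pM(1)] XC \<open>1 \<le> r\<close> cK pM by metis
        then show ?thesis using X pM by (simp add: nondegenerate_maps_def)
      qed
      have "continuous_on (chart_image c) (partials (chart_image c) [v] (in_chart c X))" if "v \<in> {1, \<i>}" for v
        using XC cK that \<open>1 \<le> r\<close> by (intro Ck_on_continuous[of r]) (auto simp: Cr_maps_def)
      then have cont: "continuous_on (chart_image c) (wirtinger (chart_image c) (in_chart c X))"
        unfolding wirtinger_def by (intro continuous_intros) auto
      have "compact (wirtinger (chart_image c) (in_chart c X) ` (snd c ` K))"
        using cK chart_image_compact[of c K]
        by (intro compact_continuous_image continuous_on_subset[OF cont]) (auto simp: chart_image_def)
      then have "closed (del_coeff c X ` K)"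
        by (simp add: image_image del_coeff_wirtinger compact_imp_closed)
      moreover have "0 \<notin> del_coeff c X ` K" using nz by auto
      ultimately have "open (- (del_coeff c X ` K))" "0 \<in> - (del_coeff c X ` K)" by auto
      then obtain \<delta> where \<delta>: "\<delta> > 0" "ball 0 \<delta> \<subseteq> - (del_coeff c X ` K)" by (rule openE)
      have "del_coeff c Y p \<noteq> 0" if "Y \<in> N.metric.mball X (\<delta> / C)" "p \<in> K" for Y p
      proof
        assume 0: "del_coeff c Y p = 0"
        have Y: "Y \<in> Cr_maps M A r" "norm_dist ?N X Y < \<delta> / C"
          using that(1) unfolding N.metric.in_mball by auto
        have "norm (del_coeff c X p) \<le> C * norm_dist ?N X Y" using C[OF XC Y(1) that(2)] 0 by simp
        also have "\<dots> < \<delta>" using Y(2) \<open>C > 0\<close> by (simp add: field_simps)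
        finally show False using \<delta>(2) that(2) by force
      qed
      then show ?thesis using \<delta>(1) \<open>C > 0\<close> by (intro exI[of _ "\<delta> / C"]) (auto simp: iK)
    qed
    then have "\<forall>i\<in>\<K>. \<exists>\<rho>. \<rho> > 0 \<and> (\<forall>Y \<in> N.metric.mball X \<rho>. \<forall>p\<in>snd i. del_coeff (fst i) Y p \<noteq> 0)" by blast
    from bchoice[OF this] obtain \<rho> where
      \<rho>: "\<forall>i\<in>\<K>. \<rho> i > 0 \<and> (\<forall>Y \<in> N.metric.mball X (\<rho> i). \<forall>p\<in>snd i. del_coeff (fst i) Y p \<noteq> 0)" by (elim exE)
    define m where "m = Min (insert 1 (\<rho> ` \<K>))"
    have m: "m > 0" "\<And>i. i \<in> \<K> \<Longrightarrow> m \<le> \<rho> i"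
      using \<rho> finite_cover by (auto simp: m_def)
    have "Y \<in> nondegenerate_maps M A r" if Y: "Y \<in> N.metric.mball X m" for Y
    proof -
      have YC: "Y \<in> Cr_maps M A r" using Y unfolding N.metric.in_mball by auto
      have "del_coeff (chart_at A p) Y p \<noteq> 0" if p: "p \<in> topspace M" for p
      proof -
        obtain c K where cK: "(c, K) \<in> \<K>" "p \<in> K" using cover_all[OF p] by blast
        have "Y \<in> N.metric.mball X (\<rho> (c, K))" using Y m(2)[OF cK(1)] unfolding N.metric.in_mball by auto
        then have nz: "del_coeff c Y p \<noteq> 0" using \<rho> cK by force
        obtain \<tau> where "\<tau> \<noteq> 0" "del_coeff c Y p = \<tau> *s del_coeff (chart_at A p) Y p"
          using del_coeff_change[of c "chart_at A p" p, where ?'n = 'n] chart_at[OF p] YC \<open>1 \<le> r\<close> cover_pieces[OF cK(1)] cK(2) by (metis subsetD)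
        then show ?thesis using nz by auto
      qed
      then show ?thesis using YC by (simp add: nondegenerate_maps_def)
    qed
    then show ?thesis using m(1) by blast
  qed
  moreover have "nondegenerate_maps M A r \<subseteq> carrier ?N" by (auto simp: nondegenerate_maps_def)
  ultimately show ?thesis unfolding norm_topology_def N.metric.openin_mtopology by blast
qed

end

section \<open>Flux\<close>

text \<open>
  The chart used here may jump with \<open>t\<close>, so the continuity of this function between the corners of
  the curve is not visible from the definition.
\<close>

definition flux_integrand :: "'a chart set \<Rightarrow> ('a \<Rightarrow> real ^ 'n) \<Rightarrow> (real \<Rightarrow> 'a) \<Rightarrow> 'n \<Rightarrow> real \<Rightarrow> real"
  where "flux_integrand A X \<gamma> j t = (let c = chart_at A (\<gamma> t)
    in Im (del_coeff c X (\<gamma> t) $ j * vector_derivative (snd c \<circ> \<gamma>) (at t)))"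

lemma integral_Im_del_eq: "integral_Im_del A X \<gamma> = (\<chi> j. integral {0..1} (flux_integrand A X \<gamma> j))"
  by (simp add: integral_Im_del_def flux_integrand_def[abs_def])

text \<open>
  Prescribing a flux map on the homology group therefore determines its values on all closed curves.
\<close>

lemma curve_class_in_homology:
  assumes \<gamma>: "closed_curve M A \<gamma>"
  shows "curve_class M \<gamma> \<in> carrier (homology_group 1 M)"
proof -
  let ?s = "restrict (\<lambda>x. \<gamma> (x 1)) (standard_simplex 1)"
  have path: "continuous_map (top_of_set {0..1}) M \<gamma>" and ends: "\<gamma> 0 = \<gamma> 1"
    using \<gamma> by (auto simp: closed_curve_def pathin_def)
  have "singular_simplex 1 M ?s"
    unfolding singular_simplex_def
  proof
    have "continuous_map (subtopology (powertop_real UNIV) (standard_simplex 1)) (top_of_set {0..1}) (\<lambda>x. x 1)"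
      unfolding continuous_map_in_subtopology
    proof
      show "continuous_map (subtopology (powertop_real UNIV) (standard_simplex 1)) euclidean (\<lambda>x. x 1)"
        by (rule continuous_map_from_subtopology) (rule continuous_map_product_projection, simp)
      show "(\<lambda>x. x 1) \<in> topspace (subtopology (powertop_real UNIV) (standard_simplex 1)) \<rightarrow> {0..1}"
        by (auto simp: standard_simplex_def)
    qed
    from continuous_map_compose[OF this path]
    show "continuous_map (subtopology (powertop_real UNIV) (standard_simplex 1)) M ?s"
      by (rule continuous_map_eq) auto
  qed simp
  then have chain: "singular_chain 1 M (frag_of ?s)" by (simp add: singular_chain_of)
  \<comment> \<open>Both faces are the constant 0-simplex at the base point, so they cancel.\<close>
  have "singular_face 1 0 ?s = singular_face 1 1 ?s"
    unfolding singular_face_def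
  proof (rule restrict_ext)
    fix x :: "nat \<Rightarrow> real" assume "x \<in> standard_simplex (1 - Suc 0)"
    then have x: "x \<in> standard_simplex 0" by simp
    then have "x 0 = 1" by (auto simp: standard_simplex_def)
    moreover have "simplical_face 0 x \<in> standard_simplex 1" "simplical_face 1 x \<in> standard_simplex 1"
      using x simplical_face_in_standard_simplex[of 1 _ x] by auto
    ultimately show "(?s \<circ> simplical_face 0) x = (?s \<circ> simplical_face 1) x"
      using ends by (simp add: simplical_face_def)
  qed
  then have "chain_boundary 1 (frag_of ?s) = 0" by (simp add: chain_boundary_of)
  then have "singular_relcycle 1 M {} (frag_of ?s)" using chain by (simp add: singular_relcycle)
  then show ?thesis
    using carrier_relative_homology_group[of 1 M "{}"] by (auto simp: curve_class_def)
qed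

context covered_surface
begin

text \<open>
  The factor by which \<open>\<partial>X\<close> changes cancels against the change of the velocity of the curve.
\<close>

lemma flux_integrand_in_chart:
  fixes X :: "'a \<Rightarrow> real ^ 'n"
  assumes X: "X \<in> Cr_maps M A r" "1 \<le> r" and c: "c \<in> A" and path: "pathin M \<gamma>"
    and uv: "0 \<le> u" "v \<le> 1" "\<gamma> ` {u<..<v} \<subseteq> fst c" and t: "t \<in> {u<..<v}"
    and D: "((snd c \<circ> \<gamma>) has_vector_derivative D) (at t)"
  shows "flux_integrand A X \<gamma> j t = Im (del_coeff c X (\<gamma> t) $ j * D)"
proof -
  define d where "d = chart_at A (\<gamma> t)"
  have tc: "\<gamma> t \<in> fst c" using uv t by blast
  then have "\<gamma> t \<in> topspace M" using chart_subset[OF c] by blast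
  then have d: "d \<in> A" "\<gamma> t \<in> fst d" using chart_at by (auto simp: d_def)
  obtain \<tau> where \<tau>: "\<tau> \<noteq> 0" "(transition c d has_field_derivative \<tau>) (at (snd c (\<gamma> t)) within overlap c d)"
    and del: "del_coeff c X (\<gamma> t) = \<tau> *s del_coeff d X (\<gamma> t)"
    using del_coeff_change[OF c d(1) tc d(2), where ?'n = 'n] X by metis
  define N where "N = {s \<in> {u<..<v}. \<gamma> s \<in> fst d}"
  have "openin (top_of_set {0..1}) {s \<in> {0..1}. \<gamma> s \<in> fst d}"
    using openin_continuous_map_preimage[OF path[unfolded pathin_def] chart_open[OF d(1)]] by simp
  then obtain O' where "open O'" "{s \<in> {0..1}. \<gamma> s \<in> fst d} = {0..1} \<inter> O'" by (auto simp: openin_open)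
  then have "N = {u<..<v} \<inter> O'" using uv by (auto simp: N_def set_eq_iff)
  then have "open N" using \<open>open O'\<close> by auto
  have tN: "t \<in> N" using t d by (simp add: N_def)
  have Nc: "\<gamma> s \<in> fst c \<inter> fst d" if "s \<in> N" for s using uv(3) that by (auto simp: N_def)
  then have sub: "(snd c \<circ> \<gamma>) ` N \<subseteq> overlap c d" by (auto simp: overlap_def)
  have "((snd c \<circ> \<gamma>) has_vector_derivative D) (at t within N)"
    using D has_vector_derivative_at_within by blast
  then have "((transition c d \<circ> (snd c \<circ> \<gamma>)) has_vector_derivative D * \<tau>) (at t within N)"
    using DERIV_subset[OF \<tau>(2) sub] by (intro field_vector_diff_chain_within) auto
  then have "((transition c d \<circ> (snd c \<circ> \<gamma>)) has_vector_derivative D * \<tau>) (at t)"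
    by (simp only: at_within_open[OF tN \<open>open N\<close>])
  then have "((snd d \<circ> \<gamma>) has_vector_derivative D * \<tau>) (at t)"
  proof (rule has_vector_derivative_transform_within_open[OF _ \<open>open N\<close> tN])
    fix s assume "s \<in> N"
    then have "\<gamma> s \<in> fst c" using Nc by blast
    then show "(transition c d \<circ> (snd c \<circ> \<gamma>)) s = (snd d \<circ> \<gamma>) s" by (simp add: transition_at[OF c])
  qed
  then have "vector_derivative (snd d \<circ> \<gamma>) (at t) = D * \<tau>" by (rule vector_derivative_at)
  then show ?thesis by (simp add: flux_integrand_def Let_def flip: d_def) (simp add: del algebra_simps)
qed

text \<open>
  Inside one chart and between two corners the integrand agrees, except possibly at the end points, with a
  continuous function that is bounded by a multiple of the \<open>C\<^sup>r\<close> norm of \<open>X\<close>.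
\<close>

lemma flux_piece_bound:
  assumes r: "1 \<le> r" and c: "c \<in> A" and path: "pathin M \<gamma>"
    and uv: "0 \<le> u" "u \<le> v" "v \<le> 1" "\<gamma> ` {u..v} \<subseteq> fst c"
    and D: "\<And>t. t \<in> {u..v} \<Longrightarrow> ((snd c \<circ> \<gamma>) has_vector_derivative D t) (at t within {u..v})" "continuous_on {u..v} D"
  shows "\<exists>C\<ge>0. \<forall>X :: 'a \<Rightarrow> real ^ 'n. X \<in> Cr_maps M A r \<longrightarrow>
    flux_integrand A X \<gamma> j integrable_on {u..v} \<and> \<bar>integral {u..v} (flux_integrand A X \<gamma> j)\<bar> \<le> C * Cr_norm X"
proof -
  let ?K = "\<gamma> ` {u..v}"
  have "compactin (top_of_set {0..1}) {u..v}" using uv by (simp add: compactin_subtopology)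
  then have "compactin M ?K" using image_compactin path unfolding pathin_def by blast
  then obtain C where "C > 0" and C: "\<And>(X :: 'a \<Rightarrow> real ^ 'n) p vs. X \<in> Cr_maps M A r \<Longrightarrow> p \<in> ?K \<Longrightarrow>
      vs \<in> words \<Longrightarrow> length vs \<le> r \<Longrightarrow> norm (chart_partial c vs X p) \<le> C * Cr_norm X"
    using chart_partial_bound[OF c _ uv(4), where ?'n = 'n] by metis
  have "bounded (D ` {u..v})" using D(2) by (intro compact_imp_bounded compact_continuous_image) auto
  then obtain B where "B > 0" and B: "\<And>t. t \<in> {u..v} \<Longrightarrow> norm (D t) \<le> B" by (auto simp: bounded_pos)
  show ?thesis
  proof (intro exI[of _ "2 * C * B * (v - u)"] conjI allI impI)
    show "0 \<le> 2 * C * B * (v - u)" using \<open>C > 0\<close> \<open>B > 0\<close> uv by simp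
    fix X :: "'a \<Rightarrow> real ^ 'n" assume X: "X \<in> Cr_maps M A r"
    let ?f = "\<lambda>t. Im (del_coeff c X (\<gamma> t) $ j * D t)"
    have cont_c: "continuous_on {u..v} (snd c \<circ> \<gamma>)"
      using D(1) has_vector_derivative_continuous continuous_on_eq_continuous_within by blast
    have "continuous_on (chart_image c) (partials (chart_image c) [w] (in_chart c X))" if "w \<in> {1, \<i>}" for w
      using X c that r by (intro Ck_on_continuous[of r]) (auto simp: Cr_maps_def)
    then have cont_w: "continuous_on (chart_image c) (wirtinger (chart_image c) (in_chart c X))"
      unfolding wirtinger_def by (intro continuous_intros) auto
    have "(snd c \<circ> \<gamma>) ` {u..v} \<subseteq> chart_image c" using uv(4) by (auto simp: chart_image_def)
    then have "continuous_on {u..v} (wirtinger (chart_image c) (in_chart c X) \<circ> (snd c \<circ> \<gamma>))"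
      by (intro continuous_on_compose[OF cont_c continuous_on_subset[OF cont_w]])
    then have "continuous_on {u..v} (\<lambda>t. del_coeff c X (\<gamma> t))" by (simp add: del_coeff_wirtinger o_def)
    then have cont: "continuous_on {u..v} ?f" using D(2) by (intro continuous_intros)
    have le: "norm (?f t) \<le> 2 * C * B * Cr_norm X" if t: "t \<in> {u..v}" for t
    proof -
      have "\<gamma> t \<in> ?K" using t by blast
      then have "norm (chart_partial c [w] X (\<gamma> t)) \<le> C * Cr_norm X" if "w \<in> {1, \<i>}" for w
        using that r by (intro C X) auto
      from this[of 1] this[of \<i>] have "norm (del_coeff c X (\<gamma> t)) \<le> 2 * C * Cr_norm X"
        using norm_del_coeff_le[of c X "\<gamma> t"] by simp
      then have 1: "norm (del_coeff c X (\<gamma> t) $ j) \<le> 2 * C * Cr_norm X"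
        using Finite_Cartesian_Product.norm_nth_le order_trans by blast
      have "norm (?f t) \<le> norm (del_coeff c X (\<gamma> t) $ j) * norm (D t)"
        using abs_Im_le_cmod[of "del_coeff c X (\<gamma> t) $ j * D t"] by (simp add: norm_mult)
      also have "\<dots> \<le> (2 * C * Cr_norm X) * B"
        using 1 B[OF t] \<open>C > 0\<close> Cr_norm_nonneg[OF X] by (intro mult_mono) auto
      finally show ?thesis by (simp add: mult_ac)
    qed
    have "(?f has_integral integral {u..v} ?f) (cbox u v)"
      using integrable_continuous_interval[OF cont] by (simp add: integrable_integral)
    moreover have "flux_integrand A X \<gamma> j t = ?f t" if t: "t \<in> box u v" for t
    proof (rule flux_integrand_in_chart[OF X r c path uv(1,3)])
      show "\<gamma> ` {u<..<v} \<subseteq> fst c" using uv(4) by force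
      show "t \<in> {u<..<v}" using t by simp
      have "((snd c \<circ> \<gamma>) has_vector_derivative D t) (at t within {u<..<v})"
        using D(1)[of t] t by (auto intro: has_vector_derivative_within_subset)
      then show "((snd c \<circ> \<gamma>) has_vector_derivative D t) (at t)"
        using t by (simp add: at_within_open[of _ "{u<..<v}"])
    qed
    ultimately have *: "(flux_integrand A X \<gamma> j has_integral integral {u..v} ?f) {u..v}"
      using has_integral_spike_interior[of ?f _ u v "flux_integrand A X \<gamma> j"] by simp
    then show "flux_integrand A X \<gamma> j integrable_on {u..v}" by blast
    have "2 * C * B * Cr_norm X * (v - u) = 2 * C * B * (v - u) * Cr_norm X" by simp
    then show "\<bar>integral {u..v} (flux_integrand A X \<gamma> j)\<bar> \<le> 2 * C * B * (v - u) * Cr_norm X"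
      using integral_bound[OF uv(2) cont le] unfolding integral_unique[OF *] by (simp only: real_norm_def)
  qed
qed

lemma finite_consecutive:
  fixes P :: "real set"
  assumes "finite P" "{0, 1} \<subseteq> P" "0 \<le> u" "u < v" "v \<le> 1" "{u<..<v} \<inter> P = {}"
  obtains a b where "a \<in> P" "b \<in> P" "a \<le> u" "v \<le> b" "{a<..<b} \<inter> P = {}"
proof -
  let ?L = "{p \<in> P. p \<le> u}" and ?R = "{p \<in> P. v \<le> p}"
  have fin: "finite ?L" "finite ?R" using assms(1) by auto
  have ne: "?L \<noteq> {}" "?R \<noteq> {}" using assms by auto
  have "p \<le> Max ?L \<or> Min ?R \<le> p" if "p \<in> P" for p
  proof -
    have "p \<le> u \<or> v \<le> p" using assms(6) that by (auto simp: disjoint_iff not_le)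
    then show ?thesis using fin that by auto
  qed
  then have "{Max ?L<..<Min ?R} \<inter> P = {}"
    unfolding disjoint_iff greaterThanLessThan_iff by (meson not_le)
  then show thesis using that[of "Max ?L" "Min ?R"] Max_in[OF fin(1) ne(1)] Min_in[OF fin(2) ne(2)] by auto
qed

text \<open>
  Every parameter has a neighbourhood on whose two halves \<open>flux_piece_bound\<close> applies, and Bolzano's
  bisection argument joins these intervals. Integrability makes the flux linear in \<open>X\<close>; the bound
  makes it continuous.
\<close>

lemma flux_bound:
  assumes r: "1 \<le> r" and \<gamma>: "closed_curve M A \<gamma>"
  shows "\<exists>C\<ge>0. \<forall>X :: 'a \<Rightarrow> real ^ 'n. X \<in> Cr_maps M A r \<longrightarrow>
    flux_integrand A X \<gamma> j integrable_on {0..1} \<and> \<bar>integral {0..1} (flux_integrand A X \<gamma> j)\<bar> \<le> C * Cr_norm X"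
proof -
  have path: "pathin M \<gamma>" using \<gamma> by (simp add: closed_curve_def)
  obtain P where P: "finite P" "{0, 1} \<subseteq> P" and
    C1_all: "\<forall>a\<in>P. \<forall>b\<in>P. a < b \<and> {a<..<b} \<inter> P = {} \<longrightarrow> C1_curve_on A {a..b} \<gamma>"
    using \<gamma> unfolding closed_curve_def by (elim conjE exE)
  have C1: "C1_curve_on A {a..b} \<gamma>" if "a \<in> P" "b \<in> P" "a < b" "{a<..<b} \<inter> P = {}" for a b
    using bspec[OF bspec[OF C1_all that(1)] that(2)] that(3,4) by simp
  define good where "good a b \<longleftrightarrow> (\<exists>C\<ge>0. \<forall>X :: 'a \<Rightarrow> real ^ 'n. X \<in> Cr_maps M A r \<longrightarrow>
    flux_integrand A X \<gamma> j integrable_on {a..b} \<and> \<bar>integral {a..b} (flux_integrand A X \<gamma> j)\<bar> \<le> C * Cr_norm X)" for a b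
  have join: "good a c" if ab: "good a b" and bc: "good b c" and le: "a \<le> b" "b \<le> c" for a b c
  proof -
    obtain C1 C2 where C: "C1 \<ge> 0" "C2 \<ge> 0" and
      1: "\<And>X :: 'a \<Rightarrow> real ^ 'n. X \<in> Cr_maps M A r \<Longrightarrow>
        flux_integrand A X \<gamma> j integrable_on {a..b} \<and> \<bar>integral {a..b} (flux_integrand A X \<gamma> j)\<bar> \<le> C1 * Cr_norm X" and
      2: "\<And>X :: 'a \<Rightarrow> real ^ 'n. X \<in> Cr_maps M A r \<Longrightarrow>
        flux_integrand A X \<gamma> j integrable_on {b..c} \<and> \<bar>integral {b..c} (flux_integrand A X \<gamma> j)\<bar> \<le> C2 * Cr_norm X"
      using ab bc unfolding good_def by blast
    have "flux_integrand A X \<gamma> j integrable_on {a..c} \<and> \<bar>integral {a..c} (flux_integrand A X \<gamma> j)\<bar> \<le> (C1 + C2) * Cr_norm X"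
      if X: "X \<in> Cr_maps M A r" for X :: "'a \<Rightarrow> real ^ 'n"
    proof
      show int: "flux_integrand A X \<gamma> j integrable_on {a..c}"
        using Henstock_Kurzweil_Integration.integrable_combine[OF le] 1[OF X] 2[OF X] by blast
      show "\<bar>integral {a..c} (flux_integrand A X \<gamma> j)\<bar> \<le> (C1 + C2) * Cr_norm X"
        using Henstock_Kurzweil_Integration.integral_combine[OF le int] 1[OF X] 2[OF X]
        unfolding distrib_right by linarith
    qed
    then show ?thesis unfolding good_def using C by (intro exI[of _ "C1 + C2"]) auto
  qed
  have piece: "good u v" if c: "c \<in> A" and uv: "0 \<le> u" "u \<le> v" "v \<le> 1" "\<gamma> ` {u..v} \<subseteq> fst c" "{u<..<v} \<inter> P = {}" for c u v
  proof (cases "u = v")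
    case True
    have "g integrable_on {v}" for g :: "real \<Rightarrow> real" using integrable_on_refl[of g v] by simp
    then show ?thesis unfolding good_def using True by (intro exI[of _ 0]) auto
  next
    case False
    then obtain a b where ab: "a \<in> P" "b \<in> P" "a \<le> u" "v \<le> b" "{a<..<b} \<inter> P = {}"
      using finite_consecutive[OF P uv(1) _ uv(3,5)] uv(2) by (metis order_le_less)
    then have "C1_curve_on A {a..b} \<gamma>" using C1 uv False by auto
    then obtain D where D: "\<And>t. t \<in> {t \<in> {a..b}. \<gamma> t \<in> fst c} \<Longrightarrow> ((snd c \<circ> \<gamma>) has_vector_derivative D t) (at t within {t \<in> {a..b}. \<gamma> t \<in> fst c})"
      "continuous_on {t \<in> {a..b}. \<gamma> t \<in> fst c} D"
      using c unfolding C1_curve_on_def Let_def by (cases c) fastforce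
    have sub: "{u..v} \<subseteq> {t \<in> {a..b}. \<gamma> t \<in> fst c}" using uv ab by auto
    show ?thesis
      unfolding good_def
      by (rule flux_piece_bound[OF r c path uv(1-4)])
        (use D sub continuous_on_subset has_vector_derivative_within_subset in blast)+
  qed
  have "0 \<le> (0::real) \<longrightarrow> (1::real) \<le> 1 \<longrightarrow> good 0 1"
  proof (rule Bolzano[where P = "\<lambda>a b. 0 \<le> a \<longrightarrow> b \<le> 1 \<longrightarrow> good a b"])
    show "0 \<le> a \<longrightarrow> c \<le> 1 \<longrightarrow> good a c"
      if "0 \<le> a \<longrightarrow> b \<le> 1 \<longrightarrow> good a b" "0 \<le> b \<longrightarrow> c \<le> 1 \<longrightarrow> good b c" "a \<le> b" "b \<le> c" for a b c
      using that join by auto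
    show "\<exists>d>0. \<forall>a b. a \<le> x \<and> x \<le> b \<and> b - a < d \<longrightarrow> 0 \<le> a \<longrightarrow> b \<le> 1 \<longrightarrow> good a b"
      if local: "0 \<le> x" "x \<le> 1" for x
    proof -
      have "\<gamma> x \<in> topspace M"
        using path local continuous_map_image_subset_topspace unfolding pathin_def by fastforce
      then obtain c where c: "c \<in> A" "\<gamma> x \<in> fst c" using charts_cover by blast
      have "openin (top_of_set {0..1}) {s \<in> {0..1}. \<gamma> s \<in> fst c}"
        using openin_continuous_map_preimage[OF path[unfolded pathin_def] chart_open[OF c(1)]] by simp
      then obtain e where e: "e > 0" "ball x e \<inter> {0..1} \<subseteq> {s \<in> {0..1}. \<gamma> s \<in> fst c}"
        using c local unfolding openin_contains_ball by auto
      \<comment> \<open>Near \<open>x\<close> the curve stays in the chart and has no corner other than possibly \<open>x\<close> itself.\<close>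
      have "open (- (P - {x}))" using P by (intro open_Compl finite_imp_closed) auto
      then obtain e' where e': "e' > 0" "ball x e' \<subseteq> - (P - {x})" by (rule openE) auto
      have "good a b" if ab: "a \<le> x" "x \<le> b" "b - a < min e e'" "0 \<le> a" "b \<le> 1" for a b
      proof -
        have near: "{a..b} \<subseteq> ball x e" "{a..b} \<subseteq> ball x e'" using ab by (auto simp: dist_real_def)
        have "\<gamma> t \<in> fst c" if "t \<in> {a..b}" for t using e(2) near(1) ab that by force
        then have chart: "\<gamma> ` {a..b} \<subseteq> fst c" by blast
        have only: "t = x" if "t \<in> {a..b}" "t \<in> P" for t using e'(2) near(2) that by force
        have "t \<notin> P" if "t \<in> {a<..<x} \<union> {x<..<b}" for t using only[of t] that ab by auto
        then have "{a<..<x} \<inter> P = {}" "{x<..<b} \<inter> P = {}" by blast+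
        moreover have "\<gamma> ` {a..x} \<subseteq> fst c" "\<gamma> ` {x..b} \<subseteq> fst c" using chart ab by auto
        ultimately show ?thesis
          using ab by (intro join[of a x b] piece[OF c(1)]) auto
      qed
      then show ?thesis using e(1) e'(1) by (intro exI[of _ "min e e'"]) auto
    qed
  qed simp
  then show ?thesis by (simp add: good_def)
qed

lemma integral_Im_del_lin_comb:
  fixes X Y :: "'a \<Rightarrow> real ^ 'n"
  assumes X: "X \<in> Cr_maps M A r" and Y: "Y \<in> Cr_maps M A r" and r: "1 \<le> r" and \<gamma>: "closed_curve M A \<gamma>"
  shows "integral_Im_del A (lin_comb M a X b Y) \<gamma> = a *\<^sub>R integral_Im_del A X \<gamma> + b *\<^sub>R integral_Im_del A Y \<gamma>"
proof -
  have path: "\<gamma> t \<in> topspace M" if "t \<in> {0..1}" for t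
    using \<gamma> that continuous_map_image_subset_topspace unfolding closed_curve_def pathin_def by fastforce
  have "integral {0..1} (flux_integrand A (lin_comb M a X b Y) \<gamma> j)
      = a * integral {0..1} (flux_integrand A X \<gamma> j) + b * integral {0..1} (flux_integrand A Y \<gamma> j)" for j
  proof -
    have int: "flux_integrand A X \<gamma> j integrable_on {0..1}" "flux_integrand A Y \<gamma> j integrable_on {0..1}"
      using flux_bound[OF r \<gamma>, of j] X Y by blast+
    have "flux_integrand A (lin_comb M a X b Y) \<gamma> j t = a * flux_integrand A X \<gamma> j t + b * flux_integrand A Y \<gamma> j t"
      if "t \<in> {0..1}" for t
      using del_coeff_lin_comb[OF X Y r, of "chart_at A (\<gamma> t)" "\<gamma> t" a b] chart_at[OF path[OF that]]
      by (simp add: flux_integrand_def Let_def algebra_simps)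
    then have "integral {0..1} (flux_integrand A (lin_comb M a X b Y) \<gamma> j)
        = integral {0..1} (\<lambda>t. a * flux_integrand A X \<gamma> j t + b * flux_integrand A Y \<gamma> j t)"
      by (rule integral_cong)
    also have "\<dots> = a * integral {0..1} (flux_integrand A X \<gamma> j) + b * integral {0..1} (flux_integrand A Y \<gamma> j)"
      using integrable_cmul[OF int(1), of a] integrable_cmul[OF int(2), of b] by (subst integral_add) auto
    finally show ?thesis .
  qed
  then show ?thesis by (simp add: integral_Im_del_eq vec_eq_iff)
qed

lemma integral_Im_del_limit:
  fixes X :: "'a \<Rightarrow> real ^ 'n"
  assumes \<sigma>: "\<And>n. \<sigma> n \<in> Cr_maps M A r" and X: "X \<in> Cr_maps M A r"
    and lim: "(\<lambda>n. norm_dist Cr_module (\<sigma> n) X) \<longlonglongrightarrow> 0"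
    and r: "1 \<le> r" and \<gamma>: "closed_curve M A \<gamma>" and zero: "\<And>n. integral_Im_del A (\<sigma> n) \<gamma> = 0"
  shows "integral_Im_del A X \<gamma> = 0"
proof -
  have "integral_Im_del A X \<gamma> $ j = 0" for j
  proof -
    obtain C where C: "C \<ge> 0" "\<And>X :: 'a \<Rightarrow> real ^ 'n. X \<in> Cr_maps M A r \<Longrightarrow>
        \<bar>integral {0..1} (flux_integrand A X \<gamma> j)\<bar> \<le> C * Cr_norm X"
      using flux_bound[OF r \<gamma>, of j] by metis
    have "\<bar>integral_Im_del A X \<gamma> $ j\<bar> \<le> C * norm_dist Cr_module (\<sigma> n) X" for n
    proof -
      have "integral_Im_del A (lin_comb M 1 (\<sigma> n) (-1) X) \<gamma> = - integral_Im_del A X \<gamma>"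
        using integral_Im_del_lin_comb[OF \<sigma>[of n] X r \<gamma>, of 1 "-1"] zero by simp
      then have "\<bar>integral_Im_del A X \<gamma> $ j\<bar> = \<bar>integral {0..1} (flux_integrand A (lin_comb M 1 (\<sigma> n) (-1) X) \<gamma> j)\<bar>"
        by (metis abs_minus_cancel integral_Im_del_eq vec_lambda_beta vector_uminus_component)
      also have "\<dots> \<le> C * norm_dist Cr_module (\<sigma> n) X"
        using C(2)[OF lin_comb_Cr[OF \<sigma>[of n] X]] by (simp only: norm_dist_Cr[OF \<sigma> X])
      finally show ?thesis .
    qed
    moreover have "(\<lambda>n. C * norm_dist Cr_module (\<sigma> n) X) \<longlonglongrightarrow> 0"
      using tendsto_mult_right_zero[OF lim] .
    ultimately have "\<bar>integral_Im_del A X \<gamma> $ j\<bar> \<le> 0" using LIMSEQ_le_const by blast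
    then show ?thesis by simp
  qed
  then show ?thesis by (simp add: vec_eq_iff)
qed

section \<open>The two spaces of immersions\<close>

lemma closed_subspace_Cr:
  fixes V :: "('a \<Rightarrow> real ^ 'n) set"
  assumes V: "V \<subseteq> Cr_maps M A r" "(\<lambda>p\<in>topspace M. 0) \<in> V"
    and lin: "\<And>X Y a b. X \<in> V \<Longrightarrow> Y \<in> V \<Longrightarrow> lin_comb M a X b Y \<in> V"
    and closed: "\<And>\<sigma> X. (\<And>n. \<sigma> n \<in> V) \<Longrightarrow> X \<in> Cr_maps M A r \<Longrightarrow>
      (\<lambda>n. norm_dist Cr_module (\<sigma> n) X) \<longlonglongrightarrow> 0 \<Longrightarrow> X \<in> V"
  shows "closed_subspace Cr_module V"
proof -
  let ?N = "Cr_module :: ('a \<Rightarrow> real ^ 'n) normed_module"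
  interpret N: banach_module ?N by standard (rule Cr_Banach)
  have "submodule V real_field ?N"
  proof (rule N.submoduleI)
    show "\<ominus>\<^bsub>?N\<^esub> X \<in> V" if "X \<in> V" for X
      using N.minus_eq_smult[of X] V(1) that lin[OF that that, of "-1" 0] by auto
  qed (use V lin in auto)
  moreover have "closedin (norm_topology ?N) V"
    unfolding norm_topology_def N.metric.metric_closedin_iff_sequentially_closed N.metric.limitin_metric_dist_null
    using V(1) closed by (auto simp: image_subset_iff)
  ultimately show ?thesis
    using Cr_Banach by (intro closed_subspace.intro banach_module.intro closed_subspace_axioms.intro)
qed

lemma lin_comb_sub_add:
  assumes "X \<in> Cr_maps M A r" shows "lin_comb M 1 (lin_comb M 1 X (-1) Y) 1 Y = X"
  using Cr_extensional[OF assms] by (auto simp: lin_comb_def fun_eq_iff)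

text \<open>
  The criterion is asked for every base point \<open>Y \<in> S\<close>, and so it can be used with any point of a
  nonempty \<open>S\<close>; the empty space has the empty atlas.
\<close>

lemma manifold_in_Cr:
  fixes V S G :: "('a \<Rightarrow> real ^ 'n) set"
  assumes "closed_subspace Cr_module V" "openin (norm_topology Cr_module) G" "S \<subseteq> Cr_maps M A r"
    and affine: "\<And>X Y. X \<in> Cr_maps M A r \<Longrightarrow> Y \<in> S \<Longrightarrow> X \<in> S \<longleftrightarrow> lin_comb M 1 X (-1) Y \<in> V \<and> X \<in> G"
  shows "real_analytic_Banach_manifold (subtopology (Cr_topology M A r) S)"
proof (cases "S = {}")
  case True then show ?thesis by (simp only: empty_manifold)
next
  case False
  then obtain Y where Y: "Y \<in> S" by blast
  interpret closed_subspace "Cr_module :: ('a \<Rightarrow> real ^ 'n) normed_module" V by fact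
  have YC: "Y \<in> Cr_maps M A r" using Y assms(3) by blast
  show ?thesis
    unfolding norm_topology_Cr[symmetric]
  proof (rule open_in_affine_subspace_manifold[OF _ assms(2) Y])
    show "S \<subseteq> carrier Cr_module" using assms(3) by simp
    show "X \<in> S \<longleftrightarrow> X \<ominus>\<^bsub>Cr_module\<^esub> Y \<in> V \<and> X \<in> G" if "X \<in> carrier Cr_module" for X
      using that affine[of X Y] Y Cr_module_minus[of X Y] YC by simp
  qed
qed

lemma Gauss_map_manifold:
  fixes f :: "'a \<Rightarrow> complex ^ 'n"
  assumes r: "1 \<le> r" and f: "f ` topspace M \<subseteq> null_quadric_punctured"
  shows "real_analytic_Banach_manifold (subtopology (Cr_topology M A r)
    {X. conformal_minimal_immersion M A r X \<and> (\<forall>p \<in> topspace M. Gauss_map A X p = proj_point (f p))})"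
  unfolding immersions_with_Gauss_map[OF r f]
proof (rule manifold_in_Cr)
  let ?L = "directed_harmonic_maps M A r f"
  show "closed_subspace Cr_module ?L"
  proof (rule closed_subspace_Cr)
    show "?L \<subseteq> Cr_maps M A r" by (auto simp: directed_harmonic_maps_def)
  qed (fact zero_directed[OF r], fact directed_harmonic_maps_lin_comb[OF r], fact directed_harmonic_maps_closed[OF r])
  show "openin (norm_topology Cr_module) (nondegenerate_maps M A r)"
    using nondegenerate_maps_open[OF r] .
  show "?L \<inter> nondegenerate_maps M A r \<subseteq> Cr_maps M A r" by (auto simp: nondegenerate_maps_def)
  fix X Y :: "'a \<Rightarrow> real ^ 'n"
  assume X: "X \<in> Cr_maps M A r" and Y: "Y \<in> ?L \<inter> nondegenerate_maps M A r"
  then show "X \<in> ?L \<inter> nondegenerate_maps M A r \<longleftrightarrow> lin_comb M 1 X (-1) Y \<in> ?L \<and> X \<in> nondegenerate_maps M A r"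
    using directed_harmonic_maps_lin_comb[OF r] lin_comb_sub_add[OF X] by (metis IntD1 IntD2 IntI)
qed

lemma complexify_inject: "complexify a = complexify b \<longleftrightarrow> a = b"
  by (simp add: complexify_def vec_eq_iff)

text \<open>
  Let \<open>Y\<close> be one immersion of the space and \<open>F\<close> its flux map. Because \<^const>\<open>complexify\<close> is injective, every
  immersion \<open>X\<close> of the space has the same flux as \<open>Y\<close> along closed curves; conversely, if the fluxes agree then
  \<open>F\<close> is a flux map of \<open>X\<close>. So the condition on the flux is that \<open>X - Y\<close> has vanishing integrals, a closed
  linear condition.
\<close>

lemma flux_manifold:
  fixes f :: "'a \<Rightarrow> complex ^ 'n"
  assumes r: "1 \<le> r" and f: "f ` topspace M \<subseteq> null_quadric_punctured"
  shows "real_analytic_Banach_manifold (subtopology (Cr_topology M A r)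
    {X. conformal_minimal_immersion M A r X \<and> (\<forall>p \<in> topspace M. Gauss_map A X p = proj_point (f p)) \<and>
      (\<exists>F. is_flux_map M A X F \<and> (\<forall>h \<in> carrier (homology_group 1 M). complexify (F h) = \<i> *s q h))})"
    (is "real_analytic_Banach_manifold (subtopology _ ?S)")
proof (rule manifold_in_Cr)
  let ?L = "directed_harmonic_maps M A r f" and ?O = "nondegenerate_maps M A r :: ('a \<Rightarrow> real ^ 'n) set"
  let ?V = "{X \<in> ?L. \<forall>\<gamma>. closed_curve M A \<gamma> \<longrightarrow> integral_Im_del A X \<gamma> = 0}"
  have LC: "X \<in> Cr_maps M A r" if "X \<in> ?L" for X using that by (simp add: directed_harmonic_maps_def)
  show "closed_subspace Cr_module ?V"
  proof (rule closed_subspace_Cr)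
    show "?V \<subseteq> Cr_maps M A r" using LC by blast
    have "integral_Im_del A (\<lambda>p\<in>topspace M. 0 :: real ^ 'n) \<gamma> = 0" if "closed_curve M A \<gamma>" for \<gamma>
    proof -
      have "lin_comb M 0 (\<lambda>p\<in>topspace M. 0 :: real ^ 'n) 0 (\<lambda>p\<in>topspace M. 0) = (\<lambda>p\<in>topspace M. 0)"
        by (auto simp: lin_comb_def fun_eq_iff)
      then show ?thesis
        using integral_Im_del_lin_comb[OF zero_Cr zero_Cr r that, of 0 0, where ?'n = 'n] by simp
    qed
    then show "(\<lambda>p\<in>topspace M. 0) \<in> ?V" using zero_directed[OF r] by blast
    show "lin_comb M a X b Y \<in> ?V" if X: "X \<in> ?V" and Y: "Y \<in> ?V" for X Y a b
    proof -
      have XL: "X \<in> ?L" and YL: "Y \<in> ?L" using X Y by blast+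
      have "integral_Im_del A (lin_comb M a X b Y) \<gamma> = 0" if "closed_curve M A \<gamma>" for \<gamma>
        using integral_Im_del_lin_comb[OF LC[OF XL] LC[OF YL] r that, of a b] X Y that by simp
      then show ?thesis using directed_harmonic_maps_lin_comb[OF r XL YL] by blast
    qed
    show "X \<in> ?V" if \<sigma>: "\<And>n. \<sigma> n \<in> ?V" and X: "X \<in> Cr_maps M A r"
      and lim: "(\<lambda>n. norm_dist Cr_module (\<sigma> n) X) \<longlonglongrightarrow> 0" for \<sigma> X
    proof -
      have "\<sigma> n \<in> ?L" for n using \<sigma> by blast
      then have "X \<in> ?L" by (rule directed_harmonic_maps_closed[OF r _ X lim])
      moreover have "integral_Im_del A X \<gamma> = 0" if "closed_curve M A \<gamma>" for \<gamma>
        using \<sigma> LC that by (intro integral_Im_del_limit[OF _ X lim r that]) auto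
      ultimately show ?thesis by blast
    qed
  qed
  show "openin (norm_topology Cr_module) ?O" using nondegenerate_maps_open[OF r] .
  have S_eq: "X \<in> ?S \<longleftrightarrow> X \<in> ?L \<and> X \<in> ?O \<and>
      (\<exists>F. is_flux_map M A X F \<and> (\<forall>h \<in> carrier (homology_group 1 M). complexify (F h) = \<i> *s q h))" for X
    using immersions_with_Gauss_map[OF r f] by blast
  show "?S \<subseteq> Cr_maps M A r" using S_eq LC by blast
  fix X Y :: "'a \<Rightarrow> real ^ 'n"
  assume X: "X \<in> Cr_maps M A r" and Y: "Y \<in> ?S"
  let ?D = "lin_comb M 1 X (-1) Y"
  have YL: "Y \<in> ?L" using Y S_eq by blast
  obtain F where F: "is_flux_map M A Y F" "\<And>h. h \<in> carrier (homology_group 1 M) \<Longrightarrow> complexify (F h) = \<i> *s q h"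
    using Y by blast
  have XL: "X \<in> ?L \<longleftrightarrow> ?D \<in> ?L"
    using directed_harmonic_maps_lin_comb[OF r] lin_comb_sub_add[OF X] YL by metis
  have int: "integral_Im_del A ?D \<gamma> = integral_Im_del A X \<gamma> - integral_Im_del A Y \<gamma>" if "closed_curve M A \<gamma>" for \<gamma>
    using integral_Im_del_lin_comb[OF X LC[OF YL] r that, of 1 "-1"] by simp
  have "(\<exists>F'. is_flux_map M A X F' \<and> (\<forall>h \<in> carrier (homology_group 1 M). complexify (F' h) = \<i> *s q h))
      \<longleftrightarrow> (\<forall>\<gamma>. closed_curve M A \<gamma> \<longrightarrow> integral_Im_del A ?D \<gamma> = 0)"
  proof
    assume "\<exists>F'. is_flux_map M A X F' \<and> (\<forall>h \<in> carrier (homology_group 1 M). complexify (F' h) = \<i> *s q h)"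
    then obtain F' where F': "is_flux_map M A X F'" "\<And>h. h \<in> carrier (homology_group 1 M) \<Longrightarrow> complexify (F' h) = \<i> *s q h"
      by blast
    have "F h = F' h" if "h \<in> carrier (homology_group 1 M)" for h
      using F(2)[OF that] F'(2)[OF that] complexify_inject by metis
    then show "\<forall>\<gamma>. closed_curve M A \<gamma> \<longrightarrow> integral_Im_del A ?D \<gamma> = 0"
      using F(1) F'(1) curve_class_in_homology[of M A] int by (simp add: is_flux_map_def)
  next
    assume "\<forall>\<gamma>. closed_curve M A \<gamma> \<longrightarrow> integral_Im_del A ?D \<gamma> = 0"
    then have "is_flux_map M A X F" using F(1) int by (simp add: is_flux_map_def)
    then show "\<exists>F'. is_flux_map M A X F' \<and> (\<forall>h \<in> carrier (homology_group 1 M). complexify (F' h) = \<i> *s q h)"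
      using F(2) by blast
  qed
  then show "X \<in> ?S \<longleftrightarrow> ?D \<in> ?V \<and> X \<in> ?O" using S_eq XL by blast
qed

end

theorem corollary6p3:
  fixes M :: "'a topology" and A :: "'a chart set" and f :: "'a \<Rightarrow> complex ^ 'n"
  assumes "compact_bordered_Riemann_surface M A"
    and "CARD('n) \<ge> 3"
    and "class_A M A f"
    and "f ` topspace M \<subseteq> null_quadric_punctured"
  shows "(\<forall>r::nat. r \<ge> 1 \<longrightarrow>
      real_analytic_Banach_manifold (subtopology (Cr_topology M A r)
        {X :: 'a \<Rightarrow> real ^ 'n. conformal_minimal_immersion M A r X \<and>
          (\<forall>p \<in> topspace M. Gauss_map A X p = proj_point (f p))}))
    \<and>
    (\<forall>r::nat. r \<ge> 1 \<longrightarrow>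
      (\<forall>q \<in> hom (homology_group 1 M)
              (additive_group_on (vec.span (f ` topspace M) \<inter> {z. \<forall>j. Re (z $ j) = 0})).
        real_analytic_Banach_manifold (subtopology (Cr_topology M A r)
          {X :: 'a \<Rightarrow> real ^ 'n. conformal_minimal_immersion M A r X \<and>
            (\<forall>p \<in> topspace M. Gauss_map A X p = proj_point (f p)) \<and>
            (\<exists>F. is_flux_map M A X F \<and>
              (\<forall>h \<in> carrier (homology_group 1 M). complexify (F h) = \<i> *s q h))})))"
proof -
  interpret bordered_surface M A using assms(1) by (rule bordered_surface.intro)
  obtain \<K> where "finite \<K>" "\<And>c K. (c, K) \<in> \<K> \<Longrightarrow> c \<in> A \<and> compactin M K \<and> K \<subseteq> fst c"
    "\<And>p. p \<in> topspace M \<Longrightarrow> \<exists>c K. (c, K) \<in> \<K> \<and> p \<in> K"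
    using compact_chart_cover by metis
  then have cover: "covered_surface M A \<K>"
    by (intro covered_surface.intro covered_surface_axioms.intro bordered_surface_axioms)
  show ?thesis
    using covered_surface.Gauss_map_manifold[OF cover _ assms(4)] covered_surface.flux_manifold[OF cover _ assms(4)]
    by blast
qed

end
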